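(* Let $T>0$, let $p,\tilde p\in AC[0,T]$ and $q,\tilde q\in L(0,T)$ be complex-valued with $\int_0^T p(x)\,dx=\int_0^T\tilde p(x)\,dx$. Let $\sigma_1$ be a complex-valued function of bounded variation on $[0,T]$, continuous from the right for $t>0$, with $H_1:=\sigma_1(+0)-\sigma_1(0)\neq 0$, and let $U_1(y)=\int_0^T y(t)\,d\sigma_1(t)$ (the same form for both pairs $(p,q)$ and $(\tilde p,\tilde q)$). Let $\{\lambda_{n1}\}_{n\in\mathbb{Z}}$ and $\{\lambda_{n1}^1\}_{n\in\mathbb{Z}}$ be the eigenvalues, counted with multiplicities, of the boundary value problems $$y''+[\lambda^2-2\lambda p(x)-q(x)]y=0,\quad U_1(y)=y(T)=0,$$ and $$y''+[\lambda^2-2\lambda p(x)-q(x)]y=0,\quad U_1(y)=y'(T)=0,$$ on $(0,T)$, respectively, and let $\{\tilde\lambda_{n1}\}_{n\in\mathbb{Z}}$, $\{\tilde\lambda_{n1}^1\}_{n\in\mathbb{Z}}$ be the corresponding eigenvalues for $(\tilde p,\tilde q)$. If $\lambda_{n1}=\tilde\lambda_{n1}$ and $\lambda_{n1}^1=\tilde\lambda_{n1}^1$ for all $n\in\mathbb{Z}$, then $p(x)=\tilde p(x)$ for all $x\in(0,T)$ and $q(x)=\tilde q(x)$ for almost every $x\in(0,T)$.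
   Context: $AC[0,T]$ is the set of absolutely continuous functions on $[0,T]$ and $L(0,T)$ the set of Lebesgue integrable functions on $(0,T)$. Solutions of $$y''(x)+[\lambda^2-2\lambda p(x)-q(x)]y(x)=0,\quad x\in(0,T),\qquad ( * )$$ have $y,y'$ absolutely continuous on $[0,T]$ and satisfy $( * )$ almost everywhere. The Stieltjes integral $\int_0^T y(t)\,d\sigma_1(t)$ includes the possible jump of $\sigma_1$ at $0$, i.e. $U_1(y)=H_1y(0)+\int_0^T y(t)\,d\sigma_{10}(t)$, where $\sigma_{10}$ is of bounded variation and continuous from the right for $t\ge0$. Let $X_1(x,\lambda),X_2(x,\lambda)$ be the solutions of $( * )$ with $X_1(0,\lambda)=X_2'(0,\lambda)=1$, $X_1'(0,\lambda)=X_2(0,\lambda)=0$. Set $V_1(y):=y(T)$, $V_2(y):=y'(T)$. The eigenvalues $\lambda_{n1}$ counted with multiplicities are the zeros, counted with multiplicities, of the entire characteristic function $\Delta_1(\lambda):=U_1(X_1)V_1(X_2)-U_1(X_2)V_1(X_1)$, and the eigenvalues $\lambda_{n1}^1$ counted with multiplicities are the zeros, counted with multiplicities, of the entire characteristic function $\Delta_{11}(\lambda):=U_1(X_1)V_2(X_2)-U_1(X_2)V_2(X_1)$. Objects with a tilde are defined in the same way with $(\tilde p,\tilde q)$ in place of $(p,q)$. *)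

theory Defs
  imports "HOL-Complex_Analysis.Complex_Analysis"
begin

text \<open>
  A finite family of non-overlapping closed subintervals of \<open>{a..b}\<close> is a \<open>division_of\<close> of its own
  union. For a nonempty interval \<open>K = {u..v}\<close> one has \<open>Inf K = u\<close> and \<open>Sup K = v\<close>; degenerate
  intervals \<open>{u..u}\<close> are allowed and contribute \<open>0\<close> to all the sums below.
\<close>

definition abs_continuous_on_ivl :: "real \<Rightarrow> real \<Rightarrow> (real \<Rightarrow> complex) \<Rightarrow> bool" where
  "abs_continuous_on_ivl a b f \<longleftrightarrow>
     (\<forall>e>0. \<exists>d>0. \<forall>D. D division_of \<Union>D \<and> \<Union>D \<subseteq> {a..b} \<and> (\<Sum>K\<in>D. Sup K - Inf K) < d \<longrightarrow>
        (\<Sum>K\<in>D. norm (f (Sup K) - f (Inf K))) < e)"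

definition bounded_variation_on_ivl :: "real \<Rightarrow> real \<Rightarrow> (real \<Rightarrow> complex) \<Rightarrow> bool" where
  "bounded_variation_on_ivl a b f \<longleftrightarrow>
     (\<exists>B. \<forall>D. D division_of {a..b} \<longrightarrow> (\<Sum>K\<in>D. norm (f (Sup K) - f (Inf K))) \<le> B)"

text \<open>
  Riemann-Stieltjes integral over the closed interval, as a limit for mesh tending to \<open>0\<close>. The
  increment over the first interval of a partition involves the value of the integrator at the left
  end point itself, so a jump \<open>s(a+) - s(a)\<close> there contributes \<open>(s(a+) - s(a)) * y(a)\<close>.
\<close>

definition has_stieltjes_integral ::
  "real \<Rightarrow> real \<Rightarrow> (real \<Rightarrow> complex) \<Rightarrow> (real \<Rightarrow> complex) \<Rightarrow> complex \<Rightarrow> bool" where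
  "has_stieltjes_integral a b s y I \<longleftrightarrow>
     (\<forall>e>0. \<exists>d>0. \<forall>D. D tagged_division_of {a..b} \<and> (\<forall>(x, K)\<in>D. Sup K - Inf K < d) \<longrightarrow>
        norm ((\<Sum>(x, K)\<in>D. y x * (s (Sup K) - s (Inf K))) - I) < e)"

definition stieltjes_integral ::
  "real \<Rightarrow> real \<Rightarrow> (real \<Rightarrow> complex) \<Rightarrow> (real \<Rightarrow> complex) \<Rightarrow> complex" where
  "stieltjes_integral a b s y = (THE I. has_stieltjes_integral a b s y I)"

definition deriv_ivl :: "real \<Rightarrow> (real \<Rightarrow> complex) \<Rightarrow> real \<Rightarrow> complex" where
  \<comment> \<open>one-sided at the end points of \<open>{0..T}\<close>\<close>
  "deriv_ivl T y x = vector_derivative y (at x within {0..T})"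

definition pencil_solution ::
  "real \<Rightarrow> (real \<Rightarrow> complex) \<Rightarrow> (real \<Rightarrow> complex) \<Rightarrow> complex \<Rightarrow> (real \<Rightarrow> complex) \<Rightarrow> bool" where
  "pencil_solution T p q l y \<longleftrightarrow>
     (\<forall>x\<in>{0..T}. y differentiable (at x within {0..T})) \<and>
     abs_continuous_on_ivl 0 T y \<and> abs_continuous_on_ivl 0 T (deriv_ivl T y) \<and>
     (AE x in lebesgue. x \<in> {0<..<T} \<longrightarrow>
        (\<exists>y2. (deriv_ivl T y has_vector_derivative y2) (at x) \<and>
              y2 + (l\<^sup>2 - 2 * l * p x - q x) * y x = 0))"

text \<open>
  On \<open>{0..T}\<close> the solution of an initial value problem is unique; the values of the chosen function
  outside \<open>{0..T}\<close> are never used.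
\<close>

definition X1 ::
  "real \<Rightarrow> (real \<Rightarrow> complex) \<Rightarrow> (real \<Rightarrow> complex) \<Rightarrow> complex \<Rightarrow> real \<Rightarrow> complex" where
  "X1 T p q l = (SOME y. pencil_solution T p q l y \<and> y 0 = 1 \<and> deriv_ivl T y 0 = 0)"

definition X2 ::
  "real \<Rightarrow> (real \<Rightarrow> complex) \<Rightarrow> (real \<Rightarrow> complex) \<Rightarrow> complex \<Rightarrow> real \<Rightarrow> complex" where
  "X2 T p q l = (SOME y. pencil_solution T p q l y \<and> y 0 = 0 \<and> deriv_ivl T y 0 = 1)"

definition U1 :: "real \<Rightarrow> (real \<Rightarrow> complex) \<Rightarrow> (real \<Rightarrow> complex) \<Rightarrow> complex" where
  "U1 T s y = stieltjes_integral 0 T s y"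

definition V1 :: "real \<Rightarrow> (real \<Rightarrow> complex) \<Rightarrow> complex" where
  "V1 T y = y T"

definition V2 :: "real \<Rightarrow> (real \<Rightarrow> complex) \<Rightarrow> complex" where
  "V2 T y = deriv_ivl T y T"

definition Delta1 ::
  "real \<Rightarrow> (real \<Rightarrow> complex) \<Rightarrow> (real \<Rightarrow> complex) \<Rightarrow> (real \<Rightarrow> complex) \<Rightarrow> complex \<Rightarrow> complex" where
  "Delta1 T s p q l =
     U1 T s (X1 T p q l) * V1 T (X2 T p q l) - U1 T s (X2 T p q l) * V1 T (X1 T p q l)"

definition Delta11 ::
  "real \<Rightarrow> (real \<Rightarrow> complex) \<Rightarrow> (real \<Rightarrow> complex) \<Rightarrow> (real \<Rightarrow> complex) \<Rightarrow> complex \<Rightarrow> complex" where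
  "Delta11 T s p q l =
     U1 T s (X1 T p q l) * V2 T (X2 T p q l) - U1 T s (X2 T p q l) * V2 T (X1 T p q l)"

definition enumerates_zeros :: "(complex \<Rightarrow> complex) \<Rightarrow> (int \<Rightarrow> complex) \<Rightarrow> bool" where
  \<comment> \<open>every zero occurs exactly as often as its order; the first conjunct excludes \<open>f = 0\<close>, for which
      \<open>zorder\<close> would be meaningless\<close>
  "enumerates_zeros f lam \<longleftrightarrow>
     range lam = {z. f z = 0} \<and>
     (\<forall>z. f z = 0 \<longrightarrow> finite {n. lam n = z} \<and> int (card {n. lam n = z}) = zorder f z)"

end

theory Submission
  imports Defs
begin

text \<open>
  Write \<open>S\<^sub>a\<close> and \<open>C\<^sub>a\<close> for the solutions of the equation with \<open>S\<^sub>a(a) = 0\<close>, \<open>S\<^sub>a'(a) = 1\<close> and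
  \<open>C\<^sub>a(a) = 1\<close>, \<open>C\<^sub>a'(a) = 0\<close>, and \<open>U\<^sub>a(y)\<close> for the Stieltjes integral of \<open>y\<close> over \<open>[0, a]\<close>. Expanding
  \<open>S\<^sub>T\<close> and \<open>C\<^sub>T\<close> in the fundamental system at \<open>0\<close> shows that the two characteristic functions are
  \<open>- U\<^sub>T(S\<^sub>T)\<close> and \<open>U\<^sub>T(C\<^sub>T)\<close>. The theorem thus says that these two functions of \<open>\<lambda>\<close>, known up to their zeros,
  determine the coefficients.
  
  From zeros to functions. A solution with data at \<open>a\<close> is at most of size \<open>exp (\<bar>Im \<lambda>\<bar> (a - t))\<close> at \<open>t < a\<close>, so
  for large \<open>\<bar>Im \<lambda>\<bar>\<close> it is concentrated near \<open>t = 0\<close>. The integrator has the jump \<open>H \<noteq> 0\<close> there and little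
  variation just to the right of \<open>0\<close>; hence \<open>U\<^sub>a(y) \<approx> H y(0)\<close> (\<open>U_asymptotics\<close>), and \<open>y(0)\<close> is known to leading order
  (\<open>asymptotics\<close>). Consequently \<open>\<lambda> U\<^sub>T(S\<^sub>T)\<close> and \<open>U\<^sub>T(C\<^sub>T)\<close> are bounded by a multiple of \<open>exp (T \<bar>Im \<lambda>\<bar>)\<close>
  everywhere, and from below by such a multiple outside a strip \<open>\<bar>Im \<lambda>\<bar> < K\<close>. Two functions of this kind with
  the same zeros have an entire quotient that is bounded: outside the strip by these estimates, inside by a
  normal family argument (\<open>entire_quotient_bounded\<close>). By Liouville it is constant, and because \<open>p\<close> and \<open>pt\<close> have
  the same integral the leading terms agree, so the constant is \<open>1\<close>.
  
  From functions to coefficients. Suppose that \<open>U\<^sub>a(S\<^sub>a)\<close> and \<open>U\<^sub>a(C\<^sub>a)\<close> are the same for both equations, and fix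
  \<open>x \<in> [a/2, a]\<close>. The combination \<open>C\<^sub>a(x) U\<^sub>a(S\<^sub>a) - S\<^sub>a(x) U\<^sub>a(C\<^sub>a)\<close> is the value of \<open>U\<^sub>a\<close> at the solution normalised
  at \<open>x\<close>, which is of size \<open>exp (\<bar>Im \<lambda>\<bar> \<bar>t - x\<bar>) / \<bar>\<lambda>\<bar>\<close>, and \<open>\<bar>t - x\<bar> \<le> x\<close> on \<open>[0, a]\<close> exactly because
  \<open>x \<ge> a/2\<close>. Comparing with the lower bound for \<open>U\<^sub>a(S\<^sub>a)\<close>, the entire function
  \<open>S\<^sub>a(x) C\<^sub>a~(x) - C\<^sub>a(x) S\<^sub>a~(x)\<close> of \<open>\<lambda>\<close> is \<open>O(1/\<bar>\<lambda>\<bar>)\<close>, hence zero (\<open>cross_zero\<close>). Together with the Wronskians this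
  gives \<open>S\<^sub>a = S\<^sub>a~\<close> and \<open>C\<^sub>a = C\<^sub>a~\<close> on \<open>[a/2, a]\<close> (\<open>solutions_agree\<close>), so the coefficients agree there. The parts
  of the Stieltjes integrals over \<open>[a/2, a]\<close> then agree as well, and a change of basis gives the same hypothesis
  for \<open>a/2\<close> in place of \<open>a\<close> (\<open>same_U_half\<close>). Starting from \<open>a = T\<close>, the intervals \<open>[T/2^(n+1), T/2^n]\<close> exhaust
  \<open>(0, T]\<close>.
  
  Since \<open>q\<close> is merely integrable, the second derivative of a solution exists only almost everywhere. All growth
  estimates are therefore reduced to one monotonicity statement, \<open>abs_cont_increasing\<close>: an absolutely continuous
  function with nonnegative derivative almost everywhere is increasing. Existence of solutions needs in addition
  that an indefinite integral is differentiable almost everywhere.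
\<close>

section \<open>Differentiating indefinite integrals\<close>

lemma integral_over_segment:
  fixes f :: "real \<Rightarrow> 'a::euclidean_space"
  assumes f: "f integrable_on {a..b}" and x: "a \<le> x" "x \<le> b" "a \<le> x + s" "x + s \<le> b"
  shows "norm (measure lborel {min x (x+s)..max x (x+s)} *\<^sub>R f x - integral {min x (x+s)..max x (x+s)} f)
       = norm (integral {a..x+s} f - integral {a..x} f - s *\<^sub>R f x)"
proof (cases "s \<ge> 0")
  case True
  have "f integrable_on {a..x+s}"
    using f by (rule integrable_subinterval_real) (use x in auto)
  then have "integral {a..x} f + integral {x..x+s} f = integral {a..x+s} f"
    using x True by (intro Henstock_Kurzweil_Integration.integral_combine) auto
  then have *: "integral {a..x+s} f - integral {a..x} f = integral {x..x+s} f"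
    by (simp add: algebra_simps)
  show ?thesis unfolding * using True by (simp add: min_def max_def norm_minus_commute)
next
  case False
  have "f integrable_on {a..x}"
    using f by (rule integrable_subinterval_real) (use x in auto)
  then have "integral {a..x+s} f + integral {x+s..x} f = integral {a..x} f"
    using x False by (intro Henstock_Kurzweil_Integration.integral_combine) auto
  then have *: "integral {a..x+s} f - integral {a..x} f = - integral {x+s..x} f"
    by (simp add: algebra_simps)
  show ?thesis unfolding * using False
    by (simp add: min_def max_def) (metis add.commute minus_diff_commute)
qed

text \<open>
  Lebesgue's differentiation theorem in one variable, by Vitali covering. Points where the difference quotients
  stay at distance \<open>1/(k+1)\<close> from \<open>f\<close> are covered by arbitrarily short segments on which \<open>f\<close> and its integral
  disagree by more than the length over \<open>k+1\<close>; by Henstock's lemma disjoint fine segments of this kind have small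
  total length, and their fivefold enlargements still cover.
\<close>

theorem indefinite_integral_has_vector_derivative_ae:
  fixes f :: "real \<Rightarrow> 'a::euclidean_space"
  assumes f: "f integrable_on {a..b}"
  obtains N where "negligible N"
    "\<And>x. x \<in> {a<..<b} - N \<Longrightarrow> ((\<lambda>t. integral {a..t} f) has_vector_derivative f x) (at x)"
proof -
  define F where "F t = integral {a..t} f" for t
  define R where "R x s = norm (F (x + s) - F x - s *\<^sub>R f x)" for x s
  define Bad where "Bad k = {x\<in>{a<..<b}. \<forall>d>0. \<exists>s. s \<noteq> 0 \<and> \<bar>s\<bar> < d \<and> \<bar>s\<bar> < R x s * (real k + 1)}" for k :: nat
  have neg: "negligible (Bad k)" for k
    unfolding negligible_outer_le
  proof (intro allI impI)
    fix e :: real assume e: "e > 0"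
    define e' where "e' = e / (5 * (real k + 1))"
    have e': "e' > 0" using e by (simp add: e'_def)
    have fint: "f integrable_on cbox a b" using f by simp
    obtain \<gamma> where \<gamma>: "gauge \<gamma>"
      and hen: "\<And>p. \<lbrakk>p tagged_partial_division_of cbox a b; \<gamma> fine p\<rbrakk> \<Longrightarrow>
          (\<Sum>(x,K)\<in>p. norm (measure lborel K *\<^sub>R f x - integral K f)) < e'"
      by (rule Henstock_lemma[OF fint e'], rule that, assumption, blast)
    \<comment> \<open>A pair \<open>(x, s)\<close> with \<open>s \<noteq> 0\<close> of either sign stands for the segment from \<open>x\<close> to \<open>x + s\<close>, tagged by its end point \<open>x\<close>.\<close>
    define J where "J = (\<lambda>(x::real,s). {min x (x+s)..max x (x+s)})"
    define c r where "c = (\<lambda>(x::real,s::real). x + s/2)" and "r = (\<lambda>(x::real,s::real). \<bar>s\<bar>/2)"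
    have Jc: "J i = cball (c i) (r i)" for i
    proof (cases i)
      case (Pair x s)
      have "x + s/2 - s/2 = x" "x + s/2 + s/2 = x + s" "x + s/2 - (-s)/2 = x + s" "x + s/2 + (-s)/2 = x" by simp_all
      then show ?thesis unfolding Pair J_def c_def r_def cball_eq_atLeastAtMost prod.case
        by (cases "s \<ge> 0") (simp_all only: min_def max_def abs_if, auto)
    qed
    define I where "I = {(x,s). x \<in> {a<..<b} \<and> s \<noteq> 0 \<and> \<bar>s\<bar> \<le> 1 \<and> J (x,s) \<subseteq> \<gamma> x \<inter> {a<..<b} \<and> \<bar>s\<bar> < R x s * (real k + 1)}"
    have I_D: "x \<in> {a<..<b}" "J (x,s) \<subseteq> \<gamma> x" "J (x,s) \<subseteq> {a<..<b}" "\<bar>s\<bar> < R x s * (real k + 1)"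
      if "(x,s) \<in> I" for x s
      using that unfolding I_def by blast+
    have I_ex: "\<exists>s. (x,s) \<in> I" if xB: "x \<in> Bad k" for x
    proof -
      have x: "x \<in> {a<..<b}" using xB by (simp add: Bad_def)
      have "open (\<gamma> x \<inter> {a<..<b})" "x \<in> \<gamma> x \<inter> {a<..<b}" using \<gamma> x by (auto simp: gauge_def)
      then obtain d where d: "d > 0" "ball x d \<subseteq> \<gamma> x \<inter> {a<..<b}"
        using openE by blast
      have "min d 1 > 0" using d(1) by simp
      then obtain s where s: "s \<noteq> 0" "\<bar>s\<bar> < min d 1" "\<bar>s\<bar> < R x s * (real k + 1)"
        using xB unfolding Bad_def by blast
      have "y \<in> ball x d" if "y \<in> J (x,s)" for y
      proof -
        have "min x (x+s) \<le> y" "y \<le> max x (x+s)" using that by (auto simp: J_def)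
        then have "\<bar>x - y\<bar> < d" using s(2) by linarith
        then show ?thesis by (simp add: dist_real_def)
      qed
      then have "J (x,s) \<subseteq> \<gamma> x \<inter> {a<..<b}" using d(2) by blast
      moreover have "\<bar>s\<bar> \<le> 1" using s(2) by linarith
      ultimately have "(x,s) \<in> I" using s x unfolding I_def by blast
      then show ?thesis ..
    qed
    have rI: "0 < r i \<and> r i \<le> 1" if "i \<in> I" for i
      using that unfolding I_def r_def by auto
    obtain C where C: "countable C" "C \<subseteq> I"
      and disj: "pairwise (\<lambda>i j. disjnt (cball (c i) (r i)) (cball (c j) (r j))) C"
      and cov: "\<And>i. i \<in> I \<Longrightarrow> \<exists>j. j \<in> C \<and> \<not> disjnt (cball (c i) (r i)) (cball (c j) (r j)) \<and> cball (c i) (r i) \<subseteq> ball (c j) (5 * r j)"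
      by (rule Vitali_covering_lemma_cballs_balls[of I r 1 c, OF rI], assumption, rule that, assumption, assumption, assumption, blast)
    have fin: "measure lebesgue (\<Union>i\<in>D. ball (c i) (5 * r i)) \<le> e" if D: "D \<subseteq> C" "finite D" for D
    proof -
      define g where "g = (\<lambda>(x,s). (x, J (x,s)))"
      have J_mem: "x \<in> J (x,s)" for x s by (simp add: J_def)
      have g_disj: "J i \<inter> J j = {}" if "i \<in> D" "j \<in> D" "i \<noteq> j" for i j
        using disj that D(1) unfolding pairwise_def Jc disjnt_def by blast
      have inj: "inj_on g D"
      proof (rule inj_onI)
        fix i j assume ij: "i \<in> D" "j \<in> D" "g i = g j"
        have "fst i \<in> J i" using J_mem by (metis prod.collapse)
        moreover have "J i = J j" using ij(3) by (simp add: g_def split: prod.splits)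
        ultimately show "i = j" using g_disj[OF ij(1,2)] by blast
      qed
      have tag: "g ` D tagged_partial_division_of cbox a b"
        unfolding tagged_partial_division_of_def
      proof (intro conjI allI impI)
        show "finite (g ` D)" using D by simp
      next
        fix x K assume "(x,K) \<in> g ` D"
        then obtain s where s: "(x,s) \<in> D" "K = J (x,s)" by (auto simp: g_def)
        show "x \<in> K" using s by (auto simp: J_def)
        have "(x,s) \<in> I" using s C(2) D(1) by blast
        then have "K \<subseteq> {a<..<b}" using I_D(3) s(2) by blast
        then show "K \<subseteq> cbox a b" by (auto simp: subset_iff)
        show "\<exists>u v. K = cbox u v" using s by (auto simp: J_def)
      next
        fix x1 K1 x2 K2 assume h: "(x1,K1) \<in> g ` D \<and> (x2,K2) \<in> g ` D \<and> (x1,K1) \<noteq> (x2,K2)"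
        then obtain s1 s2 where s: "(x1,s1) \<in> D" "K1 = J (x1,s1)" "(x2,s2) \<in> D" "K2 = J (x2,s2)"
          by (auto simp: g_def)
        then have "K1 \<inter> K2 = {}" using g_disj[of "(x1,s1)" "(x2,s2)"] h by auto
        then show "interior K1 \<inter> interior K2 = {}" using interior_subset by blast
      qed
      have fine: "\<gamma> fine g ` D"
      proof (rule fineI)
        fix x K assume "(x,K) \<in> g ` D"
        then obtain s where s: "(x,s) \<in> D" "K = J (x,s)" by (auto simp: g_def)
        then have "(x,s) \<in> I" using C(2) D(1) by blast
        then show "K \<subseteq> \<gamma> x" using I_D(2) s(2) by blast
      qed
      have "(\<Sum>(x,s)\<in>D. R x s) = (\<Sum>(x,K)\<in>g ` D. norm (measure lborel K *\<^sub>R f x - integral K f))"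
        unfolding sum.reindex[OF inj] o_def
      proof (rule sum.cong[OF refl])
        fix i assume i: "i \<in> D"
        obtain x s where xs: "i = (x,s)" by (cases i)
        have "(x,s) \<in> I" using i xs C(2) D(1) by blast
        then have "J (x,s) \<subseteq> {a<..<b}" by (rule I_D(3))
        moreover have "x \<in> J (x,s)" "x + s \<in> J (x,s)" by (auto simp: J_def)
        ultimately have "x \<in> {a<..<b}" "x + s \<in> {a<..<b}" by blast+
        then have "a \<le> x" "x \<le> b" "a \<le> x+s" "x+s \<le> b" by auto
        from integral_over_segment[OF f this]
        show "(case i of (x,s) \<Rightarrow> R x s) = (case g i of (x, K) \<Rightarrow> norm (measure lborel K *\<^sub>R f x - integral K f))"
          unfolding xs g_def R_def F_def J_def by simp
      qed
      then have small: "(\<Sum>(x,s)\<in>D. R x s) < e'" using hen[OF tag fine] by simp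
      have "measure lebesgue (\<Union>i\<in>D. ball (c i) (5 * r i)) \<le> (\<Sum>i\<in>D. measure lebesgue (ball (c i) (5 * r i)))"
        using D by (intro measure_UNION_le) auto
      also have "\<dots> \<le> (\<Sum>(x,s)\<in>D. 5 * (real k + 1) * R x s)"
      proof (rule sum_mono, clarify)
        fix x s assume i: "(x,s) \<in> D"
        then have "(x,s) \<in> I" using C(2) D(1) by blast
        then have "\<bar>s\<bar> < R x s * (real k + 1)" by (rule I_D(4))
        moreover have "measure lebesgue (ball (c (x,s)) (5 * r (x,s))) = 5 * \<bar>s\<bar>"
          by (simp add: ball_eq_greaterThanLessThan r_def c_def)
        ultimately show "measure lebesgue (ball (c (x,s)) (5 * r (x,s))) \<le> 5 * (real k + 1) * R x s"
          by (simp add: algebra_simps)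
      qed
      also have "\<dots> = 5 * (real k + 1) * (\<Sum>(x,s)\<in>D. R x s)"
        by (simp add: sum_distrib_left case_prod_beta)
      also have "\<dots> \<le> 5 * (real k + 1) * e'" using small by (intro mult_left_mono) auto
      also have "\<dots> = e" by (simp add: e'_def)
      finally show ?thesis .
    qed
    have "(\<Union>i\<in>C. ball (c i) (5 * r i)) \<in> lmeasurable \<and> measure lebesgue (\<Union>i\<in>C. ball (c i) (5 * r i)) \<le> e"
      by (intro conjI fmeasurable_UN_bound[OF C(1) _ fin] measure_UN_bound[OF C(1) _ fin])
         (use e in auto)
    moreover have "Bad k \<subseteq> (\<Union>i\<in>C. ball (c i) (5 * r i))"
    proof
      fix x assume "x \<in> Bad k"
      then obtain s where s: "(x,s) \<in> I" using I_ex by blast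
      then obtain j where "j \<in> C" "J (x,s) \<subseteq> ball (c j) (5 * r j)" using cov unfolding Jc by blast
      moreover have "x \<in> J (x,s)" by (auto simp: J_def)
      ultimately show "x \<in> (\<Union>i\<in>C. ball (c i) (5 * r i))" by blast
    qed
    ultimately show "\<exists>T. Bad k \<subseteq> T \<and> T \<in> lmeasurable \<and> measure lebesgue T \<le> e" by blast
  qed
  show ?thesis
  proof (rule that)
    show "negligible (\<Union>k. Bad k)" using neg by (intro negligible_countable_Union) auto
    fix x assume x: "x \<in> {a<..<b} - (\<Union>k. Bad k)"
    have "\<exists>d>0. \<forall>y. norm (y - x) < d \<longrightarrow> norm (F y - F x - (y - x) *\<^sub>R f x) \<le> e * norm (y - x)" if e: "e > 0" for e
    proof -
      obtain k where "inverse (real (Suc k)) < e" using reals_Archimedean[OF e] by blast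
      then have k: "1 / (real k + 1) < e" by (simp add: inverse_eq_divide add.commute)
      have "x \<notin> Bad k" using x by blast
      have xab: "x \<in> {a<..<b}" using x by (rule DiffD1)
      have "\<not> (\<forall>d>0. \<exists>s. s \<noteq> 0 \<and> \<bar>s\<bar> < d \<and> \<bar>s\<bar> < R x s * (real k + 1))"
      proof
        assume "\<forall>d>0. \<exists>s. s \<noteq> 0 \<and> \<bar>s\<bar> < d \<and> \<bar>s\<bar> < R x s * (real k + 1)"
        then have "x \<in> Bad k" unfolding Bad_def mem_Collect_eq by (rule conjI[OF xab])
        with \<open>x \<notin> Bad k\<close> show False ..
      qed
      then obtain d where d: "d > 0" "\<not> (\<exists>s. s \<noteq> 0 \<and> \<bar>s\<bar> < d \<and> \<bar>s\<bar> < R x s * (real k + 1))"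
        by blast
      have dR: "R x s * (real k + 1) \<le> \<bar>s\<bar>" if "s \<noteq> 0" "\<bar>s\<bar> < d" for s
        using d(2) that by (meson not_less)
      have "norm (F y - F x - (y - x) *\<^sub>R f x) \<le> e * norm (y - x)" if "norm (y - x) < d" for y
      proof (cases "y = x")
        case False
        then have "R x (y - x) * (real k + 1) \<le> \<bar>y - x\<bar>" using dR[of "y - x"] that by simp
        then have "R x (y - x) \<le> 1 / (real k + 1) * \<bar>y - x\<bar>" by (simp add: field_simps)
        also have "\<dots> \<le> e * \<bar>y - x\<bar>" using k by (intro mult_right_mono) auto
        finally show ?thesis by (simp add: R_def)
      qed auto
      then show ?thesis using d(1) by blast
    qed
    then have "(F has_vector_derivative f x) (at x)"
      unfolding has_vector_derivative_def has_derivative_at_alt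
      using bounded_linear_scaleR_left by blast
    then show "((\<lambda>t. integral {a..t} f) has_vector_derivative f x) (at x)"
      unfolding F_def .
  qed
qed

section \<open>Absolutely continuous functions\<close>

text \<open>
  The notion of the statement for values in any normed space: energies of solutions are real-valued.
\<close>

definition abs_cont :: "real \<Rightarrow> real \<Rightarrow> (real \<Rightarrow> 'a::real_normed_vector) \<Rightarrow> bool" where
  "abs_cont a b f \<longleftrightarrow>
     (\<forall>e>0. \<exists>d>0. \<forall>D. D division_of \<Union>D \<and> \<Union>D \<subseteq> {a..b} \<and> (\<Sum>K\<in>D. Sup K - Inf K) < d \<longrightarrow>
        (\<Sum>K\<in>D. norm (f (Sup K) - f (Inf K))) < e)"

lemma abs_continuous_on_ivl_iff_abs_cont: "abs_continuous_on_ivl a b f \<longleftrightarrow> abs_cont a b f"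
  unfolding abs_continuous_on_ivl_def abs_cont_def ..

lemma division_real_interval:
  fixes D :: "real set set"
  assumes D: "D division_of \<Union>D" "\<Union>D \<subseteq> {a..b}" and K: "K \<in> D"
  shows "K = {Inf K..Sup K}" "a \<le> Inf K" "Inf K \<le> Sup K" "Sup K \<le> b"
proof -
  obtain u v where uv: "K = {u..v}" using division_ofD(4)[OF D(1) K] by auto
  have "K \<noteq> {}" using division_ofD(3)[OF D(1) K] .
  then have le: "u \<le> v" using uv by auto
  then have "Inf K = u" "Sup K = v" unfolding uv by auto
  moreover have "K \<subseteq> {a..b}" using D(2) K by blast
  ultimately show "K = {Inf K..Sup K}" "a \<le> Inf K" "Inf K \<le> Sup K" "Sup K \<le> b" using uv le by auto
qed

text \<open>
  All closure properties below are instances: an increment bounded by increments of absolutely continuous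
  functions is small when these are.
\<close>

lemma abs_cont_dominated:
  assumes f: "abs_cont a b f" and g: "abs_cont a b g"
    and le: "\<And>u v. a \<le> u \<Longrightarrow> u \<le> v \<Longrightarrow> v \<le> b \<Longrightarrow> norm (h v - h u) \<le> M * (norm (f v - f u) + norm (g v - g u))"
  shows "abs_cont a b h"
  unfolding abs_cont_def
proof (intro allI impI)
  fix e :: real assume e: "e > 0"
  define e' where "e' = e / (\<bar>M\<bar> + 1) / 2"
  have e': "e' > 0" using e by (simp add: e'_def)
  obtain d1 where d1: "d1 > 0" "\<And>D. D division_of \<Union>D \<and> \<Union>D \<subseteq> {a..b} \<and> (\<Sum>K\<in>D. Sup K - Inf K) < d1 \<Longrightarrow>
        (\<Sum>K\<in>D. norm (f (Sup K) - f (Inf K))) < e'"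
    using f e' unfolding abs_cont_def by blast
  obtain d2 where d2: "d2 > 0" "\<And>D. D division_of \<Union>D \<and> \<Union>D \<subseteq> {a..b} \<and> (\<Sum>K\<in>D. Sup K - Inf K) < d2 \<Longrightarrow>
        (\<Sum>K\<in>D. norm (g (Sup K) - g (Inf K))) < e'"
    using g e' unfolding abs_cont_def by blast
  show "\<exists>d>0. \<forall>D. D division_of \<Union>D \<and> \<Union>D \<subseteq> {a..b} \<and> (\<Sum>K\<in>D. Sup K - Inf K) < d \<longrightarrow>
        (\<Sum>K\<in>D. norm (h (Sup K) - h (Inf K))) < e"
  proof (intro exI[of _ "min d1 d2"] conjI allI impI)
    show "min d1 d2 > 0" using d1 d2 by simp
    fix D :: "real set set" assume D: "D division_of \<Union>D \<and> \<Union>D \<subseteq> {a..b} \<and> (\<Sum>K\<in>D. Sup K - Inf K) < min d1 d2"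
    let ?F = "\<Sum>K\<in>D. norm (f (Sup K) - f (Inf K))" and ?G = "\<Sum>K\<in>D. norm (g (Sup K) - g (Inf K))"
    have "(\<Sum>K\<in>D. norm (h (Sup K) - h (Inf K)))
        \<le> (\<Sum>K\<in>D. (\<bar>M\<bar> + 1) * (norm (f (Sup K) - f (Inf K)) + norm (g (Sup K) - g (Inf K))))"
    proof (rule sum_mono)
      fix K assume K: "K \<in> D"
      note K' = division_real_interval[of D a b, OF _ _ K]
      have "norm (h (Sup K) - h (Inf K)) \<le> M * (norm (f (Sup K) - f (Inf K)) + norm (g (Sup K) - g (Inf K)))"
        using K' D by (intro le) auto
      also have "\<dots> \<le> (\<bar>M\<bar> + 1) * (norm (f (Sup K) - f (Inf K)) + norm (g (Sup K) - g (Inf K)))"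
        by (intro mult_right_mono) auto
      finally show "norm (h (Sup K) - h (Inf K)) \<le> (\<bar>M\<bar> + 1) * (norm (f (Sup K) - f (Inf K)) + norm (g (Sup K) - g (Inf K)))" .
    qed
    also have "\<dots> = (\<bar>M\<bar> + 1) * (?F + ?G)"
      by (simp add: sum_distrib_left[symmetric] sum.distrib)
    also have "\<dots> < (\<bar>M\<bar> + 1) * (e' + e')"
    proof (rule mult_strict_left_mono)
      have "?F < e'" "?G < e'" using D by (intro d1 d2; simp)+
      then show "?F + ?G < e' + e'" by simp
    qed simp
    also have "\<dots> = e" 
    proof -
      have "\<bar>M\<bar> + 1 \<noteq> 0" using abs_ge_zero[of M] by linarith
      moreover have "e' + e' = e / (\<bar>M\<bar> + 1)" by (simp only: e'_def field_sum_of_halves)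
      ultimately show ?thesis by simp
    qed
    finally show "(\<Sum>K\<in>D. norm (h (Sup K) - h (Inf K))) < e" .
  qed
qed

lemma abs_cont_id: "abs_cont a b (\<lambda>x. x)"
  unfolding abs_cont_def
proof (intro allI impI exI conjI)
  fix e :: real and D :: "real set set"
  assume e: "0 < e" and D: "D division_of \<Union>D \<and> \<Union>D \<subseteq> {a..b} \<and> (\<Sum>K\<in>D. Sup K - Inf K) < e"
  have "(\<Sum>K\<in>D. norm (Sup K - Inf K)) = (\<Sum>K\<in>D. Sup K - Inf K)"
    using D by (intro sum.cong) (auto dest: division_real_interval(3)[of D a b])
  then show "(\<Sum>K\<in>D. norm (Sup K - Inf K)) < e" using D by simp
qed

lemma abs_cont_of_lipschitz:
  fixes h :: "real \<Rightarrow> 'a::real_normed_vector"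
  assumes "\<And>u v. a \<le> u \<Longrightarrow> u \<le> v \<Longrightarrow> v \<le> b \<Longrightarrow> norm (h v - h u) \<le> M * (v - u)"
  shows "abs_cont a b h"
proof (rule abs_cont_dominated[OF abs_cont_id abs_cont_id, where M="M/2"])
  fix u v assume uv: "a \<le> u" "u \<le> v" "v \<le> b"
  have "M / 2 * (norm (v - u) + norm (v - u)) = M * (v - u)" using uv by (simp add: algebra_simps)
  then show "norm (h v - h u) \<le> M / 2 * (norm (v - u) + norm (v - u))" using assms[OF uv] by (simp only:)
qed

lemma abs_cont_const: "abs_cont a b (\<lambda>x. c)"
  by (rule abs_cont_of_lipschitz[where M=0]) simp

lemma abs_cont_continuous:
  assumes f: "abs_cont a b f"
  shows "continuous_on {a..b} f"
  unfolding continuous_on_iff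
proof (intro ballI allI impI)
  fix x e :: real assume x: "x \<in> {a..b}" and e: "e > 0"
  obtain d where d: "d > 0" "\<And>D. D division_of \<Union>D \<and> \<Union>D \<subseteq> {a..b} \<and> (\<Sum>K\<in>D. Sup K - Inf K) < d \<Longrightarrow>
        (\<Sum>K\<in>D. norm (f (Sup K) - f (Inf K))) < e"
    using f e unfolding abs_cont_def by blast
  have *: "norm (f v - f u) < e" if "u \<le> v" "a \<le> u" "v \<le> b" "v - u < d" for u v
  proof -
    have "{{u..v}} division_of \<Union>{{u..v}}" using that division_of_self[of u v] by simp
    with that show ?thesis using d(2)[of "{{u..v}}"] by simp
  qed
  show "\<exists>d>0. \<forall>x'\<in>{a..b}. dist x' x < d \<longrightarrow> dist (f x') (f x) < e"
  proof (intro exI[of _ d] conjI ballI impI)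
    fix y assume y: "y \<in> {a..b}" "dist y x < d"
    show "dist (f y) (f x) < e"
    proof (cases "x \<le> y")
      case True then show ?thesis using *[of x y] x y by (simp add: dist_norm)
    next
      case False then show ?thesis using *[of y x] x y by (simp add: dist_norm norm_minus_commute)
    qed
  qed (use d in auto)
qed

lemma abs_cont_bounded:
  assumes "abs_cont a b f"
  obtains B where "B > 0" "\<And>x. x \<in> {a..b} \<Longrightarrow> norm (f x) \<le> B"
proof -
  have "bounded (f ` {a..b})"
    by (intro compact_imp_bounded compact_continuous_image abs_cont_continuous assms) simp
  then show ?thesis using that unfolding bounded_pos by auto
qed

lemma abs_cont_add:
  assumes "abs_cont a b f" "abs_cont a b g" shows "abs_cont a b (\<lambda>x. f x + g x)"
proof (rule abs_cont_dominated[OF assms, of _ 1])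
  fix u v
  have "f v + g v - (f u + g u) = (f v - f u) + (g v - g u)" by simp
  then show "norm (f v + g v - (f u + g u)) \<le> 1 * (norm (f v - f u) + norm (g v - g u))"
    by (simp only: mult_1 norm_triangle_ineq)
qed

lemma (in bounded_bilinear) abs_cont:
  assumes f: "abs_cont a b f" and g: "abs_cont a b g"
  shows "abs_cont a b (\<lambda>x. prod (f x) (g x))"
proof -
  obtain A where A: "A > 0" "\<And>x. x \<in> {a..b} \<Longrightarrow> norm (f x) \<le> A" by (rule abs_cont_bounded[OF f], rule that)
  obtain B where B: "B > 0" "\<And>x. x \<in> {a..b} \<Longrightarrow> norm (g x) \<le> B" by (rule abs_cont_bounded[OF g], rule that)
  obtain K where K: "K > 0" "\<And>x y. norm (prod x y) \<le> norm x * norm y * K" using pos_bounded by blast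
  show ?thesis
  proof (rule abs_cont_dominated[OF f g, of _ "K * (A + B)"])
    fix u v assume uv: "a \<le> u" "u \<le> v" "v \<le> b"
    have "prod (f v) (g v) - prod (f u) (g u) = prod (f v) (g v - g u) + prod (f v - f u) (g u)"
      by (simp add: diff_left diff_right)
    then have "norm (prod (f v) (g v) - prod (f u) (g u)) \<le> norm (prod (f v) (g v - g u)) + norm (prod (f v - f u) (g u))"
      by (simp only: norm_triangle_ineq)
    also have "\<dots> \<le> norm (f v) * norm (g v - g u) * K + norm (f v - f u) * norm (g u) * K"
      by (intro add_mono K)
    also have "\<dots> \<le> (A + B) * norm (g v - g u) * K + norm (f v - f u) * (A + B) * K"
      using A(2)[of v] B(2)[of u] A(1) B(1) K(1) uv
      by (intro add_mono mult_right_mono mult_left_mono) auto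
    finally show "norm (prod (f v) (g v) - prod (f u) (g u)) \<le> K * (A + B) * (norm (f v - f u) + norm (g v - g u))"
      by (simp add: algebra_simps)
  qed
qed

lemmas abs_cont_mult = bounded_bilinear.abs_cont[OF bounded_bilinear_mult]
  and abs_cont_inner = bounded_bilinear.abs_cont[OF bounded_bilinear_inner]

lemma abs_cont_cmult: "abs_cont a b f \<Longrightarrow> abs_cont a b (\<lambda>x. c * f x)"
  for f :: "real \<Rightarrow> 'a::real_normed_algebra"
  by (rule abs_cont_mult[OF abs_cont_const])

lemma abs_cont_diff:
  fixes f :: "real \<Rightarrow> 'a::real_normed_vector"
  assumes "abs_cont a b f" "abs_cont a b g" shows "abs_cont a b (\<lambda>x. f x - g x)"
proof (rule abs_cont_dominated[OF assms, of _ 1])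
  fix u v
  have "f v - g v - (f u - g u) = (f v - f u) - (g v - g u)" by simp
  then show "norm (f v - g v - (f u - g u)) \<le> 1 * (norm (f v - f u) + norm (g v - g u))"
    by (simp only: mult_1 norm_triangle_ineq4)
qed

lemma abs_cont_exp:
  fixes f :: "real \<Rightarrow> 'a::{banach,real_normed_field}"
  assumes f: "abs_cont a b f"
  shows "abs_cont a b (\<lambda>x. exp (f x))"
proof -
  obtain A where A: "A > 0" "\<And>x. x \<in> {a..b} \<Longrightarrow> norm (f x) \<le> A" by (rule abs_cont_bounded[OF f], rule that)
  show ?thesis
  proof (rule abs_cont_dominated[OF f f, of _ "exp A"])
    fix u v assume uv: "a \<le> u" "u \<le> v" "v \<le> b"
    have "norm (exp (f v) - exp (f u)) \<le> exp A * norm (f v - f u)"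
    proof (rule field_differentiable_bound[where S="cball 0 A" and f'=exp])
      fix z :: 'a assume "z \<in> cball 0 A"
      then show "norm (exp z) \<le> exp A"
        using norm_exp[of z] by (meson exp_le_cancel_iff mem_cball_0 order_trans)
    qed (use A(2) uv in \<open>auto intro!: derivative_eq_intros\<close>)
    also have "\<dots> \<le> exp A * (norm (f v - f u) + norm (f v - f u))" by (intro mult_left_mono) auto
    finally show "norm (exp (f v) - exp (f u)) \<le> exp A * (norm (f v - f u) + norm (f v - f u))" .
  qed
qed

lemma abs_cont_subinterval:
  assumes "abs_cont a b f" "a \<le> c" "d \<le> b"
  shows "abs_cont c d f"
  using assms unfolding abs_cont_def
  by (meson atLeastatMost_subset_iff order_trans)

lemma abs_cont_of_vector_derivative:
  fixes f :: "real \<Rightarrow> 'a::real_normed_vector"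
  assumes f: "\<And>x. x \<in> {a..b} \<Longrightarrow> (f has_vector_derivative f' x) (at x within {a..b})"
    and B: "\<And>x. x \<in> {a..b} \<Longrightarrow> norm (f' x) \<le> B"
  shows "abs_cont a b f"
proof (rule abs_cont_of_lipschitz[where M=B])
  fix u v assume uv: "a \<le> u" "u \<le> v" "v \<le> b"
  have "norm (f v - f u) \<le> B * norm (v - u)"
  proof (rule differentiable_bound[of "{a..b}" f "\<lambda>x h. h *\<^sub>R f' x"])
    fix x assume x: "x \<in> {a..b}"
    show "(f has_derivative (\<lambda>h. h *\<^sub>R f' x)) (at x within {a..b})"
      using f[OF x] by (simp add: has_vector_derivative_def)
    show "onorm (\<lambda>h. h *\<^sub>R f' x) \<le> B"
    proof (rule onorm_le)
      show "norm (h *\<^sub>R f' x) \<le> B * norm h" for h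
        using mult_right_mono[OF B[OF x], of "\<bar>h\<bar>"] by (simp add: mult.commute)
    qed
  qed (use uv in auto)
  then show "norm (f v - f u) \<le> B * (v - u)" using uv by simp
qed

text \<open>
  Take a fine tagged division. Intervals tagged where the derivative exists contribute at least \<open>- e1\<close> times their
  length. The remaining tags lie in a null set, so their intervals fit into an open set of small measure, and
  absolute continuity makes their total contribution small.
\<close>

theorem abs_cont_increasing:
  fixes f :: "real \<Rightarrow> real"
  assumes ac: "abs_cont a b f" and ab: "a \<le> b" and N: "negligible N"
    and deriv: "\<And>x. x \<in> {a<..<b} - N \<Longrightarrow> \<exists>c\<ge>0. (f has_real_derivative c) (at x)"
  shows "f a \<le> f b"
proof (rule field_le_epsilon)
  fix e :: real assume e: "e > 0"
  define e1 where "e1 = e / (2 * (b - a + 1))"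
  have e1: "e1 > 0" "e1 * (b - a) \<le> e/2"
    using e ab by (auto simp: e1_def field_simps)
  obtain d where d: "d > 0" "\<And>D. D division_of \<Union>D \<and> \<Union>D \<subseteq> {a..b} \<and> (\<Sum>K\<in>D. Sup K - Inf K) < d \<Longrightarrow>
        (\<Sum>K\<in>D. norm (f (Sup K) - f (Inf K))) < e/2"
    using ac half_gt_zero[OF e] unfolding abs_cont_def by blast
  \<comment> \<open>The end points carry no assumption on the derivative and are treated as exceptional.\<close>
  define N' where "N' = N \<union> {a,b}"
  have N': "negligible N'" unfolding N'_def using N by (intro negligible_Un) auto
  obtain W where W: "open W" "N' \<subseteq> W" "W - N' \<in> lmeasurable" "emeasure lebesgue (W - N') < ennreal d"
    using sets_lebesgue_outer_open[OF negligible_imp_sets[OF N'] d(1)] .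
  have NL: "N' \<in> lmeasurable" by (rule negligible_imp_measurable[OF N'])
  have Wm: "W \<in> lmeasurable"
    using fmeasurable.Un[OF W(3) NL] W(2) by (simp add: Un_absorb2)
  have "measure lebesgue W \<le> measure lebesgue (W - N') + measure lebesgue N'"
    using measure_Un_le[of "W - N'" lebesgue N'] W(2,3) NL by (simp add: Un_absorb2 fmeasurableD)
  also have "\<dots> < d"
    using W(3,4) d(1) negligible_imp_measure0[OF N'] by (simp add: emeasure_eq_measure2 ennreal_less_iff)
  finally have Wd: "measure lebesgue W < d" .
  have "\<exists>r>0. (x \<in> N' \<longrightarrow> ball x r \<subseteq> W) \<and>
      (x \<in> {a..b} - N' \<longrightarrow> (\<forall>u v. u \<le> x \<and> x \<le> v \<and> {u..v} \<subseteq> ball x r \<longrightarrow> f v - f u \<ge> - e1 * (v - u)))" for x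
  proof (cases "x \<in> {a..b} - N'")
    case False
    show ?thesis
    proof (cases "x \<in> N'")
      case True
      then obtain r where "r > 0" "ball x r \<subseteq> W" using W openE by blast
      then show ?thesis using True by blast
    qed (use False in \<open>auto intro: exI[of _ 1]\<close>)
  next
    case True
    then have "x \<in> {a<..<b} - N" by (auto simp: N'_def)
    then obtain c where c: "c \<ge> 0" "(f has_real_derivative c) (at x)" using deriv by blast
    then have "(f has_derivative (\<lambda>h. c * h)) (at x)" by (simp add: has_field_derivative_def)
    then obtain r where r: "r > 0" "\<And>y. norm (y - x) < r \<Longrightarrow> norm (f y - f x - c * (y - x)) \<le> e1 * norm (y - x)"
      using e1(1) unfolding has_derivative_at_alt by blast
    have "f v - f u \<ge> - e1 * (v - u)" if uv: "u \<le> x" "x \<le> v" "{u..v} \<subseteq> ball x r" for u v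
    proof -
      have "u \<in> {u..v}" "v \<in> {u..v}" using uv(1,2) by auto
      then have "u \<in> ball x r" "v \<in> ball x r" using uv(3) by blast+
      then have "norm (u - x) < r" "norm (v - x) < r" by (auto simp: dist_norm norm_minus_commute)
      then have "\<bar>f u - f x - c * (u - x)\<bar> \<le> e1 * (x - u)" "\<bar>f v - f x - c * (v - x)\<bar> \<le> e1 * (v - x)"
        using r(2)[of u] r(2)[of v] uv by auto
      moreover have "c * (v - x) \<ge> 0" "c * (x - u) \<ge> 0" using c uv by auto
      ultimately show ?thesis by (simp add: algebra_simps abs_le_iff)
    qed
    then show ?thesis using r(1) True by blast
  qed
  then obtain r where r0: "\<And>x. r x > 0" and rN: "\<And>x. x \<in> N' \<Longrightarrow> ball x (r x) \<subseteq> W"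
    and rg: "\<And>x u v. x \<in> {a..b} - N' \<Longrightarrow> u \<le> x \<Longrightarrow> x \<le> v \<Longrightarrow> {u..v} \<subseteq> ball x (r x) \<Longrightarrow> f v - f u \<ge> - e1 * (v - u)"
    by metis
  have "gauge (\<lambda>x. ball x (r x))" using r0 by (simp add: gauge_def)
  then obtain p where p: "p tagged_division_of {a..b}" "(\<lambda>x. ball x (r x)) fine p"
    using fine_division_exists_real by blast
  note pD = tagged_division_ofD[OF p(1)]
  define p1 where "p1 = {t\<in>p. fst t \<in> N'}"
  define p2 where "p2 = {t\<in>p. fst t \<notin> N'}"
  have pp: "p = p1 \<union> p2" "p1 \<inter> p2 = {}" "finite p1" "finite p2" using pD(1) by (auto simp: p1_def p2_def)
  have pK: "\<exists>u v. K = {u..v} \<and> u \<le> x \<and> x \<le> v \<and> Inf K = u \<and> Sup K = v \<and> {u..v} \<subseteq> ball x (r x) \<and> x \<in> {a..b}" if xK: "(x,K) \<in> p" for x K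
  proof -
    obtain u v where uv: "K = {u..v}" using pD(4)[OF xK] by auto
    have x: "x \<in> {u..v}" "x \<in> {a..b}" "{u..v} \<subseteq> ball x (r x)"
      using pD(2,3)[OF xK] fineD[OF p(2) xK] uv by auto
    then have "u \<le> v" by simp
    then show ?thesis using uv x by (intro exI[of _ u] exI[of _ v]) simp
  qed
  have "- (e/2) \<le> (\<Sum>(x,K)\<in>p1. f (Sup K) - f (Inf K))"
  proof -
    have t: "p1 tagged_partial_division_of {a..b}"
      using p(1) tagged_partial_division_subset[of p "{a..b}" p1] pp(1) unfolding tagged_division_of_def by blast
    define D where "D = snd ` p1"
    have t': "p1 tagged_division_of \<Union>D"
      using tagged_partial_division_of_Union_self[OF t] by (simp add: D_def)
    have D: "D division_of \<Union>D" unfolding D_def by (rule division_of_tagged_division[OF t'[unfolded D_def]])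
    have Dab: "\<Union>D \<subseteq> {a..b}" using tagged_partial_division_ofD(3)[OF t] by (force simp: D_def)
    have DW: "\<Union>D \<subseteq> W"
    proof
      fix y assume "y \<in> \<Union>D"
      then obtain x K where "(x,K) \<in> p" "x \<in> N'" "y \<in> K" by (auto simp: D_def p1_def)
      then show "y \<in> W" using fineD[OF p(2)] rN by blast
    qed
    have "(\<Sum>K\<in>D. Sup K - Inf K) = (\<Sum>K\<in>D. measure lebesgue K)"
    proof (rule sum.cong[OF refl])
      fix K assume K: "K \<in> D"
      note K' = division_real_interval[OF D Dab K]
      have "measure lebesgue {Inf K..Sup K} = Sup K - Inf K" using K'(3) by simp
      then show "Sup K - Inf K = measure lebesgue K" using K'(1) by simp
    qed
    also have "\<dots> = measure lebesgue (\<Union>D)" by (rule content_division[OF D])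
    also have "\<dots> \<le> measure lebesgue W"
      by (rule measure_mono_fmeasurable[OF DW _ Wm]) (use D in \<open>simp add: fmeasurableD lmeasurable_division\<close>)
    finally have "(\<Sum>K\<in>D. Sup K - Inf K) < d" using Wd by simp
    then have "(\<Sum>K\<in>D. norm (f (Sup K) - f (Inf K))) < e/2" using d(2) D Dab by blast
    moreover have "(\<Sum>(x,K)\<in>p1. f (Sup K) - f (Inf K)) = (\<Sum>K\<in>D. f (Sup K) - f (Inf K))"
    proof -
      \<comment> \<open>\<open>Sup {}\<close> is unspecified, hence the case distinction.\<close>
      define \<phi> where "\<phi> K = (if K = {} then 0 else f (Sup K) - f (Inf K))" for K
      have "(\<Sum>(x,K)\<in>p1. \<phi> K) = (\<Sum>K\<in>D. \<phi> K)"
        unfolding D_def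
      proof (rule sum.over_tagged_division_lemma[OF t'[unfolded D_def]])
        fix u v :: real assume "box u v = {}"
        then have "v \<le> u" by simp
        then show "\<phi> (cbox u v) = 0" by (cases "u = v") (auto simp: \<phi>_def)
      qed
      moreover have "(\<Sum>(x,K)\<in>p1. f (Sup K) - f (Inf K)) = (\<Sum>(x,K)\<in>p1. \<phi> K)"
        by (intro sum.cong) (auto simp: \<phi>_def dest: tagged_partial_division_ofD(2)[OF t])
      moreover have "(\<Sum>K\<in>D. f (Sup K) - f (Inf K)) = (\<Sum>K\<in>D. \<phi> K)"
        using division_ofD(3)[OF D] by (intro sum.cong) (auto simp: \<phi>_def)
      ultimately show ?thesis by simp
    qed
    moreover have "\<bar>\<Sum>K\<in>D. f (Sup K) - f (Inf K)\<bar> \<le> (\<Sum>K\<in>D. norm (f (Sup K) - f (Inf K)))"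
      using norm_sum[of "\<lambda>K. f (Sup K) - f (Inf K)" D] by simp
    ultimately show ?thesis by linarith
  qed
  moreover have "- (e/2) \<le> (\<Sum>(x,K)\<in>p2. f (Sup K) - f (Inf K))"
  proof -
    have "(\<Sum>(x,K)\<in>p2. - e1 * (Sup K - Inf K)) \<le> (\<Sum>(x,K)\<in>p2. f (Sup K) - f (Inf K))"
    proof (rule sum_mono, clarify)
      fix x K assume xK: "(x,K) \<in> p2"
      then have xp: "(x,K) \<in> p" "x \<notin> N'" by (auto simp: p2_def)
      from pK[OF xp(1)] obtain u v where "K = {u..v}" "u \<le> x" "x \<le> v" "Inf K = u" "Sup K = v" "{u..v} \<subseteq> ball x (r x)" "x \<in> {a..b}" by blast
      then show "- e1 * (Sup K - Inf K) \<le> f (Sup K) - f (Inf K)" using rg[of x u v] xp(2) by simp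
    qed
    moreover have "(\<Sum>(x,K)\<in>p2. - e1 * (Sup K - Inf K)) = - e1 * (\<Sum>(x,K)\<in>p2. Sup K - Inf K)"
      by (simp add: sum_distrib_left case_prod_beta sum_negf)
    moreover have "(\<Sum>(x,K)\<in>p2. Sup K - Inf K) \<le> (\<Sum>(x,K)\<in>p. Sup K - Inf K)"
      using pD(1) pK by (intro sum_mono2) (fastforce simp: p2_def)+
    moreover have "(\<Sum>(x,K)\<in>p. Sup K - Inf K) = b - a"
      using additive_tagged_division_1[OF ab p(1), of "\<lambda>x. x"] by simp
    ultimately have "- e1 * (b - a) \<le> (\<Sum>(x,K)\<in>p2. f (Sup K) - f (Inf K))"
      using e1(1) by (smt (verit) mult_left_mono mult_minus_left)
    then show ?thesis using e1(2) by simp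
  qed
  moreover have "(\<Sum>(x,K)\<in>p. f (Sup K) - f (Inf K)) = (\<Sum>(x,K)\<in>p1. f (Sup K) - f (Inf K)) + (\<Sum>(x,K)\<in>p2. f (Sup K) - f (Inf K))"
    unfolding pp(1) by (rule sum.union_disjoint) (use pp in auto)
  moreover have "(\<Sum>(x,K)\<in>p. f (Sup K) - f (Inf K)) = f b - f a"
    by (rule additive_tagged_division_1[OF ab p(1)])
  ultimately show "f a \<le> f b + e" by linarith
qed

text \<open>
  The mean value inequality in the form used for all estimates: test \<open>f\<close> against the direction of its increment
  and apply monotonicity to the difference with \<open>H\<close>.
\<close>

lemma abs_cont_norm_increment_le:
  fixes f :: "real \<Rightarrow> 'a::real_inner"
  assumes f: "abs_cont a b f" and H: "abs_cont a b H" and N: "negligible N"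
    and deriv: "\<And>x. x \<in> {a<..<b} - N \<Longrightarrow>
      \<exists>f' h. (f has_vector_derivative f') (at x) \<and> (H has_real_derivative h) (at x) \<and> norm f' \<le> h"
    and uv: "a \<le> u" "u \<le> v" "v \<le> b"
  shows "norm (f v - f u) \<le> H v - H u"
proof -
  define w where "w = sgn (f v - f u)"
  have w: "norm w \<le> 1" by (simp add: w_def norm_sgn)
  have "(\<lambda>x. H x - w \<bullet> f x) u \<le> (\<lambda>x. H x - w \<bullet> f x) v"
  proof (rule abs_cont_increasing[OF _ uv(2) N])
    show "abs_cont u v (\<lambda>x. H x - w \<bullet> f x)"
      using f H uv by (intro abs_cont_diff abs_cont_inner abs_cont_const) (auto intro: abs_cont_subinterval)
    fix x assume "x \<in> {u<..<v} - N"
    then have "x \<in> {a<..<b} - N" using uv by auto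
    then obtain f' h where d: "(f has_vector_derivative f') (at x)" "(H has_real_derivative h) (at x)" "norm f' \<le> h"
      using deriv by blast
    have "((\<lambda>x. w \<bullet> f x) has_vector_derivative w \<bullet> f') (at x)"
      using bounded_linear.has_vector_derivative[OF bounded_linear_inner_right d(1)] .
    then have "((\<lambda>x. H x - w \<bullet> f x) has_real_derivative h - w \<bullet> f') (at x)"
      using d(2) by (intro DERIV_diff) (simp_all add: has_real_derivative_iff_has_vector_derivative)
    moreover have "w \<bullet> f' \<le> norm w * norm f'" by (rule norm_cauchy_schwarz)
    moreover have "norm w * norm f' \<le> 1 * norm f'" using w by (intro mult_right_mono) auto
    ultimately show "\<exists>c\<ge>0. ((\<lambda>x. H x - w \<bullet> f x) has_real_derivative c) (at x)"
      using d(3) by (intro exI[of _ "h - w \<bullet> f'"]) auto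
  qed
  then have "w \<bullet> (f v - f u) \<le> H v - H u" by (simp add: inner_diff_right)
  moreover have "w \<bullet> (f v - f u) = norm (f v - f u)"
    by (cases "f v - f u = 0") (auto simp: w_def sgn_div_norm power2_norm_eq_inner[symmetric] power2_eq_square)
  ultimately show ?thesis by simp
qed

lemma abs_cont_eq_const:
  fixes f :: "real \<Rightarrow> 'a::real_inner"
  assumes f: "abs_cont a b f" and N: "negligible N"
    and deriv: "\<And>x. x \<in> {a<..<b} - N \<Longrightarrow> (f has_vector_derivative 0) (at x)"
    and x: "x \<in> {a..b}"
  shows "f x = f a"
proof -
  have "norm (f x - f a) \<le> 0 - (0::real)"
    by (rule abs_cont_norm_increment_le[OF f abs_cont_const N]) (use deriv x in \<open>force intro!: exI derivative_intros\<close>)+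
  then show ?thesis by simp
qed

text \<open>
  The tail of an integrable function above level \<open>n\<close> has small integral; below that level the integral over a set
  is at most \<open>n\<close> times its measure. This gives absolute continuity of the indefinite integral.
\<close>

lemma integral_truncation_remainder:
  fixes g :: "real \<Rightarrow> real"
  assumes g: "g absolutely_integrable_on S" "\<And>x. g x \<ge> 0" and S: "S = {a..b}" and e: "e > 0"
  obtains n :: nat where "(\<lambda>x. g x - min (g x) n) integrable_on S" "integral S (\<lambda>x. g x - min (g x) n) < e"
proof -
  have int: "(\<lambda>x. g x - min (g x) (real n)) integrable_on S" for n
  proof -
    have "(\<lambda>x. real n) absolutely_integrable_on S" by (simp add: S absolutely_integrable_continuous_real)
    then have "(\<lambda>x. min (g x) (real n)) absolutely_integrable_on S" using g(1) by (intro absolutely_integrable_min_1)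
    then show ?thesis using g(1) set_lebesgue_integral_eq_integral(1) by (intro integrable_diff) blast+
  qed
  have "(\<lambda>n. integral S (\<lambda>x. g x - min (g x) (real n))) \<longlonglongrightarrow> integral S (\<lambda>x. 0)"
  proof (rule dominated_convergence(2)[where h=g])
    show "g integrable_on S" using g(1) set_lebesgue_integral_eq_integral(1) by blast
    show "norm (g x - min (g x) (real k)) \<le> g x" for x k using g(2)[of x] by (simp add: min_def)
    fix x
    obtain N :: nat where N: "g x \<le> N" using real_arch_simple by blast
    have "eventually (\<lambda>n. g x - min (g x) (real n) = 0) sequentially"
      using N by (intro eventually_sequentiallyI[of N]) (auto simp: min_def)
    then show "(\<lambda>k. g x - min (g x) (real k)) \<longlonglongrightarrow> 0" by (rule tendsto_eventually)
  qed (rule int)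
  then have "eventually (\<lambda>n. integral S (\<lambda>x. g x - min (g x) (real n)) < e) sequentially"
    using e by (intro order_tendstoD(2)) auto
  then obtain n where "integral S (\<lambda>x. g x - min (g x) (real n)) < e"
    unfolding eventually_sequentially by blast
  then show ?thesis using that int by blast
qed

theorem abs_cont_indefinite_integral:
  fixes f :: "real \<Rightarrow> 'a::euclidean_space"
  assumes f: "f absolutely_integrable_on {a..b}"
  shows "abs_cont a b (\<lambda>t. integral {a..t} f)"
  unfolding abs_cont_def
proof (intro allI impI)
  fix e :: real assume e: "e > 0"
  have fi: "f integrable_on {a..b}" and gi: "(\<lambda>x. norm (f x)) integrable_on {a..b}"
    and ga: "(\<lambda>x. norm (f x)) absolutely_integrable_on {a..b}"
    using f absolutely_integrable_norm[OF f] by (auto simp: absolutely_integrable_on_def o_def)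
  obtain n :: nat where n: "(\<lambda>x. norm (f x) - min (norm (f x)) n) integrable_on {a..b}"
      "integral {a..b} (\<lambda>x. norm (f x) - min (norm (f x)) n) < e/2"
    using integral_truncation_remainder[OF ga norm_ge_zero refl half_gt_zero[OF e]] by blast
  define h where "h x = norm (f x) - min (norm (f x)) n" for x
  have hi: "h integrable_on {a..b}" and hs: "integral {a..b} h < e/2" using n by (auto simp: h_def[abs_def])
  have h0: "h x \<ge> 0" for x by (simp add: h_def)
  show "\<exists>d>0. \<forall>D. D division_of \<Union>D \<and> \<Union>D \<subseteq> {a..b} \<and> (\<Sum>K\<in>D. Sup K - Inf K) < d \<longrightarrow>
        (\<Sum>K\<in>D. norm (integral {a..Sup K} f - integral {a..Inf K} f)) < e"
  proof (intro exI[of _ "e / (2 * (real n + 1))"] conjI allI impI)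
    show "e / (2 * (real n + 1)) > 0" using e by simp
    fix D :: "real set set"
    assume "D division_of \<Union>D \<and> \<Union>D \<subseteq> {a..b} \<and> (\<Sum>K\<in>D. Sup K - Inf K) < e / (2 * (real n + 1))"
    then have D: "D division_of \<Union>D" "\<Union>D \<subseteq> {a..b}" "(\<Sum>K\<in>D. Sup K - Inf K) < e / (2 * (real n + 1))" by auto
    have hK: "h integrable_on K" if K: "K \<in> D" for K
    proof -
      note K' = division_real_interval[OF D(1,2) K]
      have "{Inf K..Sup K} \<subseteq> {a..b}" using K'(2,4) by auto
      then have "h integrable_on {Inf K..Sup K}" by (rule integrable_subinterval_real[OF hi])
      then show ?thesis using K'(1) by simp
    qed
    have "norm (integral {a..Sup K} f - integral {a..Inf K} f) \<le> integral K h + n * (Sup K - Inf K)" if K: "K \<in> D" for K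
    proof -
      note K' = division_real_interval[OF D(1,2) K]
      have sub: "{Inf K..Sup K} \<subseteq> {a..b}" using K'(2,4) by auto
      have i1: "f integrable_on {Inf K..Sup K}" "(\<lambda>x. norm (f x)) integrable_on {Inf K..Sup K}" "h integrable_on {Inf K..Sup K}"
        using integrable_subinterval_real[OF _ sub] fi gi hi by blast+
      have "f integrable_on {a..Sup K}" using K'(4) by (intro integrable_subinterval_real[OF fi]) auto
      then have "integral {a..Inf K} f + integral {Inf K..Sup K} f = integral {a..Sup K} f"
        using K'(2,3) by (intro Henstock_Kurzweil_Integration.integral_combine) auto
      then have "integral {a..Sup K} f - integral {a..Inf K} f = integral {Inf K..Sup K} f" by (simp add: algebra_simps)
      moreover have "norm (integral {Inf K..Sup K} f) \<le> integral {Inf K..Sup K} (\<lambda>x. h x + n)"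
      proof (rule integral_norm_bound_integral)
        show "(\<lambda>x. h x + n) integrable_on {Inf K..Sup K}" by (intro integrable_add i1 integrable_const_ivl)
        show "norm (f x) \<le> h x + n" for x by (simp add: h_def)
      qed (rule i1)
      moreover have "integral {Inf K..Sup K} (\<lambda>x. h x + n) = integral {Inf K..Sup K} h + n * (Sup K - Inf K)"
        using i1 K'(3) by (subst integral_add) auto
      moreover have "integral K h = integral {Inf K..Sup K} h" using K'(1) by (rule arg_cong)
      ultimately show ?thesis by simp
    qed
    then have "(\<Sum>K\<in>D. norm (integral {a..Sup K} f - integral {a..Inf K} f)) \<le> (\<Sum>K\<in>D. integral K h + n * (Sup K - Inf K))"
      by (rule sum_mono)
    also have "\<dots> = (\<Sum>K\<in>D. integral K h) + n * (\<Sum>K\<in>D. Sup K - Inf K)"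
      by (simp add: sum.distrib sum_distrib_left)
    also have "(\<Sum>K\<in>D. integral K h) = integral (\<Union>D) h"
      using integral_combine_division_bottomup[OF D(1) hK] by simp
    also have "\<dots> \<le> integral {a..b} h"
    proof (rule integral_subset_le[OF D(2) _ hi])
      show "h integrable_on \<Union>D"
        using has_integral_combine_division[OF D(1) integrable_integral[OF hK]] by blast
    qed (use h0 in auto)
    also have "integral {a..b} h + n * (\<Sum>K\<in>D. Sup K - Inf K) < e/2 + e/2"
    proof -
      have "n * (\<Sum>K\<in>D. Sup K - Inf K) \<le> n * (e / (2 * (real n + 1)))" using D(3) by (intro mult_left_mono) auto
      also have "\<dots> \<le> e / 2" using e by (simp add: field_simps)
      finally show ?thesis using hs by simp
    qed
    finally show "(\<Sum>K\<in>D. norm (integral {a..Sup K} f - integral {a..Inf K} f)) < e" by simp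
  qed
qed

section \<open>Solutions of \<open>y'' = W y\<close>\<close>

text \<open>
  The equation as a first-order system: \<open>z\<close> is the derivative of \<open>y\<close>, including the one-sided derivatives at the
  end points.
\<close>

definition solves :: "real \<Rightarrow> (real \<Rightarrow> complex) \<Rightarrow> (real \<Rightarrow> complex) \<Rightarrow> (real \<Rightarrow> complex) \<Rightarrow> bool" where
  "solves T W y z \<longleftrightarrow> abs_cont 0 T y \<and> abs_cont 0 T z \<and>
     (\<forall>x\<in>{0..T}. (y has_vector_derivative z x) (at x within {0..T})) \<and>
     (\<exists>N. negligible N \<and> (\<forall>x\<in>{0<..<T} - N. (z has_vector_derivative W x * y x) (at x)))"

lemma solvesD:
  assumes "solves T W y z"
  shows "abs_cont 0 T y" "abs_cont 0 T z"
    "x \<in> {0..T} \<Longrightarrow> (y has_vector_derivative z x) (at x within {0..T})"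
    "x \<in> {0<..<T} \<Longrightarrow> (y has_vector_derivative z x) (at x)"
proof -
  show "abs_cont 0 T y" "abs_cont 0 T z"
    and *: "x \<in> {0..T} \<Longrightarrow> (y has_vector_derivative z x) (at x within {0..T})"
    using assms unfolding solves_def by auto
  assume x: "x \<in> {0<..<T}"
  then have "at x within {0..T} = at x" by (intro at_within_interior) simp
  then show "(y has_vector_derivative z x) (at x)" using * x by simp
qed

lemma solves_ae:
  assumes "solves T W y z"
  obtains N where "negligible N" "\<And>x. x \<in> {0<..<T} - N \<Longrightarrow> (z has_vector_derivative W x * y x) (at x)"
  using assms unfolding solves_def by blast

lemma solves_continuous:
  assumes "solves T W y z" shows "continuous_on {0..T} y" "continuous_on {0..T} z"
  using assms by (auto simp: solves_def abs_cont_continuous)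

lemma AE_lebesgue_iff_negligible: "(AE x in lebesgue. P x) \<longleftrightarrow> (\<exists>N. negligible N \<and> (\<forall>x. x \<notin> N \<longrightarrow> P x))"
  unfolding eventually_ae_filter by (auto simp: negligible_iff_null_sets)

lemma solves_of_pencil_solution:
  assumes T: "T > 0" and s: "pencil_solution T p q l y"
  shows "solves T (\<lambda>x. 2 * l * p x + q x - l\<^sup>2) y (deriv_ivl T y)"
proof -
  let ?W = "\<lambda>x. 2 * l * p x + q x - l\<^sup>2"
  have "(y has_vector_derivative deriv_ivl T y x) (at x within {0..T})" if "x \<in> {0..T}" for x
    using s that unfolding pencil_solution_def deriv_ivl_def by (simp add: vector_derivative_works)
  moreover have "\<exists>N. negligible N \<and> (\<forall>x\<in>{0<..<T} - N. (deriv_ivl T y has_vector_derivative ?W x * y x) (at x))"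
  proof -
    obtain N where N: "negligible N" "\<And>x. x \<notin> N \<Longrightarrow> x \<in> {0<..<T} \<Longrightarrow>
        (\<exists>y2. (deriv_ivl T y has_vector_derivative y2) (at x) \<and> y2 + (l\<^sup>2 - 2 * l * p x - q x) * y x = 0)"
      using s unfolding pencil_solution_def AE_lebesgue_iff_negligible by blast
    have "(deriv_ivl T y has_vector_derivative ?W x * y x) (at x)" if "x \<in> {0<..<T} - N" for x
    proof -
      obtain y2 where y2: "(deriv_ivl T y has_vector_derivative y2) (at x)" "y2 + (l\<^sup>2 - 2 * l * p x - q x) * y x = 0"
        using N(2)[of x] \<open>x \<in> {0<..<T} - N\<close> by blast
      have "y2 = ?W x * y x" using y2(2) by (simp add: algebra_simps add_eq_0_iff)
      then show ?thesis using y2(1) by simp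
    qed
    then show ?thesis using N(1) by blast
  qed
  ultimately show ?thesis
    using s unfolding solves_def pencil_solution_def abs_continuous_on_ivl_iff_abs_cont by blast
qed

lemma deriv_ivl_eq_of_solves:
  assumes T: "T > 0" and s: "solves T W y z" and x: "x \<in> {0..T}"
  shows "deriv_ivl T y x = z x"
  unfolding deriv_ivl_def
  by (rule vector_derivative_within_closed_interval[OF T x]) (use s x in \<open>auto simp: solves_def\<close>)

lemma pencil_solution_of_solves:
  assumes T: "T > 0" and s: "solves T (\<lambda>x. 2 * l * p x + q x - l\<^sup>2) y z"
  shows "pencil_solution T p q l y"
proof -
  let ?W = "\<lambda>x. 2 * l * p x + q x - l\<^sup>2"
  note D = solvesD[OF s]
  obtain N where N: "negligible N" "\<And>x. x \<in> {0<..<T} - N \<Longrightarrow> (z has_vector_derivative ?W x * y x) (at x)"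
    by (rule solves_ae[OF s], rule that)
  note d = deriv_ivl_eq_of_solves[OF T s]
  have "abs_cont 0 T (deriv_ivl T y)"
    by (rule abs_cont_dominated[OF D(2) D(2), of _ 1]) (simp add: d)
  moreover have "\<exists>y2. (deriv_ivl T y has_vector_derivative y2) (at x) \<and> y2 + (l\<^sup>2 - 2 * l * p x - q x) * y x = 0"
    if "x \<in> {0<..<T} - N" for x
  proof (intro exI conjI)
    show "(deriv_ivl T y has_vector_derivative ?W x * y x) (at x)"
      by (rule has_vector_derivative_transform_within_open[OF N(2)[OF that], of "{0<..<T}"])
         (use that d in auto)
  qed (simp add: algebra_simps)
  moreover have "y differentiable (at x within {0..T})" if "x \<in> {0..T}" for x
    using D(3)[OF that] by (metis differentiableI_vector)
  ultimately show ?thesis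
    unfolding pencil_solution_def abs_continuous_on_ivl_iff_abs_cont AE_lebesgue_iff_negligible
    using D(1) N(1) by blast
qed

lemma solves_lincomb:
  assumes 1: "solves T W y1 z1" and 2: "solves T W y2 z2"
  shows "solves T W (\<lambda>x. a * y1 x + b * y2 x) (\<lambda>x. a * z1 x + b * z2 x)"
proof -
  obtain N1 where N1: "negligible N1" "\<And>x. x \<in> {0<..<T} - N1 \<Longrightarrow> (z1 has_vector_derivative W x * y1 x) (at x)"
    by (rule solves_ae[OF 1], rule that)
  obtain N2 where N2: "negligible N2" "\<And>x. x \<in> {0<..<T} - N2 \<Longrightarrow> (z2 has_vector_derivative W x * y2 x) (at x)"
    by (rule solves_ae[OF 2], rule that)
  show ?thesis unfolding solves_def
  proof (intro conjI ballI exI)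
    show "abs_cont 0 T (\<lambda>x. a * y1 x + b * y2 x)" "abs_cont 0 T (\<lambda>x. a * z1 x + b * z2 x)"
      by (intro abs_cont_add abs_cont_cmult solvesD[OF 1] solvesD[OF 2])+
    show "negligible (N1 \<union> N2)" using N1 N2 by (intro negligible_Un)
    show "((\<lambda>x. a * y1 x + b * y2 x) has_vector_derivative a * z1 x + b * z2 x) (at x within {0..T})"
      if "x \<in> {0..T}" for x
      using solvesD(3)[OF 1 that] solvesD(3)[OF 2 that] by (auto intro!: derivative_eq_intros)
    fix x assume "x \<in> {0<..<T} - (N1 \<union> N2)"
    then have "(z1 has_vector_derivative W x * y1 x) (at x)" "(z2 has_vector_derivative W x * y2 x) (at x)"
      using N1(2) N2(2) by auto
    then show "((\<lambda>x. a * z1 x + b * z2 x) has_vector_derivative W x * (a * y1 x + b * y2 x)) (at x)"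
      by (auto intro!: derivative_eq_intros simp: algebra_simps)
  qed
qed

lemma wronskian_constant:
  assumes 1: "solves T W y1 z1" and 2: "solves T W y2 z2" and x: "x \<in> {0..T}"
  shows "y1 x * z2 x - z1 x * y2 x = y1 0 * z2 0 - z1 0 * y2 0"
proof -
  obtain N1 where N1: "negligible N1" "\<And>x. x \<in> {0<..<T} - N1 \<Longrightarrow> (z1 has_vector_derivative W x * y1 x) (at x)"
    by (rule solves_ae[OF 1], rule that)
  obtain N2 where N2: "negligible N2" "\<And>x. x \<in> {0<..<T} - N2 \<Longrightarrow> (z2 has_vector_derivative W x * y2 x) (at x)"
    by (rule solves_ae[OF 2], rule that)
  show ?thesis
  proof (rule abs_cont_eq_const[where f="\<lambda>x. y1 x * z2 x - z1 x * y2 x", OF _ negligible_Un[OF N1(1) N2(1)] _ x])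
    show "abs_cont 0 T (\<lambda>x. y1 x * z2 x - z1 x * y2 x)"
      by (intro abs_cont_diff abs_cont_mult solvesD[OF 1] solvesD[OF 2])
    fix x assume x: "x \<in> {0<..<T} - (N1 \<union> N2)"
    have "(y1 has_vector_derivative z1 x) (at x)" "(y2 has_vector_derivative z2 x) (at x)"
      "(z1 has_vector_derivative W x * y1 x) (at x)" "(z2 has_vector_derivative W x * y2 x) (at x)"
      using x N1 N2 solvesD(4)[OF 1] solvesD(4)[OF 2] by auto
    note d = has_vector_derivative_mult[OF this(1,4)] has_vector_derivative_mult[OF this(3,2)]
    show "((\<lambda>x. y1 x * z2 x - z1 x * y2 x) has_vector_derivative 0) (at x)"
      using has_vector_derivative_diff[OF d] by (simp add: algebra_simps)
  qed
qed

text \<open>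
  The weight \<open>\<mu>\<close> is at our disposal. With \<open>\<mu> = \<bar>\<lambda>\<bar>\<close> the growth rate of the energy involves \<open>\<bar>Im \<lambda>\<bar>\<close> in place of
  \<open>\<bar>\<lambda>\<bar>\<close>; with \<open>\<mu> = 1\<close> the energy detects zero initial data for every \<open>\<lambda>\<close>.
\<close>

definition energy :: "real \<Rightarrow> (real \<Rightarrow> complex) \<Rightarrow> (real \<Rightarrow> complex) \<Rightarrow> real \<Rightarrow> real" where
  "energy \<mu> y z x = (norm (z x))\<^sup>2 + \<mu>\<^sup>2 * (norm (y x))\<^sup>2"

text \<open>
  The derivative of the energy is \<open>2 Re (conj(z) (W + \<mu>^2) y)\<close>, at most \<open>k\<close> times the energy by the inequality
  between arithmetic and geometric mean. So the energy times \<open>exp (- K)\<close> decreases and the energy times \<open>exp K\<close>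
  increases, which bounds the growth in both directions at once.
\<close>

lemma energy_growth:
  assumes s: "solves T W y z" and \<mu>: "\<mu> > 0" and K: "abs_cont 0 T K" and N: "negligible N"
    and dK: "\<And>x. x \<in> {0<..<T} - N \<Longrightarrow> \<exists>k. (K has_real_derivative k) (at x) \<and> norm (W x + \<mu>\<^sup>2) \<le> \<mu> * k"
    and uv: "0 \<le> u" "u \<le> v" "v \<le> T"
  shows "energy \<mu> y z v \<le> energy \<mu> y z u * exp (K v - K u)"
    and "energy \<mu> y z u \<le> energy \<mu> y z v * exp (K v - K u)"
proof -
  obtain N1 where N1: "negligible N1" "\<And>x. x \<in> {0<..<T} - N1 \<Longrightarrow> (z has_vector_derivative W x * y x) (at x)"
    by (rule solves_ae[OF s], rule that)
  define n where "n x = z x \<bullet> z x + \<mu>\<^sup>2 * (y x \<bullet> y x)" for x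
  have n_energy: "energy \<mu> y z = n" by (simp add: fun_eq_iff energy_def n_def power2_norm_eq_inner)
  have nac: "abs_cont 0 T n" unfolding n_def[abs_def]
    by (intro abs_cont_add abs_cont_inner abs_cont_cmult solvesD[OF s])
  have dn: "\<exists>k n'. (K has_real_derivative k) (at x) \<and> (n has_real_derivative n') (at x) \<and> \<bar>n'\<bar> \<le> k * n x"
    if x: "x \<in> {0<..<T} - (N \<union> N1)" for x
  proof -
    obtain k where k: "(K has_real_derivative k) (at x)" "norm (W x + \<mu>\<^sup>2) \<le> \<mu> * k" using dK x by blast
    have d: "(y has_vector_derivative z x) (at x)" "(z has_vector_derivative W x * y x) (at x)"
      using x N1 solvesD(4)[OF s] by auto
    let ?n' = "2 * (z x \<bullet> ((W x + \<mu>\<^sup>2) * y x))"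
    have "(n has_vector_derivative (z x \<bullet> (W x * y x) + (W x * y x) \<bullet> z x) + \<mu>\<^sup>2 * (y x \<bullet> z x + z x \<bullet> y x)) (at x)"
      unfolding n_def[abs_def]
      by (intro has_vector_derivative_add has_vector_derivative_mult_right
           bounded_bilinear.has_vector_derivative[OF bounded_bilinear_inner] d)
    moreover have "(z x \<bullet> (W x * y x) + (W x * y x) \<bullet> z x) + \<mu>\<^sup>2 * (y x \<bullet> z x + z x \<bullet> y x) = ?n'"
    proof -
      have "z x \<bullet> ((W x + \<mu>\<^sup>2) * y x) = z x \<bullet> (W x * y x) + \<mu>\<^sup>2 * (z x \<bullet> y x)"
        using inner_scaleR_right[of "z x" "\<mu>\<^sup>2" "y x"] by (simp add: distrib_right inner_add_right scaleR_conv_of_real)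
      then show ?thesis by (simp add: inner_commute algebra_simps)
    qed
    ultimately have n': "(n has_real_derivative ?n') (at x)"
      by (simp add: has_real_derivative_iff_has_vector_derivative)
    have k0: "k \<ge> 0" using k(2) \<mu> by (meson norm_ge_zero order_trans zero_le_mult_iff not_less)
    have "\<bar>?n'\<bar> \<le> 2 * (norm (z x) * norm ((W x + \<mu>\<^sup>2) * y x))"
      using Cauchy_Schwarz_ineq2[of "z x" "(W x + \<mu>\<^sup>2) * y x"] by (simp add: abs_mult)
    also have "\<dots> \<le> 2 * (norm (z x) * ((\<mu> * k) * norm (y x)))"
      unfolding norm_mult using k(2) by (intro mult_left_mono mult_right_mono) auto
    also have "\<dots> = k * (2 * norm (z x) * (\<mu> * norm (y x)))" by (simp add: algebra_simps)
    also have "\<dots> \<le> k * ((norm (z x))\<^sup>2 + (\<mu> * norm (y x))\<^sup>2)"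
      using k0 by (intro mult_left_mono sum_squares_bound) auto
    also have "\<dots> = k * n x" by (simp add: n_def power2_norm_eq_inner power_mult_distrib)
    finally show ?thesis using k(1) n' by blast
  qed
  have Nn: "negligible (N \<union> N1)" using N N1(1) by (rule negligible_Un)
  have sub: "abs_cont u v f" if "abs_cont 0 T f" for f :: "real \<Rightarrow> real"
    using that uv by (auto intro: abs_cont_subinterval)
  have "- (n u * exp (0 - K u)) \<le> - (n v * exp (0 - K v))"
  proof (rule abs_cont_increasing[OF _ uv(2) Nn, where f="\<lambda>x. - (n x * exp (0 - K x))"])
    have "abs_cont u v (\<lambda>x. 0 - n x * exp (0 - K x))"
      by (intro sub abs_cont_diff abs_cont_mult abs_cont_exp abs_cont_const nac K)
    then show "abs_cont u v (\<lambda>x. - (n x * exp (0 - K x)))" by simp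
    fix x assume "x \<in> {u<..<v} - (N \<union> N1)"
    then have "x \<in> {0<..<T} - (N \<union> N1)" using uv by auto
    from dn[OF this] obtain k n' where d: "(K has_real_derivative k) (at x)" "(n has_real_derivative n') (at x)" "\<bar>n'\<bar> \<le> k * n x"
      by blast
    have "((\<lambda>x. - (n x * exp (0 - K x))) has_real_derivative (k * n x - n') * exp (0 - K x)) (at x)"
      using d(1,2) by (auto intro!: derivative_eq_intros simp: algebra_simps)
    moreover have "(k * n x - n') * exp (0 - K x) \<ge> 0" using d(3) by (intro mult_nonneg_nonneg) auto
    ultimately show "\<exists>c\<ge>0. ((\<lambda>x. - (n x * exp (0 - K x))) has_real_derivative c) (at x)" by blast
  qed
  then have "n v * exp (- K v) \<le> n u * exp (- K u)" by simp
  then have "n v * exp (- K v) * exp (K v) \<le> n u * exp (- K u) * exp (K v)" by (rule mult_right_mono) simp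
  then show "energy \<mu> y z v \<le> energy \<mu> y z u * exp (K v - K u)"
    unfolding n_energy by (simp add: mult.assoc flip: exp_add)
  have "n u * exp (K u) \<le> n v * exp (K v)"
  proof (rule abs_cont_increasing[OF _ uv(2) Nn, where f="\<lambda>x. n x * exp (K x)"])
    show "abs_cont u v (\<lambda>x. n x * exp (K x))"
      by (intro sub abs_cont_mult abs_cont_exp nac K)
    fix x assume "x \<in> {u<..<v} - (N \<union> N1)"
    then have "x \<in> {0<..<T} - (N \<union> N1)" using uv by auto
    from dn[OF this] obtain k n' where d: "(K has_real_derivative k) (at x)" "(n has_real_derivative n') (at x)" "\<bar>n'\<bar> \<le> k * n x"
      by blast
    have "((\<lambda>x. n x * exp (K x)) has_real_derivative (k * n x + n') * exp (K x)) (at x)"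
      using d(1,2) by (auto intro!: derivative_eq_intros simp: algebra_simps)
    moreover have "(k * n x + n') * exp (K x) \<ge> 0" using d(3) by (intro mult_nonneg_nonneg) auto
    ultimately show "\<exists>c\<ge>0. ((\<lambda>x. n x * exp (K x)) has_real_derivative c) (at x)" by blast
  qed
  then have "n u * exp (K u) * exp (- K u) \<le> n v * exp (K v) * exp (- K u)" by (rule mult_right_mono) simp
  then show "energy \<mu> y z u \<le> energy \<mu> y z v * exp (K v - K u)"
    unfolding n_energy by (simp add: mult.assoc flip: exp_add)
qed

section \<open>Existence of solutions, and their dependence on the spectral parameter\<close>

lemma absolutely_integrable_mult_continuous:
  fixes h c :: "real \<Rightarrow> complex"
  assumes h: "h absolutely_integrable_on {a..b}" and c: "continuous_on {a..b} c"
  shows "(\<lambda>t. h t * c t) absolutely_integrable_on {a..b}"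
proof -
  have "(\<lambda>t. (\<lambda>u v. v * u) (c t) (h t)) absolutely_integrable_on {a..b}"
  proof (rule absolutely_integrable_bounded_measurable_product[where h="\<lambda>u v. v * u" and f=c and g=h])
    show "bilinear (\<lambda>u v :: complex. v * u)"
      unfolding bilinear_conv_bounded_bilinear by (rule bounded_bilinear.flip[OF bounded_bilinear_mult])
    show "c \<in> borel_measurable (lebesgue_on {a..b})"
      by (rule continuous_imp_measurable_on_sets_lebesgue[OF c]) simp
    show "bounded (c ` {a..b})"
      using c by (intro compact_imp_bounded compact_continuous_image) auto
  qed (simp_all add: h)
  then show ?thesis by simp
qed

text \<open>
  Functions of \<open>x\<close> and \<open>\<lambda>\<close> that are polynomials in \<open>\<lambda>\<close> with continuous coefficients on \<open>[0, T]\<close>. The Picard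
  iterates are of this kind, and any linear functional in \<open>x\<close> takes them to polynomials in \<open>\<lambda>\<close>.
\<close>

inductive poly_family :: "real \<Rightarrow> (real \<Rightarrow> complex \<Rightarrow> complex) \<Rightarrow> bool" for T where
  coeff: "continuous_on {0..T} c \<Longrightarrow> poly_family T (\<lambda>x l. c x)"
| times_param: "poly_family T f \<Longrightarrow> poly_family T (\<lambda>x l. l * f x l)"
| plus: "poly_family T f \<Longrightarrow> poly_family T g \<Longrightarrow> poly_family T (\<lambda>x l. f x l + g x l)"
| cong: "poly_family T f \<Longrightarrow> (\<And>x l. x \<in> {0..T} \<Longrightarrow> g x l = f x l) \<Longrightarrow> poly_family T g"

lemma poly_family_continuous:
  assumes "poly_family T f" shows "continuous_on {0..T} (\<lambda>x. f x l)"
  using assms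
proof induction
  case (cong f g)
  then show ?case by (metis (no_types, lifting) continuous_on_cong)
qed (auto intro!: continuous_intros)

lemma poly_family_sum:
  assumes "\<And>i. i \<in> I \<Longrightarrow> poly_family T (f i)"
  shows "poly_family T (\<lambda>x l. \<Sum>i\<in>I. f i x l)"
  using assms
proof (induction I rule: infinite_finite_induct)
  case (insert i I)
  then show ?case by (auto intro: poly_family.plus)
qed (auto intro: poly_family.coeff)

lemma poly_family_integral:
  assumes "poly_family T f" and h: "h absolutely_integrable_on {0..T}"
  shows "poly_family T (\<lambda>x l. integral {0..x} (\<lambda>t. h t * f t l))"
  using assms(1)
proof induction
  case (coeff c)
  have "(\<lambda>t. h t * c t) integrable_on {0..T}"
    using absolutely_integrable_mult_continuous[OF h coeff] by (simp add: absolutely_integrable_on_def)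
  then show ?case by (intro poly_family.coeff indefinite_integral_continuous_1)
next
  case (times_param f)
  show ?case
    by (rule poly_family.cong[OF poly_family.times_param[OF times_param.IH]]) (simp add: mult.left_commute)
next
  case (plus f g)
  show ?case
  proof (rule poly_family.cong[OF poly_family.plus[OF plus.IH]])
    fix x l assume x: "x \<in> {0..T}"
    have int: "(\<lambda>t. h t * k t l) integrable_on {0..x}" if "poly_family T k" for k
    proof -
      have "(\<lambda>t. h t * k t l) integrable_on {0..T}"
        using absolutely_integrable_mult_continuous[OF h poly_family_continuous[OF that]]
        by (simp add: absolutely_integrable_on_def)
      then show ?thesis by (rule integrable_subinterval_real) (use x in auto)
    qed
    show "integral {0..x} (\<lambda>t. h t * (f t l + g t l)) = integral {0..x} (\<lambda>t. h t * f t l) + integral {0..x} (\<lambda>t. h t * g t l)"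
      unfolding distrib_left by (intro integral_add int plus.hyps)
  qed
next
  case (cong f g)
  show ?case
  proof (rule poly_family.cong[OF cong.IH])
    fix x l assume "x \<in> {0..T}"
    then show "integral {0..x} (\<lambda>t. h t * g t l) = integral {0..x} (\<lambda>t. h t * f t l)"
      by (intro integral_cong) (simp add: cong.hyps)
  qed
qed

text \<open>
  Approximation by such polynomials, uniformly for \<open>x \<in> [0, T]\<close> and bounded \<open>\<lambda>\<close>. It makes
  \<open>\<lambda> \<mapsto> \<Lambda>(y(\<cdot>, \<lambda>))\<close> entire for every bounded functional \<open>\<Lambda>\<close>, in particular for point evaluation and
  for the Stieltjes integral.
\<close>

definition entire_family :: "real \<Rightarrow> (real \<Rightarrow> complex \<Rightarrow> complex) \<Rightarrow> bool" where
  "entire_family T y \<longleftrightarrow> (\<exists>Y. (\<forall>n. poly_family T (Y n)) \<and>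
     (\<forall>R. uniform_limit ({0..T} \<times> cball 0 R) (\<lambda>n (x,l). Y n x l) (\<lambda>(x,l). y x l) sequentially))"

lemma entire_family_continuous:
  assumes "entire_family T y" shows "continuous_on {0..T} (\<lambda>x. y x l)"
proof -
  obtain Y where Y: "\<And>n. poly_family T (Y n)"
    "uniform_limit ({0..T} \<times> cball 0 (norm l)) (\<lambda>n (x,l). Y n x l) (\<lambda>(x,l). y x l) sequentially"
    using assms unfolding entire_family_def by blast
  have "uniform_limit {0..T} (\<lambda>n x. Y n x l) (\<lambda>x. y x l) sequentially"
    using Y(2) unfolding uniform_limit_iff by (fastforce elim: eventually_mono)
  then show ?thesis
    by (rule uniform_limit_theorem[rotated]) (auto intro!: always_eventually poly_family_continuous Y(1))
qed

theorem holomorphic_functional_entire_family: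
  fixes \<Lambda> :: "(real \<Rightarrow> complex) \<Rightarrow> complex"
  assumes y: "entire_family T y"
    and add: "\<And>f g. continuous_on {0..T} f \<Longrightarrow> continuous_on {0..T} g \<Longrightarrow> \<Lambda> (\<lambda>x. f x + g x) = \<Lambda> f + \<Lambda> g"
    and scale: "\<And>c f. continuous_on {0..T} f \<Longrightarrow> \<Lambda> (\<lambda>x. c * f x) = c * \<Lambda> f"
    and bound: "\<And>f M. continuous_on {0..T} f \<Longrightarrow> (\<And>x. x \<in> {0..T} \<Longrightarrow> norm (f x) \<le> M) \<Longrightarrow> norm (\<Lambda> f) \<le> B * M"
  shows "(\<lambda>l. \<Lambda> (\<lambda>x. y x l)) holomorphic_on UNIV"
proof -
  have diff: "\<Lambda> (\<lambda>x. f x - g x) = \<Lambda> f - \<Lambda> g" if "continuous_on {0..T} f" "continuous_on {0..T} g" for f g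
    using add[OF that(1), of "\<lambda>x. (-1) * g x"] scale[OF that(2), of "-1"] that by (auto intro!: continuous_intros)
  have cong: "\<Lambda> f = \<Lambda> g" if "continuous_on {0..T} g" "\<And>x. x \<in> {0..T} \<Longrightarrow> f x = g x" for f g
  proof -
    have f: "continuous_on {0..T} f" using that by (metis (no_types, lifting) continuous_on_cong)
    have "norm (\<Lambda> (\<lambda>x. f x - g x)) \<le> B * 0" using that f by (intro bound continuous_intros) auto
    then show ?thesis using diff[OF f that(1)] by simp
  qed
  have hol: "(\<lambda>l. \<Lambda> (\<lambda>x. f x l)) holomorphic_on UNIV" if "poly_family T f" for f
    using that
  proof induction
    case (times_param f)
    then show ?case using scale[OF poly_family_continuous[OF times_param.hyps]] by (auto intro!: holomorphic_intros)
  next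
    case (plus f g)
    then show ?case using add[OF poly_family_continuous[OF plus.hyps(1)] poly_family_continuous[OF plus.hyps(2)]]
      by (auto intro!: holomorphic_intros)
  next
    case (cong f g)
    have "\<Lambda> (\<lambda>x. g x l) = \<Lambda> (\<lambda>x. f x l)" for l
      using cong.hyps by (intro \<open>\<And>f g. continuous_on {0..T} g \<Longrightarrow> (\<And>x. x \<in> {0..T} \<Longrightarrow> f x = g x) \<Longrightarrow> \<Lambda> f = \<Lambda> g\<close>
         poly_family_continuous) auto
    then show ?case using cong.IH by simp
  qed auto
  obtain Y where Y: "\<And>n. poly_family T (Y n)"
    "\<And>R. uniform_limit ({0..T} \<times> cball 0 R) (\<lambda>n (x,l). Y n x l) (\<lambda>(x,l). y x l) sequentially"
    using y unfolding entire_family_def by blast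
  show ?thesis
  proof (rule holomorphic_uniform_sequence[where f="\<lambda>n l. \<Lambda> (\<lambda>x. Y n x l)"])
    show "(\<lambda>l. \<Lambda> (\<lambda>x. Y n x l)) holomorphic_on UNIV" for n by (rule hol[OF Y(1)])
    fix l :: complex
    have "uniform_limit (cball l 1) (\<lambda>n l. \<Lambda> (\<lambda>x. Y n x l)) (\<lambda>l. \<Lambda> (\<lambda>x. y x l)) sequentially"
      unfolding uniform_limit_iff
    proof (intro allI impI)
      fix e :: real assume e: "e > 0"
      define e' where "e' = e / (\<bar>B\<bar> + 1)"
      have "e' > 0" using e by (simp add: e'_def add_nonneg_pos)
      then have "eventually (\<lambda>n. \<forall>x\<in>{0..T} \<times> cball 0 (norm l + 1). dist ((\<lambda>(x,l). Y n x l) x) ((\<lambda>(x,l). y x l) x) < e') sequentially"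
        using Y(2)[of "norm l + 1"] unfolding uniform_limit_iff by blast
      then show "eventually (\<lambda>n. \<forall>m\<in>cball l 1. dist (\<Lambda> (\<lambda>x. Y n x m)) (\<Lambda> (\<lambda>x. y x m)) < e) sequentially"
      proof eventually_elim
        case (elim n)
        show ?case
        proof
          fix m assume m: "m \<in> cball l 1"
          have "norm m \<le> norm l + norm (m - l)" using norm_triangle_ineq[of l "m - l"] by simp
          then have m': "m \<in> cball 0 (norm l + 1)" using m by (simp add: dist_norm norm_minus_commute)
          have cY: "continuous_on {0..T} (\<lambda>x. Y n x m)" by (rule poly_family_continuous[OF Y(1)])
          have cy: "continuous_on {0..T} (\<lambda>x. y x m)" by (rule entire_family_continuous[OF y])
          have "norm (\<Lambda> (\<lambda>x. Y n x m - y x m)) \<le> B * e'"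
          proof (rule bound)
            show "continuous_on {0..T} (\<lambda>x. Y n x m - y x m)" by (intro continuous_intros cY cy)
            fix x assume "x \<in> {0..T}"
            then show "norm (Y n x m - y x m) \<le> e'" using bspec[OF elim, of "(x,m)"] m' by (simp add: dist_norm)
          qed
          also have "\<dots> \<le> \<bar>B\<bar> * e'" using \<open>e' > 0\<close> by (intro mult_right_mono) auto
          also have "\<dots> < (\<bar>B\<bar> + 1) * e'" using \<open>e' > 0\<close> by (intro mult_strict_right_mono) auto
          also have "\<dots> = e" using abs_ge_zero[of B] by (simp add: e'_def)
          finally show "dist (\<Lambda> (\<lambda>x. Y n x m)) (\<Lambda> (\<lambda>x. y x m)) < e"
            unfolding dist_norm diff[OF cY cy, symmetric] .
        qed
      qed
    qed
    then show "\<exists>d>0. cball l d \<subseteq> UNIV \<and> uniform_limit (cball l d) (\<lambda>n l. \<Lambda> (\<lambda>x. Y n x l)) (\<lambda>l. \<Lambda> (\<lambda>x. y x l)) sequentially"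
      by (intro exI[of _ 1]) auto
  qed simp
qed

lemma abs_cont_power:
  fixes f :: "real \<Rightarrow> 'a::real_normed_algebra_1"
  assumes "abs_cont a b f" shows "abs_cont a b (\<lambda>x. f x ^ n)"
  using assms by (induction n) (auto intro: abs_cont_mult abs_cont_const)

lemma integral_mult_tendsto:
  fixes h :: "real \<Rightarrow> complex"
  assumes h: "h absolutely_integrable_on {0..T}" and x: "x \<in> {0..T}"
    and c: "\<And>N. continuous_on {0..T} (F N)" and B: "\<And>N t. t \<in> {0..T} \<Longrightarrow> norm (F N t) \<le> B"
    and lim: "\<And>t. t \<in> {0..T} \<Longrightarrow> (\<lambda>N. F N t) \<longlonglongrightarrow> f t"
  shows "(\<lambda>N. integral {0..x} (\<lambda>t. h t * F N t)) \<longlonglongrightarrow> integral {0..x} (\<lambda>t. h t * f t)"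
proof (rule dominated_convergence(2)[where h="\<lambda>t. norm (h t) * B"])
  have sub: "{0..x} \<subseteq> {0..T}" using x by auto
  fix N
  have "(\<lambda>t. h t * F N t) integrable_on {0..T}"
    using absolutely_integrable_mult_continuous[OF h c] by (simp add: absolutely_integrable_on_def)
  then show "(\<lambda>t. h t * F N t) integrable_on {0..x}" by (rule integrable_subinterval_real[OF _ sub])
  have "(\<lambda>t. norm (h t)) integrable_on {0..x}"
    using h by (intro integrable_subinterval_real[OF _ sub]) (simp add: absolutely_integrable_on_def)
  then show "(\<lambda>t. norm (h t) * B) integrable_on {0..x}" by (rule integrable_on_mult_left)
  fix t assume "t \<in> {0..x}"
  then have t: "t \<in> {0..T}" using sub by blast
  show "norm (h t * F N t) \<le> norm (h t) * B"
    unfolding norm_mult using B[OF t] by (intro mult_left_mono) auto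
  show "(\<lambda>k. h t * F k t) \<longlonglongrightarrow> h t * f t" by (intro tendsto_intros lim t)
qed

locale pencil =
  fixes T :: real and p q :: "real \<Rightarrow> complex"
  assumes T_pos: "T > 0" and p_cont: "continuous_on {0..T} p"
    and q_int: "q absolutely_integrable_on {0..T}"
begin

definition W :: "complex \<Rightarrow> real \<Rightarrow> complex" where
  "W l x = 2 * l * p x + q x - l\<^sup>2"

definition Q :: "real \<Rightarrow> real" where
  "Q x = integral {0..x} (\<lambda>t. norm (q t))"

text \<open>
  The constant is the supremum plus one, so that it is positive even when \<open>p = 0\<close>.
\<close>

definition p_max :: real where "p_max = (SUP x\<in>{0..T}. norm (p x)) + 1"

lemma norm_p_less: "norm (p x) < p_max" if "x \<in> {0..T}"
proof -
  have "compact ((\<lambda>x. norm (p x)) ` {0..T})"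
    by (intro compact_continuous_image continuous_intros p_cont) simp
  then have "norm (p x) \<le> (SUP x\<in>{0..T}. norm (p x))"
    using that by (intro cSUP_upper bounded_imp_bdd_above compact_imp_bounded)
  then show ?thesis by (simp add: p_max_def)
qed

lemmas norm_p_le = less_imp_le[OF norm_p_less]

lemma p_max_pos: "p_max > 0"
  using le_less_trans[OF norm_ge_zero norm_p_less[of 0]] T_pos by simp

lemma norm_q_int: "(\<lambda>t. norm (q t)) absolutely_integrable_on {0..T}"
  using absolutely_integrable_norm[OF q_int] by (simp add: o_def)

lemma Q_abs_cont: "abs_cont 0 T Q"
  unfolding Q_def[abs_def] by (rule abs_cont_indefinite_integral[OF norm_q_int])

lemma Q_derivative:
  obtains N where "negligible N" "\<And>x. x \<in> {0<..<T} - N \<Longrightarrow> (Q has_real_derivative norm (q x)) (at x)"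
proof -
  have "(\<lambda>t. norm (q t)) integrable_on {0..T}" using norm_q_int by (simp add: absolutely_integrable_on_def)
  from indefinite_integral_has_vector_derivative_ae[OF this] show ?thesis
    using that unfolding Q_def[abs_def] has_real_derivative_iff_has_vector_derivative by metis
qed

lemma Q_0: "Q 0 = 0" by (simp add: Q_def)

lemma Q_mono: "Q x \<le> Q y" if "0 \<le> x" "x \<le> y" "y \<le> T"
proof -
  obtain N where N: "negligible N" "\<And>x. x \<in> {0<..<T} - N \<Longrightarrow> (Q has_real_derivative norm (q x)) (at x)"
    by (rule Q_derivative, rule that)
  show ?thesis
  proof (rule abs_cont_increasing[OF abs_cont_subinterval[OF Q_abs_cont that(1,3)] that(2) N(1)])
    fix t assume "t \<in> {x<..<y} - N"
    then have "t \<in> {0<..<T} - N" using that by auto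
    then show "\<exists>c\<ge>0. (Q has_real_derivative c) (at t)" using N(2) norm_ge_zero by blast
  qed
qed

lemma Q_nonneg: "Q x \<ge> 0" if "x \<in> {0..T}" using Q_mono[of 0 x] Q_0 that by simp

definition majorant :: "real \<Rightarrow> real \<Rightarrow> real" where "majorant A x = A * x + Q x"

lemma majorant_abs_cont: "abs_cont 0 T (majorant A)"
  unfolding majorant_def[abs_def] by (intro abs_cont_add abs_cont_cmult abs_cont_id Q_abs_cont)

lemma majorant_derivative:
  obtains N where "negligible N" "\<And>x A. x \<in> {0<..<T} - N \<Longrightarrow> (majorant A has_real_derivative A + norm (q x)) (at x)"
proof -
  obtain N where N: "negligible N" "\<And>x. x \<in> {0<..<T} - N \<Longrightarrow> (Q has_real_derivative norm (q x)) (at x)"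
    by (rule Q_derivative, rule that)
  have "(majorant A has_real_derivative A + norm (q x)) (at x)" if "x \<in> {0<..<T} - N" for x A
    unfolding majorant_def[abs_def] using N(2)[OF that] by (auto intro!: derivative_eq_intros)
  then show ?thesis using that[OF N(1)] by blast
qed

lemma majorant_le: "0 \<le> A \<Longrightarrow> x \<in> {0..T} \<Longrightarrow> 0 \<le> majorant A x \<and> majorant A x \<le> majorant A T"
  using Q_mono[of x T] Q_nonneg[of x] by (auto simp: majorant_def intro!: add_mono mult_left_mono)

text \<open>
  The induction step of the factorial estimate for Picard iterates; \<open>A + \<bar>q\<bar>\<close> is the derivative of \<open>majorant A\<close>, so
  the right-hand side is an antiderivative of the bound on the integrand.
\<close>

lemma integral_le_majorant_power:
  assumes f: "f absolutely_integrable_on {0..T}" and A: "A \<ge> 0" and C: "C \<ge> 0"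
    and le: "\<And>t. t \<in> {0<..<T} \<Longrightarrow> norm (f t) \<le> (A + norm (q t)) * (C * majorant A t ^ n)"
    and x: "x \<in> {0..T}"
  shows "norm (integral {0..x} f :: complex) \<le> C / (real n + 1) * majorant A x ^ Suc n"
proof -
  obtain N1 where N1: "negligible N1" "\<And>x A. x \<in> {0<..<T} - N1 \<Longrightarrow> (majorant A has_real_derivative A + norm (q x)) (at x)"
    by (rule majorant_derivative, rule that)
  have "f integrable_on {0..T}" using f by (simp add: absolutely_integrable_on_def)
  then obtain N2 where N2: "negligible N2"
      "\<And>x. x \<in> {0<..<T} - N2 \<Longrightarrow> ((\<lambda>t. integral {0..t} f) has_vector_derivative f x) (at x)"
    using indefinite_integral_has_vector_derivative_ae by blast
  have "norm (integral {0..x} f - integral {0..0} f) \<le> C / (real n + 1) * majorant A x ^ Suc n - C / (real n + 1) * majorant A 0 ^ Suc n"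
  proof (rule abs_cont_norm_increment_le[where a=0 and b=T and N="N1 \<union> N2" and f="\<lambda>t. integral {0..t} f" and H="\<lambda>x. C / (real n + 1) * majorant A x ^ Suc n"])
    show "abs_cont 0 T (\<lambda>t. integral {0..t} f)" by (rule abs_cont_indefinite_integral[OF f])
    show "abs_cont 0 T (\<lambda>x. C / (real n + 1) * majorant A x ^ Suc n)"
      by (intro abs_cont_cmult abs_cont_power majorant_abs_cont)
    show "negligible (N1 \<union> N2)" by (intro negligible_Un N1 N2)
    fix t assume t: "t \<in> {0<..<T} - (N1 \<union> N2)"
    have d1: "((\<lambda>t. integral {0..t} f) has_vector_derivative f t) (at t)" using N2 t by auto
    have "(majorant A has_real_derivative A + norm (q t)) (at t)" using N1 t by auto
    from DERIV_cmult[OF DERIV_power[OF this, of "Suc n"], of "C / (real n + 1)"]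
    have d2: "((\<lambda>x. C / (real n + 1) * majorant A x ^ Suc n) has_real_derivative
        C / (real n + 1) * (real (Suc n) * ((A + norm (q t)) * majorant A t ^ n))) (at t)" by simp
    have "C / (real n + 1) * (real (Suc n) * ((A + norm (q t)) * majorant A t ^ n)) = (A + norm (q t)) * (C * majorant A t ^ n)"
      by (simp add: field_simps)
    then show "\<exists>f' h. ((\<lambda>t. integral {0..t} f) has_vector_derivative f') (at t) \<and>
        ((\<lambda>x. C / (real n + 1) * majorant A x ^ Suc n) has_real_derivative h) (at t) \<and> norm f' \<le> h"
      using d1 d2 le[of t] t by (intro exI conjI) auto
  qed (use x in auto)
  then show ?thesis by (simp add: majorant_def Q_0)
qed

primrec picard :: "complex \<Rightarrow> complex \<Rightarrow> nat \<Rightarrow> (real \<Rightarrow> complex \<Rightarrow> complex) \<times> (real \<Rightarrow> complex \<Rightarrow> complex)" where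
  "picard c0 c1 0 = (\<lambda>x l. c0, \<lambda>x l. c1)"
| "picard c0 c1 (Suc n) = (\<lambda>x l. integral {0..x} (\<lambda>t. snd (picard c0 c1 n) t l),
                           \<lambda>x l. integral {0..x} (\<lambda>t. W l t * fst (picard c0 c1 n) t l))"

lemma W_int: "W l absolutely_integrable_on {0..T}"
proof -
  have "(\<lambda>x. 2 * l * p x - l\<^sup>2) absolutely_integrable_on {0..T}"
    by (intro absolutely_integrable_continuous_real continuous_intros p_cont)
  from set_integral_add(1)[OF this q_int] show ?thesis by (simp add: W_def[abs_def] algebra_simps)
qed

lemma poly_family_picard:
  "poly_family T (fst (picard c0 c1 n)) \<and> poly_family T (snd (picard c0 c1 n))"
proof (induction n)
  case 0
  then show ?case by (auto intro!: poly_family.coeff)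
next
  case (Suc n)
  let ?u = "fst (picard c0 c1 n)" and ?v = "snd (picard c0 c1 n)"
  have one: "(\<lambda>t. 1 :: complex) absolutely_integrable_on {0..T}"
    by (intro absolutely_integrable_continuous_real continuous_intros)
  have pint: "p absolutely_integrable_on {0..T}"
    by (intro absolutely_integrable_continuous_real p_cont)
  have "poly_family T (\<lambda>x l. integral {0..x} (\<lambda>t. 1 * ?v t l))"
    using Suc by (intro poly_family_integral one) auto
  moreover have "poly_family T (\<lambda>x l. integral {0..x} (\<lambda>t. W l t * ?u t l))"
  proof -
    have u: "poly_family T ?u" using Suc by simp
    note P = poly_family_integral[OF u]
    have m2: "(\<lambda>t. 2 * p t) absolutely_integrable_on {0..T}"
      by (intro absolutely_integrable_continuous_real continuous_intros p_cont)
    have m1: "(\<lambda>t. -1 :: complex) absolutely_integrable_on {0..T}"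
      by (intro absolutely_integrable_continuous_real continuous_intros)
    note poly_family.plus[OF poly_family.plus[OF poly_family.times_param[OF P[OF m2]] P[OF q_int]]
        poly_family.times_param[OF poly_family.times_param[OF P[OF m1]]]]
    then show ?thesis
    proof (rule poly_family.cong)
      fix x l assume x: "x \<in> {0..T}"
      have int: "(\<lambda>t. h t * ?u t l) integrable_on {0..x}" if "h absolutely_integrable_on {0..T}" for h
      proof -
        have "(\<lambda>t. h t * ?u t l) integrable_on {0..T}"
          using absolutely_integrable_mult_continuous[OF that poly_family_continuous[OF u]]
          by (simp add: absolutely_integrable_on_def)
        then show ?thesis by (rule integrable_subinterval_real) (use x in auto)
      qed
      have "integral {0..x} (\<lambda>t. W l t * ?u t l)
          = integral {0..x} (\<lambda>t. l * (2 * p t * ?u t l) + q t * ?u t l + l * (l * (-1 * ?u t l)))"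
        by (intro integral_cong) (simp add: W_def algebra_simps power2_eq_square)
      also have "\<dots> = l * integral {0..x} (\<lambda>t. 2 * p t * ?u t l) + integral {0..x} (\<lambda>t. q t * ?u t l)
          + l * (l * integral {0..x} (\<lambda>t. -1 * ?u t l))"
        by (intro integral_unique has_integral_add has_integral_mult_right integrable_integral int m2 q_int m1)
      finally show "integral {0..x} (\<lambda>t. W l t * ?u t l) = \<dots>" .
    qed
  qed
  ultimately show ?case by simp
qed

lemma picard_bound:
  assumes A: "1 \<le> A" "\<And>x. x \<in> {0<..<T} \<Longrightarrow> norm (W l x) \<le> A + norm (q x)" and x: "x \<in> {0..T}"
    and C: "norm c0 \<le> C" "norm c1 \<le> C"
  shows "norm (fst (picard c0 c1 n) x l) \<le> C / fact n * majorant A x ^ n \<and>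
         norm (snd (picard c0 c1 n) x l) \<le> C / fact n * majorant A x ^ n"
  using x
proof (induction n arbitrary: x)
  case 0
  then show ?case using C by simp
next
  case (Suc n)
  let ?u = "fst (picard c0 c1 n)" and ?v = "snd (picard c0 c1 n)"
  have "C \<ge> 0" using C(1) norm_ge_zero order_trans by blast
  then have C0: "C / fact n \<ge> 0" by simp
  have A0: "A \<ge> 0" using A by simp
  have eq: "C / fact (Suc n) = C / fact n / (real n + 1)" by (simp add: field_simps)
  have cu: "continuous_on {0..T} (\<lambda>t. ?u t l)" and cv: "continuous_on {0..T} (\<lambda>t. ?v t l)"
    using poly_family_picard poly_family_continuous by blast+
  have "norm (integral {0..x} (\<lambda>t. ?v t l)) \<le> C / fact n / (real n + 1) * majorant A x ^ Suc n"
  proof (rule integral_le_majorant_power[OF _ A0 C0 _ Suc.prems])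
    show "(\<lambda>t. ?v t l) absolutely_integrable_on {0..T}" by (intro absolutely_integrable_continuous_real cv)
    fix t assume "t \<in> {0<..<T}"
    then have t: "t \<in> {0..T}" by simp
    have "1 * norm (?v t l) \<le> (A + norm (q t)) * (C / fact n * majorant A t ^ n)"
      using A(1) A0 Suc.IH[OF t] by (intro mult_mono) (auto intro: add_increasing2)
    then show "norm (?v t l) \<le> (A + norm (q t)) * (C / fact n * majorant A t ^ n)" by simp
  qed
  moreover have "norm (integral {0..x} (\<lambda>t. W l t * ?u t l)) \<le> C / fact n / (real n + 1) * majorant A x ^ Suc n"
  proof (rule integral_le_majorant_power[OF _ A0 C0 _ Suc.prems])
    show "(\<lambda>t. W l t * ?u t l) absolutely_integrable_on {0..T}"
      by (rule absolutely_integrable_mult_continuous[OF W_int cu])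
    fix t assume t: "t \<in> {0<..<T}"
    have "norm (W l t) * norm (?u t l) \<le> (A + norm (q t)) * (C / fact n * majorant A t ^ n)"
      using A0 A(2)[OF t] Suc.IH[of t] t by (intro mult_mono) auto
    then show "norm (W l t * ?u t l) \<le> (A + norm (q t)) * (C / fact n * majorant A t ^ n)"
      by (simp add: norm_mult)
  qed
  ultimately show ?case unfolding eq by simp
qed

text \<open>
  The Picard series converges uniformly by the factorial bound, so the limit satisfies the integrated equations
  \<open>y = c0 + \<integral> z\<close> and \<open>z = c1 + \<integral> W y\<close>; differentiating these almost everywhere gives the equation.
\<close>

theorem solution_family_exists:
  obtains y z where
    "\<And>l. solves T (W l) (\<lambda>x. y x l) (\<lambda>x. z x l)" "\<And>l. y 0 l = c0" "\<And>l. z 0 l = c1"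
    "entire_family T y" "entire_family T z"
proof -
  define U where "U n = fst (picard c0 c1 n)" for n
  define V where "V n = snd (picard c0 c1 n)" for n
  define y where "y x l = (\<Sum>n. U n x l)" for x l
  define z where "z x l = (\<Sum>n. V n x l)" for x l
  define M where "M = p_max"
  note M = p_max_pos[folded M_def] norm_p_le[folded M_def]
  define C where "C = max (norm c0) (norm c1)"
  define A where "A R = 1 + 2 * R * M + R\<^sup>2" for R :: real
  define g where "g R n = C / fact n * majorant (A R) T ^ n" for R n
  have C0: "C \<ge> 0" by (simp add: C_def le_max_iff_disj)
  have pf: "poly_family T (U n)" "poly_family T (V n)" for n using poly_family_picard by (auto simp: U_def V_def)
  have bnd: "norm (U n x l) \<le> g R n" "norm (V n x l) \<le> g R n" if l: "norm l \<le> R" and x: "x \<in> {0..T}" for n x l R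
  proof -
    have R: "R \<ge> 0" using l norm_ge_zero order_trans by blast
    then have A1: "A R \<ge> 1" using M(1) by (simp add: A_def)
    have "norm (W l t) \<le> A R + norm (q t)" if "t \<in> {0<..<T}" for t
    proof -
      have "norm (W l t) \<le> norm (2 * l * p t) + norm (q t) + norm (l\<^sup>2)"
        unfolding W_def by (meson add_mono norm_triangle_ineq norm_triangle_ineq4 order_refl order_trans)
      also have "\<dots> = 2 * norm l * norm (p t) + norm (q t) + (norm l)\<^sup>2" by (simp add: norm_mult norm_power)
      also have "\<dots> \<le> 2 * R * M + norm (q t) + R\<^sup>2"
        using l M(2)[of t] that R by (intro add_mono mult_mono power_mono) auto
      finally show ?thesis by (simp add: A_def)
    qed
    note b = picard_bound[OF A1 this x, of c0 C c1 n]
    have "majorant (A R) x ^ n \<le> majorant (A R) T ^ n" using majorant_le[of "A R" x] A1 x by (intro power_mono) auto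
    then have "C / fact n * majorant (A R) x ^ n \<le> g R n" unfolding g_def using C0 by (intro mult_left_mono) auto
    then show "norm (U n x l) \<le> g R n" "norm (V n x l) \<le> g R n" using b by (auto simp: U_def V_def C_def)
  qed
  have gsum: "summable (g R)" for R
    using summable_mult[OF summable_exp[of "majorant (A R) T"], of C] by (simp add: g_def[abs_def] field_simps)
  have ulim: "uniform_limit ({0..T} \<times> cball 0 R) (\<lambda>N (x,l). \<Sum>n<N. H n x l) (\<lambda>(x,l). \<Sum>n. H n x l) sequentially"
    if "\<And>n x l. norm l \<le> R \<Longrightarrow> x \<in> {0..T} \<Longrightarrow> norm (H n x l) \<le> g R n" for H :: "nat \<Rightarrow> real \<Rightarrow> complex \<Rightarrow> complex" and R
  proof -
    have "uniform_limit ({0..T} \<times> cball 0 R) (\<lambda>N a. \<Sum>n<N. (\<lambda>(x,l). H n x l) a) (\<lambda>a. \<Sum>n. (\<lambda>(x,l). H n x l) a) sequentially"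
      by (rule Weierstrass_m_test[OF _ gsum[of R]]) (use that in auto)
    then show ?thesis by (simp add: case_prod_unfold)
  qed
  have fam: "entire_family T y" "entire_family T z"
    unfolding entire_family_def y_def z_def using ulim[OF bnd(1)] ulim[OF bnd(2)]
    by (intro exI[of _ "\<lambda>N x l. \<Sum>n<N. U n x l"] exI[of _ "\<lambda>N x l. \<Sum>n<N. V n x l"] conjI allI poly_family_sum pf; simp)+
  have lim: "(\<lambda>N. \<Sum>n<N. H n x l) \<longlonglongrightarrow> (\<Sum>n. H n x l)" and part: "norm (\<Sum>n<N. H n x l) \<le> suminf (g (norm l))"
    if "\<And>n x l R. norm l \<le> R \<Longrightarrow> x \<in> {0..T} \<Longrightarrow> norm (H n x l) \<le> g R n" "x \<in> {0..T}"
    for H :: "nat \<Rightarrow> real \<Rightarrow> complex \<Rightarrow> complex" and x l N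
  proof -
    have b: "norm (H n x l) \<le> g (norm l) n" for n by (rule that(1)[OF order_refl that(2)])
    have "summable (\<lambda>n. H n x l)" by (rule summable_comparison_test'[OF gsum[of "norm l"], of 0]) (use b in auto)
    then show "(\<lambda>N. \<Sum>n<N. H n x l) \<longlonglongrightarrow> (\<Sum>n. H n x l)" by (rule summable_LIMSEQ)
    have "norm (\<Sum>n<N. H n x l) \<le> (\<Sum>n<N. g (norm l) n)" by (rule sum_norm_le) (use b in auto)
    also have "\<dots> \<le> suminf (g (norm l))"
      using b norm_ge_zero order_trans by (intro sum_le_suminf gsum) blast+
    finally show "norm (\<Sum>n<N. H n x l) \<le> suminf (g (norm l))" .
  qed
  have inteq: "(\<Sum>n. G n x l) = c + integral {0..x} (\<lambda>t. h t * (\<Sum>n. H n t l))"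
    if h: "h absolutely_integrable_on {0..T}" and x: "x \<in> {0..T}" and H: "\<And>n. poly_family T (H n)"
      and G0: "\<And>x. G 0 x l = c" and GS: "\<And>n x. G (Suc n) x l = integral {0..x} (\<lambda>t. h t * H n t l)"
      and bG: "\<And>n x l R. norm l \<le> R \<Longrightarrow> x \<in> {0..T} \<Longrightarrow> norm (G n x l) \<le> g R n"
      and bH: "\<And>n x l R. norm l \<le> R \<Longrightarrow> x \<in> {0..T} \<Longrightarrow> norm (H n x l) \<le> g R n"
    for G H :: "nat \<Rightarrow> real \<Rightarrow> complex \<Rightarrow> complex" and c h x l
  proof (rule LIMSEQ_unique)
    show "(\<lambda>N. \<Sum>n<Suc N. G n x l) \<longlonglongrightarrow> (\<Sum>n. G n x l)"
      using lim[OF bG x] by (rule LIMSEQ_Suc)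
    have "(\<Sum>n<Suc N. G n x l) = c + integral {0..x} (\<lambda>t. h t * (\<Sum>n<N. H n t l))" for N
    proof -
      have "(\<lambda>t. h t * H n t l) integrable_on {0..x}" for n
      proof -
        have "(\<lambda>t. h t * H n t l) integrable_on {0..T}"
          using absolutely_integrable_mult_continuous[OF h poly_family_continuous[OF H]]
          by (simp add: absolutely_integrable_on_def)
        then show ?thesis by (rule integrable_subinterval_real) (use x in auto)
      qed
      then have "integral {0..x} (\<lambda>t. \<Sum>n<N. h t * H n t l) = (\<Sum>n<N. integral {0..x} (\<lambda>t. h t * H n t l))"
        by (intro integral_sum) auto
      then show ?thesis unfolding sum.lessThan_Suc_shift G0 GS by (simp add: sum_distrib_left)
    qed
    moreover have "(\<lambda>N. c + integral {0..x} (\<lambda>t. h t * (\<Sum>n<N. H n t l))) \<longlonglongrightarrow> c + integral {0..x} (\<lambda>t. h t * (\<Sum>n. H n t l))"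
      by (intro tendsto_add tendsto_const integral_mult_tendsto[OF h x] continuous_on_sum poly_family_continuous H)
         (rule part[OF bH] lim[OF bH]; assumption)+
    ultimately show "(\<lambda>N. \<Sum>n<Suc N. G n x l) \<longlonglongrightarrow> c + integral {0..x} (\<lambda>t. h t * (\<Sum>n. H n t l))" by simp
  qed
  have one: "(\<lambda>t. 1 :: complex) absolutely_integrable_on {0..T}"
    by (intro absolutely_integrable_continuous_real continuous_intros)
  have yeq: "y x l = c0 + integral {0..x} (\<lambda>t. z t l)" if "x \<in> {0..T}" for x l
    unfolding y_def z_def
    using inteq[where G=U and H=V and c=c0 and l=l, OF one that pf(2) _ _ bnd] by (simp add: U_def V_def)
  have zeq: "z x l = c1 + integral {0..x} (\<lambda>t. W l t * y t l)" if "x \<in> {0..T}" for x l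
    unfolding y_def z_def
    using inteq[where G=V and H=U and c=c1 and l=l, OF W_int[of l] that pf(1) _ _ bnd(2,1)] by (simp add: U_def V_def)
  have sol: "solves T (W l) (\<lambda>x. y x l) (\<lambda>x. z x l)" for l
  proof -
    have cy: "continuous_on {0..T} (\<lambda>x. y x l)" and cz: "continuous_on {0..T} (\<lambda>x. z x l)"
      by (intro entire_family_continuous fam)+
    have Wy: "(\<lambda>t. W l t * y t l) absolutely_integrable_on {0..T}"
      by (rule absolutely_integrable_mult_continuous[OF W_int cy])
    have dy: "((\<lambda>x. y x l) has_vector_derivative z x l) (at x within {0..T})" if x: "x \<in> {0..T}" for x
    proof (rule has_vector_derivative_transform[OF x yeq])
      show "((\<lambda>x. c0 + integral {0..x} (\<lambda>t. z t l)) has_vector_derivative z x l) (at x within {0..T})"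
        using has_vector_derivative_add[OF has_vector_derivative_const integral_has_vector_derivative[OF cz x]] by simp
    qed
    have acy: "abs_cont 0 T (\<lambda>x. y x l)"
    proof -
      have "bounded ((\<lambda>x. z x l) ` {0..T})" using cz by (intro compact_imp_bounded compact_continuous_image) auto
      then obtain B where "\<And>x. x \<in> {0..T} \<Longrightarrow> norm (z x l) \<le> B" by (metis bounded_iff imageI)
      then show ?thesis using dy by (rule abs_cont_of_vector_derivative[rotated])
    qed
    have acI: "abs_cont 0 T (\<lambda>x. integral {0..x} (\<lambda>t. W l t * y t l))"
      by (rule abs_cont_indefinite_integral[OF Wy])
    have acz: "abs_cont 0 T (\<lambda>x. z x l)"
      by (rule abs_cont_dominated[OF acI acI, of _ 1]) (simp add: zeq)
    have "(\<lambda>t. W l t * y t l) integrable_on {0..T}" using Wy by (simp add: absolutely_integrable_on_def)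
    then obtain N where N: "negligible N" "\<And>x. x \<in> {0<..<T} - N \<Longrightarrow>
        ((\<lambda>x. integral {0..x} (\<lambda>t. W l t * y t l)) has_vector_derivative W l x * y x l) (at x)"
      using indefinite_integral_has_vector_derivative_ae by blast
    have "((\<lambda>x. z x l) has_vector_derivative W l x * y x l) (at x)" if "x \<in> {0<..<T} - N" for x
    proof (rule has_vector_derivative_transform_within_open[of _ _ _ "{0<..<T}"])
      show "((\<lambda>x. c1 + integral {0..x} (\<lambda>t. W l t * y t l)) has_vector_derivative W l x * y x l) (at x)"
        using has_vector_derivative_add[OF has_vector_derivative_const N(2)[OF that]] by simp
    qed (use that zeq in auto)
    then show ?thesis unfolding solves_def using dy acy acz N(1) by blast
  qed
  show ?thesis
  proof (rule that[OF sol _ _ fam])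
    show "y 0 l = c0" "z 0 l = c1" for l using yeq[of 0 l] zeq[of 0 l] T_pos by auto
  qed
qed

end

section \<open>Estimates for solutions\<close>

context pencil begin

definition growth_C :: real where "growth_C = 2 * exp (p_max * T + Q T)"

lemma growth_C_ge_1: "growth_C \<ge> 1"
proof -
  have "exp (p_max * T + Q T) \<ge> 1" using p_max_pos T_pos Q_nonneg[of T] by simp
  then show ?thesis unfolding growth_C_def by linarith
qed

text \<open>
  Energy growth with weight \<open>\<bar>\<lambda>\<bar>\<close>. The point is that \<open>\<bar>W + \<bar>\<lambda>\<bar>^2\<bar>\<close> is at most \<open>\<bar>\<lambda>\<bar>\<close> times \<open>2 \<bar>Im \<lambda>\<bar>\<close> plus a function
  independent of \<open>\<lambda>\<close>, because \<open>\<bar>\<bar>\<lambda>\<bar>^2 - \<lambda>^2\<bar> = 2 \<bar>\<lambda>\<bar> \<bar>Im \<lambda>\<bar>\<close>.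
\<close>

theorem growth_bound:
  assumes s: "solves T (W l) y z" and l: "norm l \<ge> 1" and a: "a \<in> {0..T}" and x: "x \<in> {0..T}"
  shows "norm (z x) + norm l * norm (y x) \<le> growth_C * exp (\<bar>Im l\<bar> * \<bar>x - a\<bar>) * (norm (z a) + norm l * norm (y a))"
proof -
  define M where "M = p_max"
  note M = p_max_pos[folded M_def] norm_p_le[folded M_def]
  obtain N where N: "negligible N" "\<And>x A. x \<in> {0<..<T} - N \<Longrightarrow> (majorant A has_real_derivative A + norm (q x)) (at x)"
    by (rule majorant_derivative, rule that)
  have QT: "Q T \<ge> 0" using Q_nonneg T_pos by simp
  define \<tau> where "\<tau> = \<bar>Im l\<bar>"
  define A where "A = 2 * \<tau> + 2 * M"
  have l0: "norm l > 0" using l by linarith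
  have dK: "\<exists>k. (majorant A has_real_derivative k) (at t) \<and> norm (W l t + complex_of_real ((norm l)\<^sup>2)) \<le> norm l * k"
    if t: "t \<in> {0<..<T} - N" for t
  proof (intro exI conjI)
    show "(majorant A has_real_derivative A + norm (q t)) (at t)" by (rule N(2)[OF t])
    have "(complex_of_real (norm l))\<^sup>2 - l\<^sup>2 = l * (cnj l - l)"
    proof -
      have "(complex_of_real (norm l))\<^sup>2 = l * cnj l" using complex_norm_square[of l] by simp
      then show ?thesis by (simp add: algebra_simps power2_eq_square)
    qed
    also have "cnj l - l = - (2 * \<i> * Im l)" using complex_diff_cnj[of l] by (simp add: algebra_simps)
    finally have e: "norm ((complex_of_real (norm l))\<^sup>2 - l\<^sup>2) = norm l * (2 * \<tau>)"
      by (simp add: norm_mult \<tau>_def)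
    have "norm (W l t + (complex_of_real (norm l))\<^sup>2) = norm (2 * l * p t + q t + ((complex_of_real (norm l))\<^sup>2 - l\<^sup>2))"
      by (simp add: W_def algebra_simps)
    also have "\<dots> \<le> norm (2 * l * p t) + norm (q t) + norm l * (2 * \<tau>)"
      unfolding e[symmetric] by (intro norm_triangle_le add_mono norm_triangle_ineq order_refl)
    also have "\<dots> \<le> norm l * (2 * M) + norm l * norm (q t) + norm l * (2 * \<tau>)"
      using M(2)[of t] t l mult_right_mono[OF l, of "norm (q t)"]
      by (intro add_mono order_refl) (auto simp: norm_mult intro!: mult_left_mono)
    also have "\<dots> = norm l * (A + norm (q t))" by (simp add: A_def algebra_simps)
    finally show "norm (W l t + complex_of_real ((norm l)\<^sup>2)) \<le> norm l * (A + norm (q t))"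
      by (simp only: of_real_power)
  qed
  have Kdiff: "majorant A v - majorant A u \<le> 2 * \<tau> * (v - u) + (2 * M * T + Q T)" if "0 \<le> u" "u \<le> v" "v \<le> T" for u v
  proof -
    have "Q v \<le> Q T" "0 \<le> Q u" using Q_mono[of v T] Q_nonneg[of u] that by auto
    moreover have "M * (v - u) \<le> M * T" using that M(1) by (intro mult_left_mono) auto
    ultimately show ?thesis by (simp add: majorant_def A_def algebra_simps)
  qed
  let ?E = "energy (norm l) y z"
  note eg = energy_growth[OF s l0 majorant_abs_cont[of A] N(1) dK]
  have E0: "?E a \<ge> 0" by (simp add: energy_def)
  have Ex: "?E x \<le> ?E a * exp (2 * \<tau> * \<bar>x - a\<bar> + (2 * M * T + Q T))"
  proof (cases "a \<le> x")
    case True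
    then have "?E x \<le> ?E a * exp (majorant A x - majorant A a)" using eg(1)[of a x] a x by auto
    also have "\<dots> \<le> ?E a * exp (2 * \<tau> * \<bar>x - a\<bar> + (2 * M * T + Q T))"
      using Kdiff[of a x] True a x E0 by (intro mult_left_mono) auto
    finally show ?thesis .
  next
    case False
    then have "?E x \<le> ?E a * exp (majorant A a - majorant A x)" using eg(2)[of x a] a x by auto
    also have "\<dots> \<le> ?E a * exp (2 * \<tau> * \<bar>x - a\<bar> + (2 * M * T + Q T))"
      using Kdiff[of x a] False a x E0 by (intro mult_left_mono) (auto simp: abs_if)
    finally show ?thesis .
  qed
  let ?s = "\<lambda>x. norm (z x) + norm l * norm (y x)"
  have s2: "(?s x)\<^sup>2 \<le> 2 * ?E x"
    using sum_squares_bound[of "norm (z x)" "norm l * norm (y x)"]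
    by (simp add: energy_def power2_sum power_mult_distrib)
  have Ea: "?E a \<le> (?s a)\<^sup>2" by (simp add: energy_def power2_sum power_mult_distrib)
  have "(?s x)\<^sup>2 \<le> 2 * ((?s a)\<^sup>2 * exp (2 * \<tau> * \<bar>x - a\<bar> + (2 * M * T + Q T)))"
    using s2 Ex mult_right_mono[OF Ea exp_ge_zero, of "2 * \<tau> * \<bar>x - a\<bar> + (2 * M * T + Q T)"] by linarith
  also have "\<dots> \<le> 4 * ((?s a)\<^sup>2 * exp (2 * (\<tau> * \<bar>x - a\<bar> + (M * T + Q T))))"
  proof -
    have "(?s a)\<^sup>2 * exp (2 * \<tau> * \<bar>x - a\<bar> + (2 * M * T + Q T)) \<le> (?s a)\<^sup>2 * exp (2 * (\<tau> * \<bar>x - a\<bar> + (M * T + Q T)))"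
      using QT by (intro mult_left_mono) auto
    moreover have "0 \<le> (?s a)\<^sup>2 * exp (2 * (\<tau> * \<bar>x - a\<bar> + (M * T + Q T)))" by simp
    ultimately show ?thesis by linarith
  qed
  also have "\<dots> = (growth_C * exp (\<tau> * \<bar>x - a\<bar>) * ?s a)\<^sup>2"
  proof -
    have "4 * (S\<^sup>2 * exp (2 * (u + w))) = (2 * exp w * exp u * S)\<^sup>2" for S u w :: real
      by (simp add: exp_double exp_add power_mult_distrib)
    then show ?thesis unfolding growth_C_def M_def by blast
  qed
  finally show ?thesis unfolding \<tau>_def
    by (rule power2_le_imp_le) (use growth_C_ge_1 in \<open>auto intro!: mult_nonneg_nonneg\<close>)
qed

lemma solution_zero:
  assumes s: "solves T (W l) y z" and a: "a \<in> {0..T}" "y a = 0" "z a = 0" and x: "x \<in> {0..T}"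
  shows "y x = 0 \<and> z x = 0"
proof -
  define M where "M = p_max"
  note M = p_max_pos[folded M_def] norm_p_le[folded M_def]
  obtain N where N: "negligible N" "\<And>x A. x \<in> {0<..<T} - N \<Longrightarrow> (majorant A has_real_derivative A + norm (q x)) (at x)"
    by (rule majorant_derivative, rule that)
  define A where "A = 2 * norm l * M + (norm l)\<^sup>2 + 1"
  have dK: "\<exists>k. (majorant A has_real_derivative k) (at t) \<and> norm (W l t + complex_of_real (1\<^sup>2)) \<le> 1 * k"
    if t: "t \<in> {0<..<T} - N" for t
  proof (intro exI conjI)
    show "(majorant A has_real_derivative A + norm (q t)) (at t)" by (rule N(2)[OF t])
    have "norm (W l t + 1) \<le> norm (2 * l * p t + q t - l\<^sup>2) + norm (1::complex)"
      unfolding W_def by (rule norm_triangle_ineq)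
    also have "\<dots> \<le> norm (2 * l * p t) + norm (q t) + norm (l\<^sup>2) + 1"
      by (intro add_mono order_trans[OF norm_triangle_ineq4] norm_triangle_ineq) auto
    also have "\<dots> \<le> 2 * norm l * M + norm (q t) + (norm l)\<^sup>2 + 1"
      using M(2)[of t] t by (intro add_mono) (auto simp: norm_mult norm_power intro!: mult_left_mono)
    finally show "norm (W l t + complex_of_real (1\<^sup>2)) \<le> 1 * (A + norm (q t))" by (simp add: A_def)
  qed
  note eg = energy_growth[OF s zero_less_one majorant_abs_cont[of A] N(1) dK]
  have "energy 1 y z a = 0" using a by (simp add: energy_def)
  then have "energy 1 y z x \<le> 0"
    using eg(1)[of a x] eg(2)[of x a] a(1) x by (cases "a \<le> x") auto
  then have "(norm (z x))\<^sup>2 + (norm (y x))\<^sup>2 \<le> 0" by (simp add: energy_def)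
  then show ?thesis by (simp add: sum_power2_le_zero_iff)
qed

lemma solution_unique:
  assumes s: "solves T (W l) y z" "solves T (W l) y' z'"
    and a: "a \<in> {0..T}" "y a = y' a" "z a = z' a" and x: "x \<in> {0..T}"
  shows "y x = y' x" "z x = z' x"
  using solution_zero[OF solves_lincomb[OF s, of 1 "-1"] a(1) _ _ x] a by auto

definition P :: "real \<Rightarrow> complex" where "P x = integral {0..x} p"

lemma P_abs_cont: "abs_cont 0 T P"
  unfolding P_def[abs_def]
  by (intro abs_cont_indefinite_integral absolutely_integrable_continuous_real p_cont)

lemma P_derivative: "(P has_vector_derivative p x) (at x)" if "x \<in> {0<..<T}"
proof -
  have "at x within {0..T} = at x" using that by (intro at_within_interior) simp
  then show ?thesis
    using integral_has_vector_derivative[OF p_cont, of x] that unfolding P_def[abs_def] by simp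
qed

text \<open>
  Put \<open>A = z + i \<lambda> y\<close> and \<open>B = z - i \<lambda> y\<close>, so that \<open>A' = i (\<lambda> - p) A + i p B + q y\<close>. Going from \<open>a\<close> to \<open>0\<close> in the upper
  half-plane, \<open>A\<close> grows and \<open>B\<close> decays up to a coupling to \<open>A\<close> of relative size \<open>1 / Im \<lambda>\<close>. Removing the
  exponential factor from \<open>A\<close> leaves a function that is constant up to \<open>O(1 / Im \<lambda>)\<close>, and \<open>2 i \<lambda> y = A - B\<close>.
\<close>

lemma asymptotics_upper:
  assumes a: "0 < a" "a \<le> T"
  obtains C where "C > 0"
    "\<And>l y z. solves T (W l) y z \<Longrightarrow> Im l \<ge> 1 \<Longrightarrow>
      norm (2 * \<i> * l * y 0 * exp (\<i> * l * a - \<i> * P a) - (z a + \<i> * l * y a))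
        \<le> C / Im l * (norm (z a) + norm l * norm (y a))"
proof -
  define M where "M = p_max"
  note M = p_max_pos[folded M_def] norm_p_le[folded M_def]
  define C0 where "C0 = growth_C"
  note C0 = growth_C_ge_1[folded C0_def] growth_bound[folded C0_def]
  obtain NQ where NQ: "negligible NQ" "\<And>x. x \<in> {0<..<T} - NQ \<Longrightarrow> (Q has_real_derivative norm (q x)) (at x)"
    by (rule Q_derivative, rule that)
  have QT: "Q T \<ge> 0" using Q_nonneg T_pos by simp
  define C1 where "C1 = C0 * (M + Q T)"
  define E where "E = exp (M * T)"
  define C2 where "C2 = E * (M / 2 + M * C1 * T + C0 * Q T)"
  define C where "C = C2 + E * (1 / (2 * a) + C1)"
  have C1: "C1 > 0" unfolding C1_def using C0(1) M(1) QT by (intro mult_pos_pos) auto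
  have E0: "E > 0" by (simp add: E_def)
  have C20: "C2 \<ge> 0" unfolding C2_def using C0(1) M(1) QT C1 E0 T_pos by (intro mult_nonneg_nonneg add_nonneg_nonneg) auto
  have Cpos: "C > 0" unfolding C_def using C20 E0 C1 a(1) by (intro add_nonneg_pos mult_pos_pos add_pos_pos) auto
  have Pdiff: "norm (P x - P a) \<le> M * T" if x: "x \<in> {0..a}" for x
  proof -
    have "norm (P a - P x) \<le> M * a - M * x"
    proof (rule abs_cont_norm_increment_le[OF P_abs_cont abs_cont_cmult[OF abs_cont_id] negligible_empty])
      fix t assume "t \<in> {0<..<T} - {}"
      then show "\<exists>f' h. (P has_vector_derivative f') (at t) \<and> ((*) M has_real_derivative h) (at t) \<and> norm f' \<le> h"
        using P_derivative[of t] M(2)[of t]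
        by (intro exI[of _ "p t"] exI[of _ M] conjI) (auto intro!: derivative_eq_intros)
    qed (use x a in auto)
    also have "M * a \<le> M * T" using a M(1) by simp
    also have "M * T - M * x \<le> M * T" using x M(1) by simp
    finally show ?thesis by (simp add: norm_minus_commute)
  qed
  have main: "norm (2 * \<i> * l * y 0 * exp (\<i> * l * a - \<i> * P a) - (z a + \<i> * l * y a))
        \<le> C / Im l * (norm (z a) + norm l * norm (y a))"
    if s: "solves T (W l) y z" and l: "Im l \<ge> 1" for l y z
  proof -
    define \<tau> where "\<tau> = Im l"
    have \<tau>: "\<tau> \<ge> 1" using l by (simp add: \<tau>_def)
    have l\<tau>: "norm l \<ge> \<tau>" unfolding \<tau>_def using abs_Im_le_cmod[of l] by linarith
    have l1: "norm l \<ge> 1" using l\<tau> \<tau> by linarith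
    note D = solvesD[OF s]
    obtain Ns where Ns: "negligible Ns" "\<And>x. x \<in> {0<..<T} - Ns \<Longrightarrow> (z has_vector_derivative W l x * y x) (at x)"
      by (rule solves_ae[OF s], rule that)
    define n where "n = norm (z a) + norm l * norm (y a)"
    have n0: "n \<ge> 0" by (simp add: n_def)
    define A where "A x = z x + \<i> * l * y x" for x
    define B where "B x = z x - \<i> * l * y x" for x
    have yb: "norm l * norm (y x) \<le> C0 * exp (\<tau> * (a - x)) * n" if x: "x \<in> {0..a}" for x
    proof -
      have "norm (z x) + norm l * norm (y x) \<le> C0 * exp (\<tau> * (a - x)) * n"
      proof -
        have "\<bar>x - a\<bar> = a - x" "\<bar>Im l\<bar> = \<tau>" using x l by (auto simp: \<tau>_def)
        then show ?thesis using C0(2)[OF s l1, of a x] a x by (simp add: n_def)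
      qed
      then show ?thesis using norm_ge_zero[of "z x"] by linarith
    qed
    have neg: "negligible (NQ \<union> Ns)" by (intro negligible_Un NQ(1) Ns(1))
    \<comment> \<open>\<open>exp (i \<lambda> t) B\<close> has derivative \<open>exp (i \<lambda> t) (2 \<lambda> p + q) y\<close>; inserting the growth bound for \<open>y\<close> leaves a factor \<open>exp (- 2 \<tau> t)\<close> whose integral supplies the gain \<open>1/\<tau>\<close>.\<close>
    have Bb: "norm (B x) \<le> n * (exp (- (\<tau> * (a - x))) + C1 / \<tau> * exp (\<tau> * (a - x)))" if x: "x \<in> {0..a}" for x
    proof -
      define g where "g t = exp (\<i> * l * t) * B t" for t :: real
      define D where "D = C0 * n * exp (\<tau> * a)"
      have D0: "D \<ge> 0" using C0(1) n0 by (simp add: D_def)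
      define H where "H t = D * (- (M / \<tau>) * exp (- 2 * \<tau> * t) + exp (- 2 * \<tau> * x) / \<tau> * Q t)" for t :: real
      have ng: "norm (g t) = exp (- (\<tau> * t)) * norm (B t)" for t
        by (simp add: g_def norm_mult norm_exp_eq_Re \<tau>_def)
      have acid: "abs_cont 0 T (\<lambda>t. \<i> * l * complex_of_real t)"
        by (intro abs_cont_of_lipschitz[where M="norm l"]) (simp flip: right_diff_distrib of_real_diff add: norm_mult)
      have inc: "norm (g a - g x) \<le> H a - H x"
      proof (rule abs_cont_norm_increment_le[where a=x and b=a and N="NQ \<union> Ns"])
        have "abs_cont 0 T g" unfolding g_def[abs_def] B_def[abs_def]
          by (intro abs_cont_mult abs_cont_exp acid abs_cont_diff abs_cont_const solvesD[OF s])
        then show "abs_cont x a g" using x a by (auto intro: abs_cont_subinterval)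
        have "abs_cont 0 T H" unfolding H_def[abs_def]
          by (intro abs_cont_add abs_cont_exp abs_cont_cmult abs_cont_id Q_abs_cont)
        then show "abs_cont x a H" using x a by (auto intro: abs_cont_subinterval)
        fix t assume t: "t \<in> {x<..<a} - (NQ \<union> Ns)"
        then have tT: "t \<in> {0<..<T}" "t \<in> {0..a}" using x a by auto
        have dy: "(y has_vector_derivative z t) (at t)" "(z has_vector_derivative W l t * y t) (at t)"
          and dQ: "(Q has_real_derivative norm (q t)) (at t)"
          using D(4) Ns(2) NQ(2) t tT by auto
        have dexp: "((\<lambda>t. exp (\<i> * l * complex_of_real t)) has_vector_derivative \<i> * l * exp (\<i> * l * t)) (at t)"
        proof -
          have "((\<lambda>w. exp (\<i> * l * w)) has_field_derivative \<i> * l * exp (\<i> * l * t)) (at (complex_of_real t))"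
            by (auto intro!: derivative_eq_intros)
          then show ?thesis by (rule has_vector_derivative_real_field)
        qed
        have dB: "(B has_vector_derivative W l t * y t - \<i> * l * z t) (at t)"
          unfolding B_def[abs_def] by (intro has_vector_derivative_diff has_vector_derivative_mult_right dy)
        have "(g has_vector_derivative exp (\<i> * l * t) * (W l t * y t - \<i> * l * z t) + \<i> * l * exp (\<i> * l * t) * B t) (at t)"
          unfolding g_def[abs_def] by (rule has_vector_derivative_mult[OF dexp dB])
        moreover have "exp (\<i> * l * t) * (W l t * y t - \<i> * l * z t) + \<i> * l * exp (\<i> * l * t) * B t
            = exp (\<i> * l * t) * ((2 * l * p t + q t) * y t)"
          by (simp add: B_def W_def algebra_simps power2_eq_square)
        ultimately have dg: "(g has_vector_derivative exp (\<i> * l * t) * ((2 * l * p t + q t) * y t)) (at t)" by simp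
        have dH: "(H has_real_derivative D * (2 * M * exp (- 2 * \<tau> * t) + exp (- 2 * \<tau> * x) / \<tau> * norm (q t))) (at t)"
          unfolding H_def[abs_def] using dQ \<tau> by (auto intro!: derivative_eq_intros simp: field_simps)
        have "norm (exp (\<i> * l * t) * ((2 * l * p t + q t) * y t)) = exp (- (\<tau> * t)) * (norm (2 * l * p t + q t) * norm (y t))"
          by (simp add: norm_mult norm_exp_eq_Re \<tau>_def)
        also have "\<dots> \<le> exp (- (\<tau> * t)) * ((2 * M + norm (q t) / \<tau>) * (C0 * exp (\<tau> * (a - t)) * n))"
        proof -
          have "norm (2 * l * p t + q t) \<le> norm l * (2 * M) + norm (q t)"
            using M(2)[of t] tT a by (intro order_trans[OF norm_triangle_ineq] add_mono) (auto simp: norm_mult intro!: mult_left_mono)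
          also have "norm (q t) \<le> norm l * (norm (q t) / \<tau>)"
            using \<tau> l\<tau> mult_right_mono[OF l\<tau>, of "norm (q t)"] by (simp add: field_simps)
          finally have "norm (2 * l * p t + q t) \<le> norm l * (2 * M + norm (q t) / \<tau>)" by (simp add: distrib_left)
          then have "norm (2 * l * p t + q t) * norm (y t) \<le> (norm l * (2 * M + norm (q t) / \<tau>)) * norm (y t)"
            by (rule mult_right_mono) simp
          also have "\<dots> = (2 * M + norm (q t) / \<tau>) * (norm l * norm (y t))" by (simp add: algebra_simps)
          also have "\<dots> \<le> (2 * M + norm (q t) / \<tau>) * (C0 * exp (\<tau> * (a - t)) * n)"
            using yb[OF tT(2)] M(1) \<tau> by (intro mult_left_mono) auto
          finally show ?thesis by (rule mult_left_mono) simp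
        qed
        also have "\<dots> = D * (2 * M + norm (q t) / \<tau>) * exp (- 2 * \<tau> * t)"
        proof -
          have "exp (- (\<tau> * t)) * exp (\<tau> * (a - t)) = exp (\<tau> * a) * exp (- 2 * \<tau> * t)"
            by (simp add: algebra_simps flip: exp_add)
          then show ?thesis unfolding D_def by (simp add: algebra_simps)
        qed
        also have "\<dots> \<le> D * (2 * M * exp (- 2 * \<tau> * t) + exp (- 2 * \<tau> * x) / \<tau> * norm (q t))"
        proof -
          have "exp (- 2 * \<tau> * t) \<le> exp (- 2 * \<tau> * x)" using t \<tau> by auto
          then have "norm (q t) / \<tau> * exp (- 2 * \<tau> * t) \<le> norm (q t) / \<tau> * exp (- 2 * \<tau> * x)"
            using \<tau> by (intro mult_left_mono) auto
          then have "D * (2 * M * exp (- 2 * \<tau> * t) + norm (q t) / \<tau> * exp (- 2 * \<tau> * t))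
              \<le> D * (2 * M * exp (- 2 * \<tau> * t) + norm (q t) / \<tau> * exp (- 2 * \<tau> * x))"
            using D0 by (intro mult_left_mono) auto
          then show ?thesis by (simp add: algebra_simps)
        qed
        finally show "\<exists>f' h. (g has_vector_derivative f') (at t) \<and> (H has_real_derivative h) (at t) \<and> norm f' \<le> h"
          using dg dH by blast
      qed (use x neg in auto)
      have "H a - H x \<le> D * (exp (- 2 * \<tau> * x) * (M + Q T) / \<tau>)"
      proof -
        have q: "exp (- 2 * \<tau> * x) / \<tau> * (Q a - Q x) \<le> exp (- 2 * \<tau> * x) / \<tau> * Q T"
          using Q_mono[of a T] Q_nonneg[of x] x a \<tau> by (intro mult_left_mono) auto
        have e: "- (M / \<tau>) * exp (- 2 * \<tau> * a) \<le> 0" using M(1) \<tau> by (simp add: divide_nonneg_nonneg)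
        have "H a - H x = D * (- (M / \<tau>) * exp (- 2 * \<tau> * a) + M / \<tau> * exp (- 2 * \<tau> * x) + exp (- 2 * \<tau> * x) / \<tau> * (Q a - Q x))"
          unfolding H_def by (simp add: algebra_simps diff_divide_distrib)
        also have "\<dots> \<le> D * (0 + M / \<tau> * exp (- 2 * \<tau> * x) + exp (- 2 * \<tau> * x) / \<tau> * Q T)"
          by (rule mult_left_mono[OF _ D0]) (use q e in linarith)
        also have "\<dots> = D * (exp (- 2 * \<tau> * x) * (M + Q T) / \<tau>)" using \<tau> by (simp add: field_simps)
        finally show ?thesis .
      qed
      then have "norm (g x) \<le> norm (g a) + D * (exp (- 2 * \<tau> * x) * (M + Q T) / \<tau>)"
        using inc norm_triangle_sub[of "g x" "g a"] by (simp add: norm_minus_commute)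
      also have "norm (g a) \<le> exp (- (\<tau> * a)) * n"
      proof -
        have "norm (B a) \<le> n" unfolding B_def n_def
          by (rule order_trans[OF norm_triangle_ineq4]) (simp add: norm_mult)
        then show ?thesis unfolding ng by (intro mult_left_mono) auto
      qed
      finally have gx: "exp (- (\<tau> * x)) * norm (B x) \<le> exp (- (\<tau> * a)) * n + D * (exp (- 2 * \<tau> * x) * (M + Q T) / \<tau>)"
        unfolding ng by simp
      have "norm (B x) = exp (\<tau> * x) * (exp (- (\<tau> * x)) * norm (B x))"
        by (simp add: mult.assoc[symmetric] flip: exp_add)
      also have "\<dots> \<le> exp (\<tau> * x) * (exp (- (\<tau> * a)) * n + D * (exp (- 2 * \<tau> * x) * (M + Q T) / \<tau>))"
        by (rule mult_left_mono[OF gx]) simp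
      also have "\<dots> = n * (exp (\<tau> * x) * exp (- (\<tau> * a)) + C1 / \<tau> * (exp (\<tau> * x) * exp (\<tau> * a) * exp (- 2 * \<tau> * x)))"
        unfolding D_def C1_def by (simp add: algebra_simps)
      also have "exp (\<tau> * x) * exp (- (\<tau> * a)) = exp (- (\<tau> * (a - x)))" by (simp add: algebra_simps flip: exp_add)
      also have "exp (\<tau> * x) * exp (\<tau> * a) * exp (- 2 * \<tau> * x) = exp (\<tau> * (a - x))" by (simp add: algebra_simps flip: exp_add)
      finally show ?thesis .
    qed
    \<comment> \<open>The phase is normalised to vanish at \<open>a\<close>; it contains \<open>P\<close> because \<open>A\<close> is transported with coefficient \<open>i (\<lambda> - p)\<close>.\<close>
    define \<theta> where "\<theta> x = \<i> * l * a - \<i> * P a + (\<i> * P x - \<i> * l * x)" for x :: real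
    define f where "f x = exp (\<theta> x) * A x" for x
    have n\<theta>: "norm (exp (\<theta> x)) \<le> E * exp (- (\<tau> * (a - x)))" if x: "x \<in> {0..a}" for x
    proof -
      have "Re (\<theta> x) = Re (\<i> * (P x - P a)) - \<tau> * (a - x)"
        by (simp add: \<theta>_def \<tau>_def algebra_simps)
      also have "Re (\<i> * (P x - P a)) \<le> norm (P x - P a)"
        using complex_Re_le_cmod[of "\<i> * (P x - P a)"] by (simp add: norm_mult)
      also have "norm (P x - P a) \<le> M * T" by (rule Pdiff[OF x])
      finally show ?thesis by (simp add: norm_exp_eq_Re E_def flip: exp_add)
    qed
    define H where "H x = E * n * (M * exp (- 2 * \<tau> * (a - x)) / (2 * \<tau>) + M * C1 / \<tau> * x + C0 / \<tau> * Q x)" for x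
    have inc: "norm (f a - f 0) \<le> H a - H 0"
    proof (rule abs_cont_norm_increment_le[where a=0 and b=a and N="NQ \<union> Ns"])
      have ac\<theta>: "abs_cont 0 T \<theta>" unfolding \<theta>_def[abs_def]
      proof (intro abs_cont_add abs_cont_const abs_cont_diff abs_cont_cmult P_abs_cont)
        show "abs_cont 0 T (\<lambda>x. complex_of_real x)"
          by (rule abs_cont_of_lipschitz[where M=1]) (simp flip: of_real_diff)
      qed
      have "abs_cont 0 T f" unfolding f_def[abs_def] A_def[abs_def]
        by (intro abs_cont_mult abs_cont_exp abs_cont_add abs_cont_const D ac\<theta>)
      then show "abs_cont 0 a f" using a by (auto intro: abs_cont_subinterval)
      have "abs_cont 0 T H" unfolding H_def[abs_def] divide_inverse
        by (intro abs_cont_add abs_cont_mult abs_cont_exp abs_cont_diff abs_cont_const abs_cont_id Q_abs_cont)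
      then show "abs_cont 0 a H" using a by (auto intro: abs_cont_subinterval)
      fix t assume t: "t \<in> {0<..<a} - (NQ \<union> Ns)"
      then have tT: "t \<in> {0<..<T}" "t \<in> {0..a}" using a by auto
      have dy: "(y has_vector_derivative z t) (at t)" "(z has_vector_derivative W l t * y t) (at t)"
        and dQ: "(Q has_real_derivative norm (q t)) (at t)"
        using D(4) Ns(2) NQ(2) t tT by auto
      have d\<theta>: "(\<theta> has_vector_derivative \<i> * p t - \<i> * l) (at t)"
        unfolding \<theta>_def[abs_def] using P_derivative[OF tT(1)]
        by (auto intro!: derivative_eq_intros)
      have dexp: "((\<lambda>x. exp (\<theta> x)) has_vector_derivative (\<i> * p t - \<i> * l) * exp (\<theta> t)) (at t)"
        using field_vector_diff_chain_at[OF d\<theta> DERIV_exp] by (simp add: o_def)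
      have dA: "(A has_vector_derivative W l t * y t + \<i> * l * z t) (at t)"
        unfolding A_def[abs_def] by (intro has_vector_derivative_add has_vector_derivative_mult_right dy)
      have "(f has_vector_derivative exp (\<theta> t) * (W l t * y t + \<i> * l * z t) + (\<i> * p t - \<i> * l) * exp (\<theta> t) * A t) (at t)"
        unfolding f_def[abs_def] by (rule has_vector_derivative_mult[OF dexp dA])
      moreover have "exp (\<theta> t) * (W l t * y t + \<i> * l * z t) + (\<i> * p t - \<i> * l) * exp (\<theta> t) * A t
          = exp (\<theta> t) * (\<i> * p t * B t + q t * y t)"
        by (simp add: A_def B_def W_def algebra_simps power2_eq_square)
      ultimately have df: "(f has_vector_derivative exp (\<theta> t) * (\<i> * p t * B t + q t * y t)) (at t)" by simp
      define h where "h = E * n * (M * exp (- 2 * \<tau> * (a - t)) + M * C1 / \<tau> + C0 / \<tau> * norm (q t))"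
      have dH: "(H has_real_derivative h) (at t)"
        unfolding H_def[abs_def] h_def using dQ \<tau> by (auto intro!: derivative_eq_intros simp: field_simps)
      have "norm (exp (\<theta> t) * (\<i> * p t * B t + q t * y t)) \<le> (E * exp (- (\<tau> * (a - t)))) *
          (M * (n * (exp (- (\<tau> * (a - t))) + C1 / \<tau> * exp (\<tau> * (a - t)))) + norm (q t) / \<tau> * (C0 * exp (\<tau> * (a - t)) * n))"
      proof -
        have "norm (\<i> * p t * B t + q t * y t) \<le> norm (p t) * norm (B t) + norm (q t) * norm (y t)"
          by (rule order_trans[OF norm_triangle_ineq]) (simp add: norm_mult)
        also have "norm (p t) * norm (B t) \<le> M * (n * (exp (- (\<tau> * (a - t))) + C1 / \<tau> * exp (\<tau> * (a - t))))"
          using M(1) M(2)[of t] tT Bb[OF tT(2)] by (intro mult_mono) auto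
        also have "norm (q t) * norm (y t) \<le> norm (q t) / \<tau> * (norm l * norm (y t))"
        proof -
          have "\<tau> * norm (y t) \<le> norm l * norm (y t)" using l\<tau> by (rule mult_right_mono) simp
          then have "norm (q t) / \<tau> * (\<tau> * norm (y t)) \<le> norm (q t) / \<tau> * (norm l * norm (y t))"
            using \<tau> by (intro mult_left_mono) auto
          then show ?thesis using \<tau> by simp
        qed
        also have "\<dots> \<le> norm (q t) / \<tau> * (C0 * exp (\<tau> * (a - t)) * n)"
          using yb[OF tT(2)] \<tau> by (intro mult_left_mono) auto
        finally have "norm (\<i> * p t * B t + q t * y t) \<le>
            M * (n * (exp (- (\<tau> * (a - t))) + C1 / \<tau> * exp (\<tau> * (a - t)))) + norm (q t) / \<tau> * (C0 * exp (\<tau> * (a - t)) * n)"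
          by (simp only: add_mono add_left_mono order_refl)
        then show ?thesis unfolding norm_mult using n\<theta>[OF tT(2)] E0 by (intro mult_mono) auto
      qed
      also have "\<dots> = h"
      proof -
        have e1: "exp (- (\<tau> * (a - t))) * exp (- (\<tau> * (a - t))) = exp (- 2 * \<tau> * (a - t))"
          by (simp add: algebra_simps flip: exp_add)
        have e2: "exp (- (\<tau> * (a - t))) * exp (\<tau> * (a - t)) = 1" by (simp flip: exp_add)
        have "(E * u) * (M * (n * (u + C1 / \<tau> * v)) + norm (q t) / \<tau> * (C0 * v * n))
            = E * n * (M * (u * u) + M * C1 / \<tau> * (u * v) + C0 / \<tau> * norm (q t) * (u * v))" for u v
          by (simp add: algebra_simps)
        then show ?thesis unfolding h_def by (simp only: e1 e2 mult_1_right)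
      qed
      finally show "\<exists>f' h. (f has_vector_derivative f') (at t) \<and> (H has_real_derivative h) (at t) \<and> norm f' \<le> h"
        using df dH by blast
    qed (use a neg in auto)
    have "H a - H 0 \<le> C2 * n / \<tau>"
    proof -
      have "H a - H 0 \<le> E * n * (M / (2 * \<tau>) + M * C1 / \<tau> * T + C0 / \<tau> * Q T)"
      proof -
        have "H a - H 0 = E * n * (M / (2 * \<tau>) - M * exp (- 2 * \<tau> * a) / (2 * \<tau>) + M * C1 / \<tau> * a + C0 / \<tau> * Q a)"
          unfolding H_def Q_0 by (simp add: algebra_simps)
        also have "\<dots> \<le> E * n * (M / (2 * \<tau>) - 0 + M * C1 / \<tau> * T + C0 / \<tau> * Q T)"
          using E0 n0 M(1) \<tau> C1 C0(1) a Q_mono[of a T]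
          by (intro mult_left_mono add_mono diff_mono) auto
        finally show ?thesis by simp
      qed
      also have "\<dots> = C2 * n / \<tau>" unfolding C2_def using \<tau> by (simp add: field_simps)
      finally show ?thesis .
    qed
    then have f_le: "norm (f a - f 0) \<le> C2 * n / \<tau>" using inc by simp
    have \<theta>0: "exp (\<theta> 0) = exp (\<i> * l * a - \<i> * P a)" by (simp add: \<theta>_def P_def)
    have fa: "f a = z a + \<i> * l * y a" by (simp add: f_def \<theta>_def A_def)
    have f0: "2 * \<i> * l * y 0 * exp (\<i> * l * a - \<i> * P a) = f 0 - exp (\<theta> 0) * B 0"
      unfolding \<theta>0[symmetric] by (simp add: f_def A_def B_def algebra_simps)
    have B0: "norm (exp (\<theta> 0) * B 0) \<le> E * (1 / (2 * a) + C1) * n / \<tau>"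
    proof -
      have "norm (exp (\<theta> 0) * B 0) \<le> (E * exp (- (\<tau> * a))) * (n * (exp (- (\<tau> * a)) + C1 / \<tau> * exp (\<tau> * a)))"
        unfolding norm_mult using n\<theta>[of 0] Bb[of 0] a E0 by (intro mult_mono) auto
      also have "\<dots> = E * n * (exp (- (\<tau> * a)) * exp (- (\<tau> * a)) + C1 / \<tau> * (exp (- (\<tau> * a)) * exp (\<tau> * a)))"
        by (simp add: algebra_simps)
      also have "exp (- (\<tau> * a)) * exp (\<tau> * a) = 1" by (simp flip: exp_add)
      also have "exp (- (\<tau> * a)) * exp (- (\<tau> * a)) = inverse (exp (2 * \<tau> * a))"
        by (simp flip: exp_add exp_minus)
      also have "inverse (exp (2 * \<tau> * a)) \<le> inverse (2 * \<tau> * a)"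
      proof (rule le_imp_inverse_le)
        show "2 * \<tau> * a \<le> exp (2 * \<tau> * a)" using exp_ge_add_one_self[of "2 * \<tau> * a"] by linarith
        show "0 < 2 * \<tau> * a" using \<tau> a by simp
      qed
      finally have "norm (exp (\<theta> 0) * B 0) \<le> E * n * (inverse (2 * \<tau> * a) + C1 / \<tau> * 1)"
        using E0 n0 by (simp add: mult_left_mono)
      also have "\<dots> = E * (1 / (2 * a) + C1) * n / \<tau>" using \<tau> a by (simp add: field_simps)
      finally show ?thesis .
    qed
    have "norm (2 * \<i> * l * y 0 * exp (\<i> * l * a - \<i> * P a) - (z a + \<i> * l * y a))
        = norm ((f 0 - f a) - exp (\<theta> 0) * B 0)" unfolding f0 fa by (simp add: algebra_simps)
    also have "\<dots> \<le> C2 * n / \<tau> + E * (1 / (2 * a) + C1) * n / \<tau>"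
      using norm_triangle_ineq4[of "f 0 - f a" "exp (\<theta> 0) * B 0"] f_le B0 by (simp add: norm_minus_commute)
    also have "\<dots> = C / \<tau> * n" unfolding C_def using \<tau> by (simp add: field_simps)
    finally show ?thesis unfolding \<tau>_def n_def .
  qed
  show ?thesis by (rule that[of C], rule Cpos, rule main)
qed

text \<open>
  The equation is unchanged under \<open>(\<lambda>, p) \<mapsto> (- \<lambda>, - p)\<close>, which exchanges the half-planes.
\<close>

lemma pencil_reflect: "pencil T (\<lambda>x. - p x) q"
  by unfold_locales (auto intro!: T_pos q_int continuous_intros p_cont)

text \<open>
  The reciprocal of the leading growth factor from \<open>a\<close> to \<open>0\<close>: the sign selects the solution that grows towards \<open>0\<close>
  in the half-plane of \<open>\<lambda>\<close>.
\<close>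

definition wave :: "real \<Rightarrow> complex \<Rightarrow> complex" where
  "wave a l = exp (complex_of_real (sgn (Im l)) * (\<i> * l * a - \<i> * P a))"

lemma norm_wave_le: "norm (wave a l) \<le> exp (norm (P a)) * exp (- (\<bar>Im l\<bar> * a))"
proof -
  have "Re (complex_of_real (sgn (Im l)) * (\<i> * l * a - \<i> * P a)) = - (\<bar>Im l\<bar> * a) + sgn (Im l) * Im (P a)"
    by (simp add: sgn_if abs_if algebra_simps)
  also have "\<dots> \<le> - (\<bar>Im l\<bar> * a) + norm (P a)"
    using abs_Im_le_cmod[of "P a"] by (auto simp: sgn_if)
  finally show ?thesis unfolding wave_def norm_exp_eq_Re by (simp flip: exp_add)
qed

theorem asymptotics:
  assumes a: "0 < a" "a \<le> T"
  obtains C where "C > 0"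
    "\<And>l y z. solves T (W l) y z \<Longrightarrow> \<bar>Im l\<bar> \<ge> 1 \<Longrightarrow>
      norm (2 * sgn (Im l) * \<i> * l * y 0 * wave a l - (z a + sgn (Im l) * \<i> * l * y a))
        \<le> C / \<bar>Im l\<bar> * (norm (z a) + norm l * norm (y a))"
proof -
  interpret r: pencil T "\<lambda>x. - p x" q by (rule pencil_reflect)
  have rW: "r.W (- l) = W l" for l by (simp add: fun_eq_iff r.W_def W_def)
  have rP: "r.P x = - P x" for x by (simp add: r.P_def P_def)
  obtain C1 where C1: "C1 > 0"
    "\<And>l y z. solves T (W l) y z \<Longrightarrow> Im l \<ge> 1 \<Longrightarrow>
      norm (2 * \<i> * l * y 0 * exp (\<i> * l * a - \<i> * P a) - (z a + \<i> * l * y a))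
        \<le> C1 / Im l * (norm (z a) + norm l * norm (y a))"
    by (rule asymptotics_upper[OF a], rule that)
  obtain C2 where C2: "C2 > 0"
    "\<And>l y z. solves T (r.W l) y z \<Longrightarrow> Im l \<ge> 1 \<Longrightarrow>
      norm (2 * \<i> * l * y 0 * exp (\<i> * l * a - \<i> * r.P a) - (z a + \<i> * l * y a))
        \<le> C2 / Im l * (norm (z a) + norm l * norm (y a))"
    by (rule r.asymptotics_upper[OF a], rule that)
  show ?thesis
  proof (rule that)
    show "C1 + C2 > 0" using C1 C2 by simp
    fix l y z assume s: "solves T (W l) y z" "\<bar>Im l\<bar> \<ge> 1"
    let ?n = "norm (z a) + norm l * norm (y a)"
    let ?d = "norm (2 * sgn (Im l) * \<i> * l * y 0 * wave a l - (z a + sgn (Im l) * \<i> * l * y a))"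
    have "?d \<le> C1 / \<bar>Im l\<bar> * ?n \<or> ?d \<le> C2 / \<bar>Im l\<bar> * ?n"
    proof (cases "Im l > 0")
      case True
      then show ?thesis using C1(2)[OF s(1)] s(2) by (simp add: wave_def)
    next
      case False
      then have "Im l < 0" using s(2) by auto
      then show ?thesis using C2(2)[of "- l" y z] s by (simp add: wave_def rW rP algebra_simps)
    qed
    moreover have "C1 / \<bar>Im l\<bar> * ?n \<le> (C1 + C2) / \<bar>Im l\<bar> * ?n" "C2 / \<bar>Im l\<bar> * ?n \<le> (C1 + C2) / \<bar>Im l\<bar> * ?n"
      using C1(1) C2(1) by (auto intro!: mult_right_mono divide_right_mono)
    ultimately show "?d \<le> (C1 + C2) / \<bar>Im l\<bar> * ?n" by linarith
  qed
qed

end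

section \<open>Riemann-Stieltjes integrals of continuous functions\<close>

text \<open>
  The witness is the variation over \<open>[a, x]\<close>. Domination of increments is the convenient form of bounded
  variation here, since it passes to subintervals at once.
\<close>

lemma bounded_variation_majorant:
  assumes bv: "bounded_variation_on_ivl a b f"
  obtains v :: "real \<Rightarrow> real" where "\<And>u w. a \<le> u \<Longrightarrow> u \<le> w \<Longrightarrow> w \<le> b \<Longrightarrow> norm (f w - f u) \<le> v w - v u"
proof -
  define var where "var D = (\<Sum>K\<in>D. norm (f (Sup K) - f (Inf K)))" for D
  obtain B where B: "\<And>D. D division_of {a..b} \<Longrightarrow> var D \<le> B"
    using bv unfolding bounded_variation_on_ivl_def var_def by blast
  define S where "S x = {var D | D. D division_of {a..x}}" for x
  have ext: "\<exists>D'. D' division_of {a..w} \<and> var D + norm (f w - f u) \<le> var D'"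
    if D: "D division_of {a..u}" and uw: "a \<le> u" "u \<le> w" for D u w
  proof (cases "u = w")
    case True
    then show ?thesis using D by auto
  next
    case False
    have "{{u..w}} division_of {u..w}" using uw division_of_self[of u w] by simp
    moreover have "interior {a..u} \<inter> interior {u..w} = {}" by auto
    ultimately have "(D \<union> {{u..w}}) division_of ({a..u} \<union> {u..w})" by (rule division_disjoint_union[OF D])
    moreover have "{a..u} \<union> {u..w} = {a..w}" using uw by auto
    moreover have "{u..w} \<notin> D"
    proof
      assume "{u..w} \<in> D"
      then have "{u..w} \<subseteq> {a..u}" using division_ofD(2)[OF D] by blast
      then show False using False uw by auto
    qed
    then have "var (D \<union> {{u..w}}) = var D + norm (f w - f u)"
      using division_ofD(1)[OF D] uw by (simp add: var_def)
    ultimately show ?thesis by (intro exI[of _ "D \<union> {{u..w}}"]) auto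
  qed
  have bdd: "bdd_above (S w)" if "a \<le> w" "w \<le> b" for w
  proof (rule bdd_aboveI)
    fix r assume "r \<in> S w"
    then obtain D where D: "D division_of {a..w}" "r = var D" by (auto simp: S_def)
    from ext[OF D(1) that] obtain D' where "D' division_of {a..b}" "var D + norm (f b - f w) \<le> var D'" by blast
    then show "r \<le> B" using B[of D'] D(2) norm_ge_zero[of "f b - f w"] by linarith
  qed
  show ?thesis
  proof (rule that[of "\<lambda>x. Sup (S x)"])
    fix u w assume uw: "a \<le> u" "u \<le> w" "w \<le> b"
    have "Sup (S u) \<le> Sup (S w) - norm (f w - f u)"
    proof (rule cSup_least)
      have "{{a..u}} division_of {a..u}" using uw division_of_self[of a u] by simp
      then show "S u \<noteq> {}" by (auto simp: S_def)
      fix r assume "r \<in> S u"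
      then obtain D where D: "D division_of {a..u}" "r = var D" by (auto simp: S_def)
      from ext[OF D(1) uw(1,2)] obtain D' where D': "D' division_of {a..w}" "var D + norm (f w - f u) \<le> var D'" by blast
      have "var D' \<le> Sup (S w)" using D'(1) bdd[of w] uw by (intro cSup_upper) (auto simp: S_def)
      then show "r \<le> Sup (S w) - norm (f w - f u)" using D(2) D'(2) by simp
    qed
    then show "norm (f w - f u) \<le> Sup (S w) - Sup (S u)" by simp
  qed
qed

lemma tagged_division_real_interval:
  fixes D :: "(real \<times> real set) set"
  assumes D: "D tagged_division_of {a..b}" and K: "(x,K) \<in> D"
  shows "K = {Inf K..Sup K}" "a \<le> Inf K" "Inf K \<le> x" "x \<le> Sup K" "Sup K \<le> b"
proof -
  obtain u v where uv: "K = {u..v}" using tagged_division_ofD(4)[OF D K] by auto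
  have x: "x \<in> {u..v}" "{u..v} \<subseteq> {a..b}" using tagged_division_ofD(2,3)[OF D K] uv by auto
  then have "Inf K = u" "Sup K = v" using uv by auto
  then show "K = {Inf K..Sup K}" "a \<le> Inf K" "Inf K \<le> x" "x \<le> Sup K" "Sup K \<le> b" using uv x by auto
qed

text \<open>
  For \<open>c \<le> d\<close> the increment of \<open>f \<circ> clamp1 c d\<close> over an interval \<open>L\<close> is the increment of \<open>f\<close> over \<open>L \<inter> [c, d]\<close>, and \<open>0\<close>
  if these are disjoint. Common refinements of partitions become telescoping sums, without a case distinction
  for empty or degenerate intersections.
\<close>

definition clamp1 :: "real \<Rightarrow> real \<Rightarrow> real \<Rightarrow> real" where
  "clamp1 c d x = max c (min d x)"

lemma clamp1_increment_swap:
  fixes f :: "real \<Rightarrow> 'a::ab_group_add"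
  assumes "c \<le> d" "u \<le> v"
  shows "f (clamp1 c d v) - f (clamp1 c d u) = f (clamp1 u v d) - f (clamp1 u v c)"
  using assms by (auto simp: clamp1_def max_def min_def)

lemma sum_clamp1_increments:
  fixes f :: "real \<Rightarrow> 'a::real_normed_vector"
  assumes D: "D tagged_division_of {a..b}" and cd: "a \<le> c" "c \<le> d" "d \<le> b"
  shows "(\<Sum>(x,L)\<in>D. f (clamp1 c d (Sup L)) - f (clamp1 c d (Inf L))) = f d - f c"
proof -
  have "(\<Sum>(x,L)\<in>D. f (clamp1 c d (Sup L)) - f (clamp1 c d (Inf L))) = f (clamp1 c d b) - f (clamp1 c d a)"
    by (rule additive_tagged_division_1[OF _ D, of "\<lambda>x. f (clamp1 c d x)"]) (use cd in simp)
  then show ?thesis using cd by (simp add: clamp1_def)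
qed

definition fine_partition :: "real \<Rightarrow> real \<Rightarrow> real \<Rightarrow> (real \<times> real set) set \<Rightarrow> bool" where
  "fine_partition a b d D \<longleftrightarrow> D tagged_division_of {a..b} \<and> (\<forall>(x,K)\<in>D. Sup K - Inf K < d)"

lemma fine_partition_mono: "fine_partition a b d D \<Longrightarrow> d \<le> e \<Longrightarrow> fine_partition a b e D"
  unfolding fine_partition_def by fastforce

lemma fine_partition_exists:
  fixes a b d :: real
  assumes "d > 0"
  obtains D where "fine_partition a b d D"
proof -
  have "gauge (\<lambda>x. ball x (d/2))" using assms by (intro gauge_ball) simp
  then obtain D where D: "D tagged_division_of {a..b}" "(\<lambda>x. ball x (d/2)) fine D"
    using fine_division_exists_real by blast
  have "Sup K - Inf K < d" if xK: "(x,K) \<in> D" for x K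
  proof -
    note K = tagged_division_real_interval[OF D(1) xK]
    have sub: "K \<subseteq> ball x (d/2)" using D(2) xK by (rule fineD)
    have "Inf K \<in> {Inf K..Sup K}" "Sup K \<in> {Inf K..Sup K}" using K(3,4) by auto
    then have "Inf K \<in> ball x (d/2)" "Sup K \<in> ball x (d/2)" using sub K(1) by blast+
    then have "\<bar>x - Inf K\<bar> < d/2" "\<bar>x - Sup K\<bar> < d/2" by (simp_all only: mem_ball dist_real_def)
    then show ?thesis by linarith
  qed
  then show ?thesis using D(1) by (intro that) (auto simp: fine_partition_def)
qed

locale stieltjes =
  fixes a b :: real and s :: "real \<Rightarrow> complex" and v :: "real \<Rightarrow> real"
  assumes ab: "a \<le> b"
    and dom: "\<And>u w. a \<le> u \<Longrightarrow> u \<le> w \<Longrightarrow> w \<le> b \<Longrightarrow> norm (s w - s u) \<le> v w - v u"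
begin

definition riemann_sum :: "(real \<times> real set) set \<Rightarrow> (real \<Rightarrow> complex) \<Rightarrow> complex" where
  "riemann_sum D y = (\<Sum>(x,K)\<in>D. y x * (s (Sup K) - s (Inf K)))"

abbreviation total :: real where "total \<equiv> v b - v a"

lemma v_mono: "a \<le> u \<Longrightarrow> u \<le> w \<Longrightarrow> w \<le> b \<Longrightarrow> v u \<le> v w"
  using dom[of u w] norm_ge_zero[of "s w - s u"] by linarith

text \<open>
  Both sums are double sums over pairs of intervals \<open>K\<close>, \<open>L\<close> of increments of \<open>s\<close> over \<open>K \<inter> L\<close>. Such an increment
  vanishes unless the intervals meet, and then their tags are close.
\<close>

lemma riemann_sum_compare:
  assumes DE: "fine_partition a b d D" "fine_partition a b d E"
    and osc: "\<And>x x'. x \<in> {a..b} \<Longrightarrow> x' \<in> {a..b} \<Longrightarrow> \<bar>x - x'\<bar> < 2 * d \<Longrightarrow> norm (y x - y x') \<le> e"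
    and e: "e \<ge> 0"
  shows "norm (riemann_sum D y - riemann_sum E y) \<le> e * total"
proof -
  have D: "D tagged_division_of {a..b}" "\<forall>(x,K)\<in>D. Sup K - Inf K < d"
    and E: "E tagged_division_of {a..b}" "\<forall>(x,K)\<in>E. Sup K - Inf K < d"
    using DE by (auto simp: fine_partition_def)
  define w where "w K L = s (clamp1 (Inf K) (Sup K) (Sup L)) - s (clamp1 (Inf K) (Sup K) (Inf L))" for K L
  define V where "V K L = v (clamp1 (Inf K) (Sup K) (Sup L)) - v (clamp1 (Inf K) (Sup K) (Inf L))" for K L
  note iD = tagged_division_real_interval[OF D(1)]
  note iE = tagged_division_real_interval[OF E(1)]
  have sD: "(\<Sum>(x',L)\<in>E. w K L) = s (Sup K) - s (Inf K)" if xK: "(x,K) \<in> D" for x K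
    unfolding w_def by (rule sum_clamp1_increments[OF E(1)]) (use iD(2-5)[OF xK] in auto)
  have sV: "(\<Sum>(x',L)\<in>E. V K L) = v (Sup K) - v (Inf K)" if xK: "(x,K) \<in> D" for x K
    unfolding V_def by (rule sum_clamp1_increments[OF E(1)]) (use iD(2-5)[OF xK] in auto)
  have sE: "(\<Sum>(x,K)\<in>D. w K L) = s (Sup L) - s (Inf L)" if xL: "(x',L) \<in> E" for x' L
  proof -
    have "(\<Sum>(x,K)\<in>D. w K L) = (\<Sum>(x,K)\<in>D. s (clamp1 (Inf L) (Sup L) (Sup K)) - s (clamp1 (Inf L) (Sup L) (Inf K)))"
    proof (rule sum.cong[OF refl], clarify)
      fix x K assume xK: "(x,K) \<in> D"
      show "w K L = s (clamp1 (Inf L) (Sup L) (Sup K)) - s (clamp1 (Inf L) (Sup L) (Inf K))"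
        unfolding w_def by (rule clamp1_increment_swap) (use iD(3,4)[OF xK] iE(3,4)[OF xL] in linarith)+
    qed
    also have "\<dots> = s (Sup L) - s (Inf L)"
      by (rule sum_clamp1_increments[OF D(1)]) (use iE(2-5)[OF xL] in auto)
    finally show ?thesis .
  qed
  have wV: "norm (w K L) \<le> V K L \<and> 0 \<le> V K L" if xK: "(x,K) \<in> D" and xL: "(x',L) \<in> E" for x K x' L
  proof -
    have "a \<le> clamp1 (Inf K) (Sup K) (Inf L)" "clamp1 (Inf K) (Sup K) (Inf L) \<le> clamp1 (Inf K) (Sup K) (Sup L)"
      "clamp1 (Inf K) (Sup K) (Sup L) \<le> b"
      using iD(2-5)[OF xK] iE(2-5)[OF xL] by (auto simp: clamp1_def)
    then show ?thesis unfolding w_def V_def using dom norm_ge_zero order_trans by blast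
  qed
  have tm: "norm ((y x - y x') * w K L) \<le> e * V K L" if xK: "(x,K) \<in> D" and xL: "(x',L) \<in> E" for x K x' L
  proof (cases "Inf L \<le> Sup K \<and> Inf K \<le> Sup L")
    case True
    have "Sup K - Inf K < d" "Sup L - Inf L < d" using D(2) E(2) xK xL by auto
    then have "\<bar>x - x'\<bar> < 2 * d" using True iD(3,4)[OF xK] iE(3,4)[OF xL] by linarith
    then have "norm (y x - y x') \<le> e" using iD(2-5)[OF xK] iE(2-5)[OF xL] by (intro osc) auto
    then show ?thesis unfolding norm_mult using wV[OF xK xL] e by (intro mult_mono) auto
  next
    case False
    then have "clamp1 (Inf K) (Sup K) (Sup L) = clamp1 (Inf K) (Sup K) (Inf L)"
      using iD(3,4)[OF xK] iE(3,4)[OF xL] by (auto simp: clamp1_def max_def min_def)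
    then show ?thesis by (simp add: w_def V_def)
  qed
  have "riemann_sum D y = (\<Sum>(x,K)\<in>D. \<Sum>(x',L)\<in>E. y x * w K L)"
    unfolding riemann_sum_def
  proof (rule sum.cong[OF refl], clarify)
    fix x K assume "(x,K) \<in> D"
    from sD[OF this] show "y x * (s (Sup K) - s (Inf K)) = (\<Sum>(x',L)\<in>E. y x * w K L)"
      by (simp add: sum_distrib_left case_prod_unfold flip: \<open>_ = s (Sup K) - s (Inf K)\<close>)
  qed
  moreover have "riemann_sum E y = (\<Sum>(x',L)\<in>E. \<Sum>(x,K)\<in>D. y x' * w K L)"
    unfolding riemann_sum_def
  proof (rule sum.cong[OF refl], clarify)
    fix x L assume "(x,L) \<in> E"
    from sE[OF this] show "y x * (s (Sup L) - s (Inf L)) = (\<Sum>(x',K)\<in>D. y x * w K L)"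
      by (simp add: sum_distrib_left case_prod_unfold flip: \<open>_ = s (Sup L) - s (Inf L)\<close>)
  qed
  moreover have "(\<Sum>(x',L)\<in>E. \<Sum>(x,K)\<in>D. y x' * w K L) = (\<Sum>(x,K)\<in>D. \<Sum>(x',L)\<in>E. y x' * w K L)"
    unfolding case_prod_unfold by (rule sum.swap)
  ultimately have "riemann_sum D y - riemann_sum E y = (\<Sum>(x,K)\<in>D. \<Sum>(x',L)\<in>E. (y x - y x') * w K L)"
    by (simp add: case_prod_unfold left_diff_distrib flip: sum_subtractf)
  also have "norm \<dots> \<le> (\<Sum>(x,K)\<in>D. \<Sum>(x',L)\<in>E. e * V K L)"
  proof (rule sum_norm_le, clarify)
    fix x K assume xK: "(x,K) \<in> D"
    show "norm (\<Sum>(x',L)\<in>E. (y x - y x') * w K L) \<le> (\<Sum>(x',L)\<in>E. e * V K L)"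
      by (rule sum_norm_le) (use tm[OF xK] in auto)
  qed
  also have "\<dots> = (\<Sum>(x,K)\<in>D. e * (v (Sup K) - v (Inf K)))"
  proof (rule sum.cong[OF refl], clarify)
    fix x K assume "(x,K) \<in> D"
    from sV[OF this] show "(\<Sum>(x',L)\<in>E. e * V K L) = e * (v (Sup K) - v (Inf K))"
      by (simp add: sum_distrib_left[symmetric] case_prod_unfold)
  qed
  also have "\<dots> = e * (\<Sum>(x,K)\<in>D. v (Sup K) - v (Inf K))"
    by (simp add: sum_distrib_left case_prod_unfold)
  also have "(\<Sum>(x,K)\<in>D. v (Sup K) - v (Inf K)) = total"
    by (rule additive_tagged_division_1[OF ab D(1)])
  finally show ?thesis .
qed

lemma has_stieltjes_integral_iff:
  "has_stieltjes_integral a b s y I \<longleftrightarrow> (\<forall>e>0. \<exists>d>0. \<forall>D. fine_partition a b d D \<longrightarrow> norm (riemann_sum D y - I) < e)"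
  unfolding has_stieltjes_integral_def fine_partition_def riemann_sum_def ..

lemma has_stieltjes_unique:
  assumes I: "has_stieltjes_integral a b s y I" "has_stieltjes_integral a b s y J"
  shows "I = J"
proof (rule ccontr)
  assume "I \<noteq> J"
  then have e: "norm (I - J) / 2 > 0" by simp
  obtain d1 where d1: "d1 > 0" "\<And>D. fine_partition a b d1 D \<Longrightarrow> norm (riemann_sum D y - I) < norm (I - J) / 2"
    using I(1) e unfolding has_stieltjes_integral_iff by blast
  obtain d2 where d2: "d2 > 0" "\<And>D. fine_partition a b d2 D \<Longrightarrow> norm (riemann_sum D y - J) < norm (I - J) / 2"
    using I(2) e unfolding has_stieltjes_integral_iff by blast
  have "min d1 d2 > 0" using d1 d2 by simp
  then obtain D where D: "fine_partition a b (min d1 d2) D"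
    by (rule fine_partition_exists)
  have "norm (riemann_sum D y - I) < norm (I - J) / 2" "norm (riemann_sum D y - J) < norm (I - J) / 2"
    using fine_partition_mono[OF D] by (intro d1 d2; simp)+
  moreover have "norm (I - J) \<le> norm (riemann_sum D y - J) + norm (riemann_sum D y - I)"
    using norm_triangle_ineq4[of "riemann_sum D y - J" "riemann_sum D y - I"] by simp
  ultimately show False by linarith
qed

lemma has_stieltjes_exists:
  assumes y: "continuous_on {a..b} y"
  shows "\<exists>I. has_stieltjes_integral a b s y I"
proof -
  have tot: "total \<ge> 0" using v_mono ab by simp
  have unif: "\<exists>d>0. \<forall>x\<in>{a..b}. \<forall>x'\<in>{a..b}. \<bar>x - x'\<bar> < 2 * d \<longrightarrow> norm (y x - y x') \<le> e" if "e > 0" for e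
  proof -
    have "uniformly_continuous_on {a..b} y" using y by (rule compact_uniformly_continuous) simp
    then obtain d where "d > 0" "\<And>x x'. x \<in> {a..b} \<Longrightarrow> x' \<in> {a..b} \<Longrightarrow> dist x' x < d \<Longrightarrow> dist (y x') (y x) < e"
      using \<open>e > 0\<close> unfolding uniformly_continuous_on_def by blast
    then show ?thesis by (intro exI[of _ "d/2"]) (force simp: dist_norm norm_minus_commute)
  qed
  have close: "\<exists>d>0. \<forall>D E. fine_partition a b d D \<and> fine_partition a b d E \<longrightarrow> norm (riemann_sum D y - riemann_sum E y) < e" if e: "e > 0" for e
  proof -
    have "e / (total + 1) > 0" using e tot by simp
    from unif[OF this] obtain d where d: "d > 0"
      "\<And>x x'. x \<in> {a..b} \<Longrightarrow> x' \<in> {a..b} \<Longrightarrow> \<bar>x - x'\<bar> < 2 * d \<Longrightarrow> norm (y x - y x') \<le> e / (total + 1)" by blast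
    have "norm (riemann_sum D y - riemann_sum E y) < e" if h: "fine_partition a b d D \<and> fine_partition a b d E" for D E
    proof -
      have "norm (riemann_sum D y - riemann_sum E y) \<le> e / (total + 1) * total"
        using h d(2) e tot by (intro riemann_sum_compare[of d D E]) auto
      also have "\<dots> < e" using e tot by (simp add: field_simps)
      finally show ?thesis .
    qed
    then show ?thesis using d(1) by blast
  qed
  have "\<exists>D. fine_partition a b (1 / real (Suc n)) D" for n
    using fine_partition_exists[of "1 / real (Suc n)" a b] by (metis of_nat_0_less_iff zero_less_Suc zero_less_divide_1_iff)
  then obtain D where D: "\<And>n. fine_partition a b (1 / real (Suc n)) (D n)" by metis
  have small: "\<exists>N. \<forall>n\<ge>N. fine_partition a b d (D n)" if d0: "d > 0" for d
  proof -
    obtain N where N: "inverse (real (Suc N)) < d" using reals_Archimedean[OF d0] by blast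
    have "fine_partition a b d (D n)" if "n \<ge> N" for n
    proof (rule fine_partition_mono[OF D])
      have "1 / real (Suc n) \<le> 1 / real (Suc N)" using that by (intro divide_left_mono) auto
      then show "1 / real (Suc n) \<le> d" using N by (simp add: inverse_eq_divide)
    qed
    then show ?thesis by blast
  qed
  have "Cauchy (\<lambda>n. riemann_sum (D n) y)"
  proof (rule CauchyI)
    fix e :: real assume "0 < e"
    from close[OF this] obtain d where d: "d > 0"
      "\<And>D E. fine_partition a b d D \<and> fine_partition a b d E \<Longrightarrow> norm (riemann_sum D y - riemann_sum E y) < e" by blast
    from small[OF d(1)] show "\<exists>M. \<forall>m\<ge>M. \<forall>n\<ge>M. norm (riemann_sum (D m) y - riemann_sum (D n) y) < e"
      using d(2) by blast
  qed
  then obtain I where I: "(\<lambda>n. riemann_sum (D n) y) \<longlonglongrightarrow> I" using Cauchy_convergent convergentD by blast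
  have "has_stieltjes_integral a b s y I"
    unfolding has_stieltjes_integral_iff
  proof (intro allI impI)
    fix e :: real assume e: "0 < e"
    then have "e/2 > 0" by simp
    from close[OF this] obtain d where d: "d > 0"
      "\<And>D E. fine_partition a b d D \<and> fine_partition a b d E \<Longrightarrow> norm (riemann_sum D y - riemann_sum E y) < e/2" by blast
    from small[OF d(1)] obtain N where N: "\<And>n. n \<ge> N \<Longrightarrow> fine_partition a b d (D n)" by blast
    show "\<exists>d>0. \<forall>D. fine_partition a b d D \<longrightarrow> norm (riemann_sum D y - I) < e"
    proof (intro exI[of _ d] conjI allI impI d(1))
      fix D' assume D': "fine_partition a b d D'"
      have "(\<lambda>n. norm (riemann_sum D' y - riemann_sum (D n) y)) \<longlonglongrightarrow> norm (riemann_sum D' y - I)" by (intro tendsto_intros I)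
      moreover have "norm (riemann_sum D' y - riemann_sum (D n) y) \<le> e/2" if "n \<ge> N" for n
        using d(2)[of D' "D n"] D' N[OF that] by simp
      ultimately have "norm (riemann_sum D' y - I) \<le> e/2" by (intro LIMSEQ_le_const2) auto
      then show "norm (riemann_sum D' y - I) < e" using e by simp
    qed
  qed
  then show ?thesis ..
qed

abbreviation int :: "(real \<Rightarrow> complex) \<Rightarrow> complex" where "int y \<equiv> stieltjes_integral a b s y"

lemma int_eqI: "has_stieltjes_integral a b s y I \<Longrightarrow> int y = I"
  unfolding stieltjes_integral_def by (rule the_equality) (auto intro: has_stieltjes_unique)

lemma has_int: "continuous_on {a..b} y \<Longrightarrow> has_stieltjes_integral a b s y (int y)"
  using has_stieltjes_exists int_eqI by metis

lemma int_approx: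
  assumes "continuous_on {a..b} y" "e > 0"
  obtains d where "d > 0" "\<And>D. fine_partition a b d D \<Longrightarrow> norm (riemann_sum D y - int y) < e"
  using has_int[OF assms(1)] assms(2) unfolding has_stieltjes_integral_iff by blast

lemma int_add:
  assumes y: "continuous_on {a..b} y" and z: "continuous_on {a..b} z"
  shows "int (\<lambda>x. y x + z x) = int y + int z"
proof (rule int_eqI, unfold has_stieltjes_integral_iff, intro allI impI)
  fix e :: real assume "e > 0"
  then have e: "e/2 > 0" by simp
  obtain d1 where d1: "d1 > 0" "\<And>D. fine_partition a b d1 D \<Longrightarrow> norm (riemann_sum D y - int y) < e/2"
    by (rule int_approx[OF y e], rule that)
  obtain d2 where d2: "d2 > 0" "\<And>D. fine_partition a b d2 D \<Longrightarrow> norm (riemann_sum D z - int z) < e/2"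
    by (rule int_approx[OF z e], rule that)
  show "\<exists>d>0. \<forall>D. fine_partition a b d D \<longrightarrow> norm (riemann_sum D (\<lambda>x. y x + z x) - (int y + int z)) < e"
  proof (intro exI[of _ "min d1 d2"] conjI allI impI)
    show "min d1 d2 > 0" using d1 d2 by simp
    fix D assume D: "fine_partition a b (min d1 d2) D"
    have "norm (riemann_sum D y - int y) < e/2" "norm (riemann_sum D z - int z) < e/2"
      using fine_partition_mono[OF D] by (intro d1 d2; simp)+
    moreover have "riemann_sum D (\<lambda>x. y x + z x) = riemann_sum D y + riemann_sum D z"
      by (simp add: riemann_sum_def case_prod_unfold distrib_right sum.distrib)
    moreover have "norm (riemann_sum D y + riemann_sum D z - (int y + int z)) \<le> norm (riemann_sum D y - int y) + norm (riemann_sum D z - int z)"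
      by (metis add_diff_add norm_triangle_ineq)
    ultimately show "norm (riemann_sum D (\<lambda>x. y x + z x) - (int y + int z)) < e" by simp
  qed
qed

lemma int_mult:
  assumes y: "continuous_on {a..b} y"
  shows "int (\<lambda>x. c * y x) = c * int y"
proof (rule int_eqI, unfold has_stieltjes_integral_iff, intro allI impI)
  fix e :: real assume e0: "e > 0"
  then have e: "e / (norm c + 1) > 0" by (simp add: add_nonneg_pos)
  obtain d where d: "d > 0" "\<And>D. fine_partition a b d D \<Longrightarrow> norm (riemann_sum D y - int y) < e / (norm c + 1)"
    by (rule int_approx[OF y e], rule that)
  show "\<exists>d>0. \<forall>D. fine_partition a b d D \<longrightarrow> norm (riemann_sum D (\<lambda>x. c * y x) - c * int y) < e"
  proof (intro exI[of _ d] conjI allI impI d(1))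
    fix D assume D: "fine_partition a b d D"
    have "riemann_sum D (\<lambda>x. c * y x) - c * int y = c * (riemann_sum D y - int y)"
      by (simp add: riemann_sum_def case_prod_unfold sum_distrib_left right_diff_distrib mult.assoc)
    then have "norm (riemann_sum D (\<lambda>x. c * y x) - c * int y) = norm c * norm (riemann_sum D y - int y)"
      by (simp only: norm_mult)
    also have "\<dots> \<le> norm c * (e / (norm c + 1))" using d(2)[OF D] by (intro mult_left_mono) auto
    also have "\<dots> < (norm c + 1) * (e / (norm c + 1))" using e by (intro mult_strict_right_mono) auto
    also have "\<dots> = e"
    proof -
      have "norm c + 1 \<noteq> 0" using norm_ge_zero[of c] by linarith
      then show ?thesis by simp
    qed
    finally show "norm (riemann_sum D (\<lambda>x. c * y x) - c * int y) < e" .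
  qed
qed

lemma int_lincomb:
  assumes y: "continuous_on {a..b} y" and z: "continuous_on {a..b} z"
  shows "int (\<lambda>x. c * y x + d * z x) = c * int y + d * int z"
  using int_add[of "\<lambda>x. c * y x" "\<lambda>x. d * z x"] y z by (simp add: int_mult continuous_on_mult_left)

lemma int_bound:
  assumes y: "continuous_on {a..b} y" and M: "\<And>x. x \<in> {a..b} \<Longrightarrow> norm (y x) \<le> M"
  shows "norm (int y) \<le> total * M"
proof (rule field_le_epsilon)
  fix e :: real assume e: "e > 0"
  obtain d where d: "d > 0" "\<And>D. fine_partition a b d D \<Longrightarrow> norm (riemann_sum D y - int y) < e"
    by (rule int_approx[OF y e], rule that)
  obtain D where fine: "fine_partition a b d D" by (rule fine_partition_exists[OF d(1)])
  then have D: "D tagged_division_of {a..b}" by (simp add: fine_partition_def)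
  have "norm (riemann_sum D y) \<le> (\<Sum>(x,K)\<in>D. M * (v (Sup K) - v (Inf K)))"
    unfolding riemann_sum_def
  proof (rule sum_norm_le, clarify)
    fix x K assume xK: "(x,K) \<in> D"
    note K = tagged_division_real_interval[OF D xK]
    have "norm (y x) * norm (s (Sup K) - s (Inf K)) \<le> M * (v (Sup K) - v (Inf K))"
    proof (rule mult_mono)
      show y': "norm (y x) \<le> M" using K(2-5) by (intro M) auto
      show "norm (s (Sup K) - s (Inf K)) \<le> v (Sup K) - v (Inf K)" using K(2-5) by (intro dom) auto
      show "0 \<le> M" using y' norm_ge_zero order_trans by blast
    qed simp
    then show "norm (y x * (s (Sup K) - s (Inf K))) \<le> M * (v (Sup K) - v (Inf K))" by (simp add: norm_mult)
  qed
  also have "\<dots> = M * (\<Sum>(x,K)\<in>D. v (Sup K) - v (Inf K))" by (simp add: sum_distrib_left case_prod_unfold)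
  also have "\<dots> = total * M" using additive_tagged_division_1[OF ab D, of v] by simp
  finally have "norm (riemann_sum D y) \<le> total * M" .
  moreover have "norm (int y) \<le> norm (riemann_sum D y) + norm (riemann_sum D y - int y)"
    using norm_triangle_sub[of "int y" "riemann_sum D y"] by (simp add: norm_minus_commute)
  ultimately show "norm (int y) \<le> total * M + e" using d(2)[OF fine] by linarith
qed

lemma int_cong:
  assumes z: "continuous_on {a..b} z" and eq: "\<And>x. x \<in> {a..b} \<Longrightarrow> y x = z x"
  shows "int y = int z"
proof (rule int_eqI)
  have "riemann_sum D y = riemann_sum D z" if "fine_partition a b d D" for d D
    unfolding riemann_sum_def using that eq by (intro sum.cong) (auto simp: fine_partition_def dest!: tag_in_interval)
  then show "has_stieltjes_integral a b s y (int z)"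
    using has_int[OF z] unfolding has_stieltjes_integral_iff by (metis (no_types, lifting))
qed

lemma int_const: "int (\<lambda>x. c) = c * (s b - s a)"
proof (rule int_eqI, unfold has_stieltjes_integral_iff, intro allI impI exI conjI)
  fix e :: real and D assume e: "e > 0" and D: "fine_partition a b 1 D"
  have "riemann_sum D (\<lambda>x. c) = c * (\<Sum>(x,K)\<in>D. s (Sup K) - s (Inf K))"
    by (simp add: riemann_sum_def sum_distrib_left case_prod_unfold)
  also have "(\<Sum>(x,K)\<in>D. s (Sup K) - s (Inf K)) = s b - s a"
    by (rule additive_tagged_division_1[OF ab]) (use D in \<open>simp add: fine_partition_def\<close>)
  finally show "norm (riemann_sum D (\<lambda>x. c) - c * (s b - s a)) < e" using e by simp
qed simp

end

lemma stieltjes_subinterval: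
  assumes "stieltjes a b s v" "a \<le> c" "c \<le> d" "d \<le> b"
  shows "stieltjes c d s v"
  using assms unfolding stieltjes_def by auto

lemma stieltjes_integral_combine:
  assumes st: "stieltjes a c s v" and ab: "a \<le> b" "b \<le> c" and y: "continuous_on {a..c} y"
  shows "stieltjes_integral a c s y = stieltjes_integral a b s y + stieltjes_integral b c s y"
proof -
  interpret ac: stieltjes a c s v by fact
  interpret ab: stieltjes a b s v by (rule stieltjes_subinterval[OF st]) (use ab in auto)
  interpret bc: stieltjes b c s v by (rule stieltjes_subinterval[OF st]) (use ab in auto)
  have y1: "continuous_on {a..b} y" and y2: "continuous_on {b..c} y"
    using y ab by (auto intro: continuous_on_subset)
  have "norm (ac.int y - (ab.int y + bc.int y)) \<le> 0 + e" if "e > 0" for e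
  proof -
    have e: "e/3 > 0" using that by simp
    obtain d1 where d1: "d1 > 0" "\<And>D. fine_partition a c d1 D \<Longrightarrow> norm (ac.riemann_sum D y - ac.int y) < e/3"
      by (rule ac.int_approx[OF y e], rule that)
    obtain d2 where d2: "d2 > 0" "\<And>D. fine_partition a b d2 D \<Longrightarrow> norm (ab.riemann_sum D y - ab.int y) < e/3"
      by (rule ab.int_approx[OF y1 e], rule that)
    obtain d3 where d3: "d3 > 0" "\<And>D. fine_partition b c d3 D \<Longrightarrow> norm (bc.riemann_sum D y - bc.int y) < e/3"
      by (rule bc.int_approx[OF y2 e], rule that)
    define d where "d = min d1 (min d2 d3)"
    have d: "d > 0" "d \<le> d1" "d \<le> d2" "d \<le> d3" using d1 d2 d3 by (simp_all add: d_def)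
    obtain D where D': "fine_partition a b d D" by (rule fine_partition_exists[OF d(1)])
    obtain E where E': "fine_partition b c d E" by (rule fine_partition_exists[OF d(1)])
    have D: "D tagged_division_of {a..b}" and E: "E tagged_division_of {b..c}"
      using D' E' by (auto simp: fine_partition_def)
    have "(D \<union> E) tagged_division_of ({a..b} \<union> {b..c})"
      by (rule tagged_division_Un[OF D E]) auto
    moreover have "{a..b} \<union> {b..c} = {a..c}" using ab by auto
    ultimately have DE: "fine_partition a c d (D \<union> E)" using D' E' by (auto simp: fine_partition_def)
    have "norm (ac.riemann_sum (D \<union> E) y - ac.int y) < e/3" "norm (ab.riemann_sum D y - ab.int y) < e/3" "norm (bc.riemann_sum E y - bc.int y) < e/3"
      using fine_partition_mono[OF DE d(2)] fine_partition_mono[OF D' d(3)] fine_partition_mono[OF E' d(4)] d1(2) d2(2) d3(2)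
      by blast+
    moreover have "ac.riemann_sum (D \<union> E) y = ab.riemann_sum D y + bc.riemann_sum E y"
      unfolding ac.riemann_sum_def ab.riemann_sum_def bc.riemann_sum_def
    proof (rule sum.union_inter_neutral)
      show "finite D" "finite E" using D E by (auto intro: tagged_division_of_finite)
      show "\<forall>t\<in>D \<inter> E. (case t of (x,K) \<Rightarrow> y x * (s (Sup K) - s (Inf K))) = 0"
      proof (clarify)
        fix x K assume "(x,K) \<in> D" "(x,K) \<in> E"
        then have "Sup K = Inf K"
          using tagged_division_real_interval(2-5)[OF D, of x K] tagged_division_real_interval(2-5)[OF E, of x K] by simp
        then show "y x * (s (Sup K) - s (Inf K)) = 0" by simp
      qed
    qed
    moreover have "norm (ac.int y - (ab.int y + bc.int y)) \<le>
        norm (ac.riemann_sum (D \<union> E) y - ac.int y) + norm (ab.riemann_sum D y - ab.int y) + norm (bc.riemann_sum E y - bc.int y)"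
      if "ac.riemann_sum (D \<union> E) y = ab.riemann_sum D y + bc.riemann_sum E y"
    proof -
      have "ac.int y - (ab.int y + bc.int y) = - (ac.riemann_sum (D \<union> E) y - ac.int y) + (ab.riemann_sum D y - ab.int y) + (bc.riemann_sum E y - bc.int y)"
        using that by simp
      then show ?thesis by (metis norm_minus_cancel norm_triangle_le norm_triangle_ineq add_mono order_refl)
    qed
    ultimately show ?thesis by simp
  qed
  then have "norm (ac.int y - (ab.int y + bc.int y)) \<le> 0" by (rule field_le_epsilon)
  then show ?thesis by simp
qed

text \<open>
  The majorant \<open>v\<close> has a limit from the right at \<open>0\<close>, so its increments on \<open>(0, \<eta>]\<close> are below \<open>e\<close> for small \<open>\<eta>\<close>. Split
  the integral at \<open>x1\<close> and \<open>\<eta>\<close> with \<open>x1 \<rightarrow> 0\<close>: the first part tends to \<open>H y(0)\<close>, the second is at most \<open>e M\<close>, and on the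
  third the smaller bound \<open>m\<close> is available.
\<close>

theorem stieltjes_integral_jump_dominates:
  assumes st: "stieltjes 0 T s v" and T: "T > 0"
    and jump: "((\<lambda>t. s t - s 0) \<longlongrightarrow> H) (at_right 0)" and e: "e > 0" and r: "r > 0"
  obtains \<eta> where "0 < \<eta>" "\<eta> < r" "\<eta> \<le> T"
    "\<And>a (y :: real \<Rightarrow> complex) M m. \<eta> \<le> a \<Longrightarrow> a \<le> T \<Longrightarrow> continuous_on {0..a} y \<Longrightarrow> \<forall>t\<in>{0..a}. norm (y t) \<le> M \<Longrightarrow>
       \<forall>t\<in>{\<eta>..a}. norm (y t) \<le> m \<Longrightarrow>
       norm (stieltjes_integral 0 a s y - H * y 0) \<le> e * M + (v T - v 0) * m"
proof -
  interpret T: stieltjes 0 T s v by fact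
  define v0 where "v0 = Inf (v ` {0<..T})"
  have bdd: "bdd_below (v ` {0<..T})" using T.v_mono[of 0] by (intro bdd_belowI[of _ "v 0"]) auto
  have v0: "v0 \<le> v x" if "x \<in> {0<..T}" for x unfolding v0_def using that by (intro cInf_lower bdd) auto
  have "\<exists>x\<in>v ` {0<..T}. x < v0 + e"
    unfolding v0_def using e T by (intro cInf_lessD) auto
  then obtain x0 where x0: "x0 \<in> {0<..T}" "v x0 < v0 + e" by auto
  define \<eta> where "\<eta> = min x0 (r/2)"
  have \<eta>: "0 < \<eta>" "\<eta> < r" "\<eta> \<le> T" using x0 r by (auto simp: \<eta>_def)
  have v\<eta>: "v \<eta> - v x \<le> e" if "0 < x" "x \<le> \<eta>" for x
    using v0[of x] T.v_mono[of \<eta> x0] x0 \<eta> that by (auto simp: \<eta>_def)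
  show ?thesis
  proof (rule that[OF \<eta>])
    fix a M m :: real and y :: "real \<Rightarrow> complex"
    assume a: "\<eta> \<le> a" "a \<le> T" and y: "continuous_on {0..a} y"
      and bnd: "\<forall>t\<in>{0..a}. norm (y t) \<le> M" "\<forall>t\<in>{\<eta>..a}. norm (y t) \<le> m"
    note M = bspec[OF bnd(1)] and m = bspec[OF bnd(2)]
    have M0: "M \<ge> 0" using order_trans[OF norm_ge_zero M[of 0]] a \<eta> by simp
    have m0: "m \<ge> 0" using order_trans[OF norm_ge_zero m[of a]] a by simp
    have tot: "v T - v 0 \<ge> 0" using T.v_mono[of 0 T] T by simp
    show "norm (stieltjes_integral 0 a s y - H * y 0) \<le> e * M + (v T - v 0) * m"
    proof (rule field_le_epsilon)
      fix e2 :: real assume e2: "e2 > 0"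
      define \<delta> where "\<delta> = e2 / (v T - v 0 + M + 1)"
      have den: "v T - v 0 + M + 1 > 0" using tot M0 by simp
      have \<delta>: "\<delta> > 0" "(v T - v 0) * \<delta> + M * \<delta> \<le> e2"
      proof -
        show "\<delta> > 0" using e2 den by (simp add: \<delta>_def)
        then have "(v T - v 0) * \<delta> + M * \<delta> \<le> (v T - v 0 + M + 1) * \<delta>" by (simp add: algebra_simps)
        also have "\<dots> = e2" using den by (simp add: \<delta>_def)
        finally show "(v T - v 0) * \<delta> + M * \<delta> \<le> e2" .
      qed
      have "0 \<in> {0..a}" using a \<eta> by simp
      then have "\<forall>e>0. \<exists>d>0. \<forall>x'\<in>{0..a}. dist x' 0 < d \<longrightarrow> dist (y x') (y 0) < e"
        using y unfolding continuous_on_iff by blast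
      then obtain d1 where d1: "d1 > 0" "\<And>t. t \<in> {0..a} \<Longrightarrow> dist t 0 < d1 \<Longrightarrow> dist (y t) (y 0) < \<delta>"
        using \<delta>(1) by blast
      have "eventually (\<lambda>t. dist (s t - s 0) H < \<delta>) (at_right 0)" using tendstoD[OF jump \<delta>(1)] .
      then obtain d2 where d2: "d2 > 0" "\<And>t. 0 < t \<Longrightarrow> t < d2 \<Longrightarrow> dist (s t - s 0) H < \<delta>"
        unfolding eventually_at_right_field by auto
      define x1 where "x1 = min (\<eta>/2) (min (d1/2) (d2/2))"
      have x1: "0 < x1" "x1 < \<eta>" "x1 < d1" "x1 < d2" using \<eta> d1 d2 by (auto simp: x1_def)
      have st_a: "stieltjes 0 a s v" by (rule stieltjes_subinterval[OF st]) (use a \<eta> in auto)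
      interpret i1: stieltjes 0 x1 s v by (rule stieltjes_subinterval[OF st]) (use a \<eta> x1 in auto)
      interpret i2: stieltjes x1 \<eta> s v by (rule stieltjes_subinterval[OF st]) (use a \<eta> x1 in auto)
      interpret i3: stieltjes \<eta> a s v by (rule stieltjes_subinterval[OF st]) (use a \<eta> x1 in auto)
      have st_xa: "stieltjes x1 a s v" by (rule stieltjes_subinterval[OF st]) (use a \<eta> x1 in auto)
      have y1: "continuous_on {0..x1} y" "continuous_on {x1..\<eta>} y" "continuous_on {\<eta>..a} y" "continuous_on {x1..a} y"
        using y x1 \<eta> a by (auto intro: continuous_on_subset)
      have split: "stieltjes_integral 0 a s y = i1.int y + (i2.int y + i3.int y)"
        using stieltjes_integral_combine[OF st_a _ _ y, of x1] stieltjes_integral_combine[OF st_xa _ _ y1(4), of \<eta>] x1 a by simp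
      have b1: "norm (i1.int y - y 0 * (s x1 - s 0)) \<le> (v T - v 0) * \<delta>"
      proof -
        have "i1.int (\<lambda>x. 1 * y x + (-1) * y 0) = 1 * i1.int y + (-1) * (y 0 * (s x1 - s 0))"
          by (subst i1.int_lincomb[OF y1(1) continuous_on_const]) (simp add: i1.int_const)
        moreover have "norm (i1.int (\<lambda>x. 1 * y x + (-1) * y 0)) \<le> (v x1 - v 0) * \<delta>"
        proof (rule i1.int_bound)
          show "continuous_on {0..x1} (\<lambda>x. 1 * y x + (-1) * y 0)" by (intro continuous_intros y1)
          show "norm (1 * y x + (-1) * y 0) \<le> \<delta>" if "x \<in> {0..x1}" for x
            using d1(2)[of x] that x1 a by (simp add: dist_norm)
        qed
        moreover have "(v x1 - v 0) * \<delta> \<le> (v T - v 0) * \<delta>"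
          using T.v_mono[of x1 T] x1 \<eta> \<delta>(1) by (intro mult_right_mono) auto
        ultimately show ?thesis by simp
      qed
      have b2: "norm (y 0 * (s x1 - s 0) - H * y 0) \<le> M * \<delta>"
      proof -
        have "y 0 * (s x1 - s 0) - H * y 0 = y 0 * (s x1 - s 0 - H)" by (simp add: algebra_simps)
        moreover have "norm (y 0) * norm (s x1 - s 0 - H) \<le> M * \<delta>"
          using M[of 0] d2(2)[of x1] x1 a \<eta> M0 by (intro mult_mono) (auto simp: dist_norm)
        ultimately show ?thesis by (simp add: norm_mult)
      qed
      have b3: "norm (i2.int y) \<le> e * M"
      proof -
        have "norm (i2.int y) \<le> (v \<eta> - v x1) * M" by (rule i2.int_bound[OF y1(2)]) (use M x1 a in auto)
        also have "\<dots> \<le> e * M" using v\<eta>[of x1] x1 M0 by (intro mult_right_mono) auto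
        finally show ?thesis .
      qed
      have b4: "norm (i3.int y) \<le> (v T - v 0) * m"
      proof -
        have "norm (i3.int y) \<le> (v a - v \<eta>) * m" by (rule i3.int_bound[OF y1(3) m])
        also have "\<dots> \<le> (v T - v 0) * m"
          using T.v_mono[of 0 \<eta>] T.v_mono[of a T] \<eta> a m0 by (intro mult_right_mono) auto
        finally show ?thesis .
      qed
      have "stieltjes_integral 0 a s y - H * y 0 = (i1.int y - y 0 * (s x1 - s 0)) + (y 0 * (s x1 - s 0) - H * y 0) + i2.int y + i3.int y"
        unfolding split by simp
      also have "norm \<dots> \<le> (v T - v 0) * \<delta> + M * \<delta> + e * M + (v T - v 0) * m"
        by (intro norm_triangle_le add_mono b1 b2 b3 b4)
      also have "\<dots> \<le> e * M + (v T - v 0) * m + e2" using \<delta>(2) by simp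
      finally show "norm (stieltjes_integral 0 a s y - H * y 0) \<le> e * M + (v T - v 0) * m + e2" .
    qed
  qed
qed

section \<open>Entire functions with the same zeros\<close>

lemma entire_quotient:
  fixes f g :: "complex \<Rightarrow> complex"
  assumes f: "f holomorphic_on UNIV" and g: "g holomorphic_on UNIV"
    and nz: "\<exists>z. f z \<noteq> 0" "\<exists>z. g z \<noteq> 0"
    and zeros: "\<And>z. g z = 0 \<Longrightarrow> f z = 0 \<and> zorder f z = zorder g z"
  obtains h where "h holomorphic_on UNIV" "\<And>z. f z = h z * g z"
proof -
  define h where "h = remove_sings (\<lambda>z. f z / g z)"
  have an: "h analytic_on {z} \<and> f z = h z * g z" for z
  proof (cases "g z = 0")
    case False
    have "f analytic_on UNIV" "g analytic_on UNIV" using f g by (auto simp: analytic_on_open)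
    then have "f analytic_on {z}" "g analytic_on {z}" by (auto intro: analytic_on_subset)
    then have *: "(\<lambda>z. f z / g z) analytic_on {z}" using False by (intro analytic_intros) auto
    then have "h z = f z / g z" unfolding h_def by (rule remove_sings_at_analytic)
    moreover have "h analytic_on {z}"
      unfolding h_def
    proof (rule remove_sings_analytic_at[OF isolated_singularity_at_analytic[OF *]])
      have "(\<lambda>z. f z / g z) field_differentiable at z" using * by (rule analytic_on_imp_differentiable_at) simp
      then show "(\<lambda>z. f z / g z) \<midarrow>z\<rightarrow> f z / g z"
        using field_differentiable_imp_continuous_at isCont_def by blast
    qed
    ultimately show ?thesis using False by simp
  next
    case True
    then have fz: "f z = 0" and ord: "zorder f z = zorder g z" using zeros by auto
    define n where "n = nat (zorder g z)"
    obtain r1 where r1: "r1 > 0" "zor_poly f z holomorphic_on cball z r1"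
       "\<And>w. w \<in> cball z r1 \<Longrightarrow> f w = zor_poly f z w * (w - z) ^ n \<and> zor_poly f z w \<noteq> 0"
      using zorder_exist_zero[OF f open_UNIV connected_UNIV UNIV_I, of z] nz(1) unfolding n_def ord by blast
    obtain r2 where r2: "r2 > 0" "zor_poly g z holomorphic_on cball z r2"
       "\<And>w. w \<in> cball z r2 \<Longrightarrow> g w = zor_poly g z w * (w - z) ^ n \<and> zor_poly g z w \<noteq> 0"
      using zorder_exist_zero[OF g open_UNIV connected_UNIV UNIV_I, of z] nz(2) unfolding n_def by blast
    define r where "r = min r1 r2"
    have r: "r > 0" using r1 r2 by (simp add: r_def)
    let ?F = "zor_poly f z" and ?G = "zor_poly g z"
    have quot: "f w / g w = ?F w / ?G w" "g w \<noteq> 0" if "w \<in> ball z r - {z}" for w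
      using r1(3)[of w] r2(3)[of w] that by (auto simp: r_def)
    have iso: "isolated_singularity_at (\<lambda>z. f z / g z) z"
      unfolding isolated_singularity_at_def
    proof (intro exI conjI)
      show "(\<lambda>z. f z / g z) analytic_on ball z r - {z}"
        using quot(2) by (subst analytic_on_open) (auto intro!: holomorphic_intros holomorphic_on_subset[OF f] holomorphic_on_subset[OF g])
    qed (rule r)
    have "?F holomorphic_on ball z r" "?G holomorphic_on ball z r"
      using r1(2) r2(2) by (auto elim!: holomorphic_on_subset simp: r_def)
    then have "isCont ?F z" "isCont ?G z"
      using r holomorphic_on_imp_continuous_on[of _ "ball z r"] continuous_on_eq_continuous_at[OF open_ball, of z r]
        centre_in_ball[of z r] by blast+
    moreover have "?G z \<noteq> 0" using r2(3)[of z] r2(1) by simp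
    ultimately have "(\<lambda>w. ?F w / ?G w) \<midarrow>z\<rightarrow> ?F z / ?G z"
      by (intro tendsto_divide) (auto simp: isCont_def)
    then have "(\<lambda>w. f w / g w) \<midarrow>z\<rightarrow> ?F z / ?G z"
    proof (rule Lim_transform_within_open[of _ _ _ _ "ball z r"])
      show "?F w / ?G w = f w / g w" if "w \<in> ball z r" "w \<noteq> z" for w using quot(1)[of w] that by simp
    qed (use r in auto)
    then have "h analytic_on {z}" unfolding h_def by (rule remove_sings_analytic_at[OF iso])
    then show ?thesis using True fz by simp
  qed
  have "h analytic_on UNIV" using an analytic_on_analytic_at by blast
  then have "h holomorphic_on UNIV" by (rule analytic_imp_holomorphic)
  then show ?thesis using an that by blast
qed

text \<open>
  Outside the strip \<open>\<bar>Im z\<bar> < K\<close> the two-sided estimates bound \<open>h\<close>. If \<open>h\<close> were unbounded at points \<open>z n\<close> of the strip,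
  move their real parts to \<open>0\<close>: by Montel's theorem a subsequence of the translates of \<open>g\<close> converges, and the limit
  is not zero because of the lower bound at height \<open>K\<close>. It has no zeros on some circle of radius \<open>\<rho> > K\<close>, so the
  translates of \<open>g\<close> are bounded below there, and the maximum principle bounds \<open>h\<close> at the points \<open>z n\<close>.
\<close>

lemma entire_quotient_bounded:
  fixes f g h :: "complex \<Rightarrow> complex"
  assumes g: "g holomorphic_on UNIV" and h: "h holomorphic_on UNIV"
    and fgh: "\<And>z. f z = h z * g z"
    and upper: "\<And>z. norm (f z) \<le> C * exp (a * \<bar>Im z\<bar>)" "\<And>z. norm (g z) \<le> C * exp (a * \<bar>Im z\<bar>)"
    and lower: "\<And>z. \<bar>Im z\<bar> \<ge> K \<Longrightarrow> norm (g z) \<ge> c * exp (a * \<bar>Im z\<bar>)"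
    and pos: "c > 0" "K > 0" "C > 0" "a \<ge> 0"
  shows "\<exists>B. \<forall>z. norm (h z) \<le> B"
proof (rule ccontr)
  assume unb: "\<not> (\<exists>B. \<forall>z. norm (h z) \<le> B)"
  then have "\<exists>z. norm (h z) > C / c + real n" for n by (meson not_less)
  then obtain z where z: "\<And>n. norm (h (z n)) > C / c + real n" by metis
  have strip: "\<bar>Im (z n)\<bar> < K" for n
  proof (rule ccontr)
    assume "\<not> \<bar>Im (z n)\<bar> < K"
    then have lo: "norm (g (z n)) \<ge> c * exp (a * \<bar>Im (z n)\<bar>)" by (intro lower) simp
    have "norm (h (z n)) * (c * exp (a * \<bar>Im (z n)\<bar>)) \<le> norm (h (z n)) * norm (g (z n))"
      by (rule mult_left_mono[OF lo]) simp
    also have "\<dots> = norm (f (z n))" by (simp add: fgh norm_mult)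
    also have "\<dots> \<le> C * exp (a * \<bar>Im (z n)\<bar>)" by (rule upper)
    finally have "norm (h (z n)) \<le> C / c" using pos by (simp add: field_simps)
    then show False using z[of n] by simp
  qed
  define \<F> where "\<F> n w = g (of_real (Re (z n)) + w)" for n w
  define \<H> where "\<H> = {\<phi>. \<phi> holomorphic_on UNIV \<and> (\<forall>w. norm (\<phi> w) \<le> C * exp (a * \<bar>Im w\<bar>))}"
  have F: "\<F> n \<in> \<H>" for n
  proof -
    have "(g \<circ> (\<lambda>w. of_real (Re (z n)) + w)) holomorphic_on UNIV"
      by (rule holomorphic_on_compose_gen[of _ UNIV _ UNIV]) (auto intro!: holomorphic_intros g)
    then have "\<F> n holomorphic_on UNIV" by (simp add: \<F>_def[abs_def] o_def)
    moreover have "norm (\<F> n w) \<le> C * exp (a * \<bar>Im w\<bar>)" for w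
      using upper(2)[of "of_real (Re (z n)) + w"] by (simp add: \<F>_def)
    ultimately show ?thesis by (simp add: \<H>_def)
  qed
  have bounded: "\<exists>B. \<forall>\<phi>\<in>\<H>. \<forall>w\<in>X. norm (\<phi> w) \<le> B" if X: "compact X" for X
  proof -
    obtain b where b: "\<And>w. w \<in> X \<Longrightarrow> norm w \<le> b" using compact_imp_bounded[OF X] unfolding bounded_iff by blast
    have "norm (\<phi> w) \<le> C * exp (a * b)" if "\<phi> \<in> \<H>" "w \<in> X" for \<phi> w
    proof -
      have "\<bar>Im w\<bar> \<le> b" using b[OF that(2)] abs_Im_le_cmod[of w] by simp
      then have "C * exp (a * \<bar>Im w\<bar>) \<le> C * exp (a * b)" using pos by (simp add: mult_left_mono)
      then show ?thesis using that(1) order_trans unfolding \<H>_def by blast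
    qed
    then show ?thesis by blast
  qed
  obtain \<Phi> r where \<Phi>: "\<Phi> holomorphic_on UNIV" and r: "strict_mono (r :: nat \<Rightarrow> nat)"
    and lim: "\<And>w. (\<lambda>n. \<F> (r n) w) \<longlonglongrightarrow> \<Phi> w"
    and ulim: "\<And>X. compact X \<Longrightarrow> uniform_limit X (\<F> \<circ> r) \<Phi> sequentially"
  proof (rule Montel[OF open_UNIV, of \<H> \<F>])
    show "\<phi> holomorphic_on UNIV" if "\<phi> \<in> \<H>" for \<phi> using that by (simp add: \<H>_def)
    show "range \<F> \<subseteq> \<H>" using F by auto
  qed (use bounded that in auto)
  have "norm (\<Phi> (\<i> * K)) \<ge> c * exp (a * K)"
  proof (rule LIMSEQ_le_const[OF tendsto_norm[OF lim]], intro exI allI impI)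
    fix n
    show "c * exp (a * K) \<le> norm (\<F> (r n) (\<i> * K))"
      using lower[of "of_real (Re (z (r n))) + \<i> * K"] pos by (simp add: \<F>_def)
  qed
  moreover have "c * exp (a * K) > 0" using pos by simp
  ultimately have nz: "\<Phi> (\<i> * K) \<noteq> 0" by auto
  have cz: "countable {w. \<Phi> w = 0}"
  proof (cases "\<Phi> constant_on UNIV")
    case True
    then have "{w. \<Phi> w = 0} = {}" using nz by (auto simp: constant_on_def)
    then show ?thesis by simp
  next
    case False
    then show ?thesis using holomorphic_countable_zeros[OF \<Phi> open_UNIV connected_UNIV] by simp
  qed
  have "uncountable {K<..<2*K}" using pos by (simp add: uncountable_open_interval)
  then have "\<not> {K<..<2*K} \<subseteq> norm ` {w. \<Phi> w = 0}" using cz countable_image countable_subset by blast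
  then obtain \<rho> where \<rho>: "K < \<rho>" "\<rho> < 2 * K" "\<And>w. norm w = \<rho> \<Longrightarrow> \<Phi> w \<noteq> 0" by (auto simp: subset_iff)
  have cont: "continuous_on (sphere 0 \<rho>) (\<lambda>w. norm (\<Phi> w))"
    by (intro continuous_intros holomorphic_on_imp_continuous_on holomorphic_on_subset[OF \<Phi>]) auto
  have "complex_of_real \<rho> \<in> sphere 0 \<rho>" using \<rho> pos by simp
  then have ne: "sphere (0::complex) \<rho> \<noteq> {}" by blast
  obtain w0 where w0: "w0 \<in> sphere 0 \<rho>" "\<And>w. w \<in> sphere 0 \<rho> \<Longrightarrow> norm (\<Phi> w0) \<le> norm (\<Phi> w)"
    using continuous_attains_inf[OF compact_sphere ne cont] by blast
  define \<delta> where "\<delta> = norm (\<Phi> w0)"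
  have \<delta>: "\<delta> > 0" using w0(1) \<rho>(3)[of w0] by (simp add: \<delta>_def)
  have "eventually (\<lambda>n. \<forall>w\<in>sphere 0 \<rho>. dist ((\<F> \<circ> r) n w) (\<Phi> w) < \<delta>/2) sequentially"
    using ulim[OF compact_sphere] \<delta> unfolding uniform_limit_iff by (meson half_gt_zero)
  then obtain N where N: "\<And>n w. n \<ge> N \<Longrightarrow> w \<in> sphere 0 \<rho> \<Longrightarrow> dist (\<F> (r n) w) (\<Phi> w) < \<delta>/2"
    unfolding eventually_sequentially comp_def by blast
  define B where "B = C * exp (a * \<rho>) / (\<delta>/2)"
  have hB: "norm (h (z (r n))) \<le> B" if n: "n \<ge> N" for n
  proof -
    define x where "x = complex_of_real (Re (z (r n)))"
    define \<psi> where "\<psi> w = h (x + w)" for w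
    have "(h \<circ> (\<lambda>w. x + w)) holomorphic_on UNIV"
      by (rule holomorphic_on_compose_gen[of _ UNIV _ UNIV]) (auto intro!: holomorphic_intros h)
    then have hol: "\<psi> holomorphic_on UNIV" by (simp add: \<psi>_def[abs_def] o_def)
    have "norm (\<psi> (z (r n) - x)) \<le> B"
    proof (rule maximum_modulus_frontier[of \<psi> "ball 0 \<rho>"])
      show "\<psi> holomorphic_on interior (ball 0 \<rho>)" by (rule holomorphic_on_subset[OF hol]) auto
      show "continuous_on (closure (ball 0 \<rho>)) \<psi>"
        by (rule holomorphic_on_imp_continuous_on, rule holomorphic_on_subset[OF hol]) auto
      have "z (r n) - x = \<i> * Im (z (r n))" by (simp add: x_def complex_eq_iff)
      then have "norm (z (r n) - x) = \<bar>Im (z (r n))\<bar>" by (simp add: norm_mult)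
      then show "z (r n) - x \<in> ball 0 \<rho>" using strip[of "r n"] \<rho>(1) by simp
      fix w assume "w \<in> frontier (ball (0::complex) \<rho>)"
      then have w: "w \<in> sphere 0 \<rho>" using \<rho>(1) pos by (simp add: frontier_ball)
      have "\<delta> \<le> norm (\<Phi> w)" using w0(2)[OF w] by (simp add: \<delta>_def)
      also have "\<dots> \<le> norm (\<F> (r n) w) + dist (\<F> (r n) w) (\<Phi> w)"
        using norm_triangle_sub[of "\<Phi> w" "\<F> (r n) w"] by (simp add: dist_norm norm_minus_commute)
      finally have "\<delta>/2 \<le> norm (g (x + w))" using N[OF n w] by (simp add: \<F>_def x_def)
      then have "norm (\<psi> w) * (\<delta>/2) \<le> norm (\<psi> w) * norm (g (x + w))" by (rule mult_left_mono) simp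
      also have "\<dots> = norm (f (x + w))" by (simp add: fgh \<psi>_def norm_mult)
      also have "\<dots> \<le> C * exp (a * \<bar>Im w\<bar>)" using upper(1)[of "x + w"] by (simp add: x_def)
      also have "\<dots> \<le> C * exp (a * \<rho>)"
        using abs_Im_le_cmod[of w] w pos by (auto intro!: mult_left_mono)
      finally show "norm (\<psi> w) \<le> B" unfolding B_def using \<delta> by (simp add: field_simps)
    qed simp
    then show ?thesis by (simp add: \<psi>_def)
  qed
  obtain m :: nat where m: "B < m" using reals_Archimedean2 by blast
  define n where "n = max N m"
  have "C / c \<ge> 0" using pos by simp
  moreover have "real m \<le> real (r n)"
    using seq_suble[OF r, of n] by (simp add: n_def)
  ultimately have "B < norm (h (z (r n)))" using z[of "r n"] m by linarith
  moreover have "norm (h (z (r n))) \<le> B" by (rule hB) (simp add: n_def)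
  ultimately show False by simp
qed

lemma entire_quotient_of_common_zeros:
  assumes f: "f holomorphic_on UNIV" "\<exists>z. f z \<noteq> 0" and g: "g holomorphic_on UNIV" "\<exists>z. g z \<noteq> 0"
    and enum: "enumerates_zeros f lam" "enumerates_zeros g lam"
  obtains h where "h holomorphic_on UNIV" "\<And>z. f z = h z * g z"
proof (rule entire_quotient[OF f(1) g(1) f(2) g(2)])
  fix z assume gz: "g z = 0"
  have "{z. f z = 0} = {z. g z = 0}" using enum by (simp add: enumerates_zeros_def)
  then have fz: "f z = 0" using gz by blast
  have "int (card {n. lam n = z}) = zorder f z" "int (card {n. lam n = z}) = zorder g z"
    using enum fz gz unfolding enumerates_zeros_def by blast+
  then show "f z = 0 \<and> zorder f z = zorder g z" using fz by simp
qed (rule that)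

section \<open>Fundamental solutions\<close>

lemma entire_family_cong:
  assumes y: "entire_family T y" and eq: "\<And>x l. x \<in> {0..T} \<Longrightarrow> y' x l = y x l"
  shows "entire_family T y'"
proof -
  obtain Y where Y: "\<And>n. poly_family T (Y n)"
    "\<And>R. uniform_limit ({0..T} \<times> cball 0 R) (\<lambda>n (x,l). Y n x l) (\<lambda>(x,l). y x l) sequentially"
    using y unfolding entire_family_def by blast
  have "uniform_limit ({0..T} \<times> cball 0 R) (\<lambda>n (x,l). Y n x l) (\<lambda>(x,l). y' x l) sequentially" for R
    by (rule uniform_limit_cong'[THEN iffD1, OF _ _ Y(2)[of R]]) (auto simp: eq)
  then show ?thesis unfolding entire_family_def using Y(1) by blast
qed

lemma entire_family_eval:
  assumes y: "entire_family T y" and x: "x \<in> {0..T}"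
  shows "(\<lambda>l. y x l) holomorphic_on UNIV"
  by (rule holomorphic_functional_entire_family[OF y, where \<Lambda>="\<lambda>f. f x" and B=1]) (use x in auto)

context pencil begin

text \<open>
  The chosen solutions of the problem agree on \<open>[0, T]\<close> with the constructed family, by uniqueness, and so inherit
  its dependence on \<open>\<lambda>\<close>.
\<close>

lemma initial_value_solution:
  fixes c0 c1 :: complex and X :: "complex \<Rightarrow> real \<Rightarrow> complex"
  assumes X: "\<And>l. X l = (SOME y. pencil_solution T p q l y \<and> y 0 = c0 \<and> deriv_ivl T y 0 = c1)"
  shows "solves T (W l) (X l) (deriv_ivl T (X l))" "X l 0 = c0" "deriv_ivl T (X l) 0 = c1"
    "entire_family T (\<lambda>x l. X l x)" "entire_family T (\<lambda>x l. deriv_ivl T (X l) x)"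
proof -
  obtain y z where yz: "\<And>l. solves T (W l) (\<lambda>x. y x l) (\<lambda>x. z x l)" "\<And>l. y 0 l = c0" "\<And>l. z 0 l = c1"
    "entire_family T y" "entire_family T z"
    by (rule solution_family_exists[of c0 c1], rule that)
  have z0: "0 \<in> {0..T}" using T_pos by simp
  have ex: "pencil_solution T p q l (\<lambda>x. y x l) \<and> y 0 l = c0 \<and> deriv_ivl T (\<lambda>x. y x l) 0 = c1" for l
    using pencil_solution_of_solves[OF T_pos yz(1)[of l, unfolded W_def[abs_def]]]
      deriv_ivl_eq_of_solves[OF T_pos yz(1) z0, of l] yz(2,3) by simp
  have Xp: "pencil_solution T p q l (X l) \<and> X l 0 = c0 \<and> deriv_ivl T (X l) 0 = c1" for l
    unfolding X by (rule someI[where P="\<lambda>y. pencil_solution T p q l y \<and> y 0 = c0 \<and> deriv_ivl T y 0 = c1", OF ex])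
  have sol: "solves T (W l) (X l) (deriv_ivl T (X l))" for l
    using solves_of_pencil_solution[OF T_pos] Xp by (simp add: W_def[abs_def])
  show "solves T (W l) (X l) (deriv_ivl T (X l))" "X l 0 = c0" "deriv_ivl T (X l) 0 = c1"
    using sol Xp by auto
  have eq: "X l x = y x l" "deriv_ivl T (X l) x = z x l" if "x \<in> {0..T}" for x l
    using solution_unique[OF sol yz(1) z0 _ _ that] Xp yz(2,3) by auto
  show "entire_family T (\<lambda>x l. X l x)" "entire_family T (\<lambda>x l. deriv_ivl T (X l) x)"
    by (rule entire_family_cong[OF yz(4)], simp add: eq, rule entire_family_cong[OF yz(5)], simp add: eq)
qed

abbreviation "Y1 l \<equiv> X1 T p q l"
abbreviation "Y2 l \<equiv> X2 T p q l"
abbreviation "Z1 l \<equiv> deriv_ivl T (X1 T p q l)"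
abbreviation "Z2 l \<equiv> deriv_ivl T (X2 T p q l)"

lemmas Y1 = initial_value_solution[of "X1 T p q", OF X1_def]
lemmas Y2 = initial_value_solution[of "X2 T p q", OF X2_def]

lemma wronskian: "x \<in> {0..T} \<Longrightarrow> Y1 l x * Z2 l x - Z1 l x * Y2 l x = 1"
  using wronskian_constant[OF Y1(1) Y2(1), of x l] Y1(2,3) Y2(2,3) by simp

text \<open>
  The solutions \<open>dir a\<close> and \<open>neu a\<close> have at \<open>a\<close> the data \<open>(0, 1)\<close> and \<open>(1, 0)\<close> respectively; the primed functions are
  their derivatives.
\<close>

definition dir :: "real \<Rightarrow> complex \<Rightarrow> real \<Rightarrow> complex" where
  "dir a l t = Y1 l a * Y2 l t - Y2 l a * Y1 l t"
definition dir' :: "real \<Rightarrow> complex \<Rightarrow> real \<Rightarrow> complex" where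
  "dir' a l t = Y1 l a * Z2 l t - Y2 l a * Z1 l t"
definition neu :: "real \<Rightarrow> complex \<Rightarrow> real \<Rightarrow> complex" where
  "neu a l t = Z2 l a * Y1 l t - Z1 l a * Y2 l t"
definition neu' :: "real \<Rightarrow> complex \<Rightarrow> real \<Rightarrow> complex" where
  "neu' a l t = Z2 l a * Z1 l t - Z1 l a * Z2 l t"

lemma solves_dir: "solves T (W l) (dir a l) (dir' a l)"
  using solves_lincomb[OF Y2(1) Y1(1), of l "Y1 l a" "- Y2 l a"] by (simp add: dir_def[abs_def] dir'_def[abs_def])

lemma solves_neu: "solves T (W l) (neu a l) (neu' a l)"
  using solves_lincomb[OF Y1(1) Y2(1), of l "Z2 l a" "- Z1 l a"] by (simp add: neu_def[abs_def] neu'_def[abs_def])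

lemma base_values:
  assumes "a \<in> {0..T}"
  shows "dir a l a = 0" "dir' a l a = 1" "neu a l a = 1" "neu' a l a = 0"
  using wronskian[OF assms, of l] by (simp_all add: dir_def dir'_def neu_def neu'_def algebra_simps)

lemma wronskian_dir_neu:
  assumes a: "a \<in> {0..T}" and x: "x \<in> {0..T}"
  shows "dir' a l x * neu a l x - dir a l x * neu' a l x = 1"
proof -
  have "dir' a l x * neu a l x - dir a l x * neu' a l x
      = (Y1 l a * Z2 l a - Z1 l a * Y2 l a) * (Y1 l x * Z2 l x - Z1 l x * Y2 l x)"
    by (simp add: dir_def dir'_def neu_def neu'_def algebra_simps)
  then show ?thesis using wronskian[OF a] wronskian[OF x] by simp
qed

lemma change_base:
  assumes a: "a \<in> {0..T}"
  shows "dir b l t = neu a l b * dir a l t + (- dir a l b) * neu a l t"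
    and "neu b l t = (- neu' a l b) * dir a l t + dir' a l b * neu a l t"
proof -
  have "neu a l b * dir a l t + (- dir a l b) * neu a l t = (Y1 l a * Z2 l a - Z1 l a * Y2 l a) * dir b l t"
    "(- neu' a l b) * dir a l t + dir' a l b * neu a l t = (Y1 l a * Z2 l a - Z1 l a * Y2 l a) * neu b l t"
    by (simp_all add: dir_def dir'_def neu_def neu'_def algebra_simps)
  then show "dir b l t = neu a l b * dir a l t + (- dir a l b) * neu a l t"
    "neu b l t = (- neu' a l b) * dir a l t + dir' a l b * neu a l t"
    using wronskian[OF a] by simp_all
qed

lemma holomorphic_dir_neu:
  assumes "a \<in> {0..T}" "x \<in> {0..T}"
  shows "(\<lambda>l. dir a l x) holomorphic_on UNIV" "(\<lambda>l. neu a l x) holomorphic_on UNIV"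
  unfolding dir_def neu_def
  using assms by (auto intro!: holomorphic_intros entire_family_eval[OF Y1(4)] entire_family_eval[OF Y1(5)]
      entire_family_eval[OF Y2(4)] entire_family_eval[OF Y2(5)])

end

section \<open>The nonlocal functional on solutions\<close>

locale nonlocal_pencil = pencil T p q + st: stieltjes 0 T s v
  for T :: real and p q s :: "real \<Rightarrow> complex" and v :: "real \<Rightarrow> real" +
  fixes H :: complex
  assumes jump: "((\<lambda>t. s t - s 0) \<longlongrightarrow> H) (at_right 0)" and H_nz: "H \<noteq> 0"
begin

abbreviation U :: "real \<Rightarrow> (real \<Rightarrow> complex) \<Rightarrow> complex" where "U a y \<equiv> stieltjes_integral 0 a s y"

definition Udir :: "real \<Rightarrow> complex \<Rightarrow> complex" where "Udir a l = U a (dir a l)"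
definition Uneu :: "real \<Rightarrow> complex \<Rightarrow> complex" where "Uneu a l = U a (neu a l)"

lemma stieltjes_initial: "a \<in> {0..T} \<Longrightarrow> stieltjes 0 a s v"
  by (rule stieltjes_subinterval[OF st.stieltjes_axioms]) auto

lemma solution_cont:
  assumes "solves T (W l) y z" "a \<le> T" "0 \<le> b" shows "continuous_on {b..a} y"
  by (rule continuous_on_subset[OF solves_continuous(1)[OF assms(1)]]) (use assms in auto)

lemma U_solution_bound:
  assumes s: "solves T (W l) y z" and a: "a \<in> {0..T}" and M: "\<And>t. t \<in> {0..a} \<Longrightarrow> norm (y t) \<le> M"
  shows "norm (U a y) \<le> (v T - v 0) * M"
proof -
  interpret sa: stieltjes 0 a s v by (rule stieltjes_initial[OF a])
  have M0: "M \<ge> 0" using order_trans[OF norm_ge_zero M[of 0]] a by simp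
  have "norm (U a y) \<le> (v a - v 0) * M"
    by (rule sa.int_bound[OF solution_cont[OF s]]) (use a M in auto)
  also have "\<dots> \<le> (v T - v 0) * M"
    using st.v_mono[of a T] a M0 by (intro mult_right_mono) auto
  finally show ?thesis .
qed

lemma total_nonneg: "v T - v 0 \<ge> 0" using st.v_mono[of 0 T] T_pos by simp

lemma U_lincomb:
  assumes 1: "solves T (W l) y1 z1" and 2: "solves T (W l) y2 z2" and a: "a \<in> {0..T}"
  shows "U a (\<lambda>x. c * y1 x + d * y2 x) = c * U a y1 + d * U a y2"
proof -
  interpret sa: stieltjes 0 a s v by (rule stieltjes_initial[OF a])
  show ?thesis by (rule sa.int_lincomb) (use solution_cont[OF 1] solution_cont[OF 2] a in auto)
qed

lemma holomorphic_U:
  assumes y: "entire_family T y" and a: "a \<in> {0..T}"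
  shows "(\<lambda>l. U a (\<lambda>x. y x l)) holomorphic_on UNIV"
proof -
  interpret sa: stieltjes 0 a s v by (rule stieltjes_initial[OF a])
  have c: "continuous_on {0..a} f" if "continuous_on {0..T} f" for f :: "real \<Rightarrow> complex"
    by (rule continuous_on_subset[OF that]) (use a in auto)
  show ?thesis
  proof (rule holomorphic_functional_entire_family[OF y, where B="v a - v 0"])
    show "norm (U a f) \<le> (v a - v 0) * M" if "continuous_on {0..T} f" "\<And>x. x \<in> {0..T} \<Longrightarrow> norm (f x) \<le> M" for f M
      by (rule sa.int_bound[OF c[OF that(1)]]) (use that(2) a in auto)
  qed (auto intro: sa.int_add sa.int_mult c)
qed

lemma Udir_Uneu_expand:
  assumes a: "a \<in> {0..T}"
  shows "Udir a l = Y1 l a * U a (Y2 l) - Y2 l a * U a (Y1 l)"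
    and "Uneu a l = Z2 l a * U a (Y1 l) - Z1 l a * U a (Y2 l)"
  using U_lincomb[OF Y2(1)[of l] Y1(1)[of l] a, where c="Y1 l a" and d="- Y2 l a"]
    U_lincomb[OF Y1(1)[of l] Y2(1)[of l] a, where c="Z2 l a" and d="- Z1 l a"]
  by (simp_all add: Udir_def Uneu_def dir_def[abs_def] neu_def[abs_def])

lemma holomorphic_Udir_Uneu:
  assumes a: "a \<in> {0..T}"
  shows "Udir a holomorphic_on UNIV" "Uneu a holomorphic_on UNIV"
proof -
  have "(\<lambda>l. Udir a l) holomorphic_on UNIV" "(\<lambda>l. Uneu a l) holomorphic_on UNIV"
    unfolding Udir_Uneu_expand[OF a]
    by (intro holomorphic_intros entire_family_eval[OF Y1(4) a] entire_family_eval[OF Y1(5) a]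
      entire_family_eval[OF Y2(4) a] entire_family_eval[OF Y2(5) a] holomorphic_U[OF Y1(4) a] holomorphic_U[OF Y2(4) a])+
  then show "Udir a holomorphic_on UNIV" "Uneu a holomorphic_on UNIV" by simp_all
qed

lemma solution_le:
  assumes s: "solves T (W l) y z" and l: "norm l \<ge> 1" and a: "a \<in> {0..T}" and t: "t \<in> {0..T}"
  shows "norm l * norm (y t) \<le> growth_C * exp (\<bar>Im l\<bar> * \<bar>t - a\<bar>) * (norm (z a) + norm l * norm (y a))"
  using growth_bound[OF s l a t] norm_ge_zero[of "z t"] by linarith

text \<open>
  Combines the two concentration effects. With \<open>n\<close> the size of the data at \<open>a\<close>, the error is at most
  \<open>2 E C (e1 + V exp (- \<tau> \<eta>)) n\<close> from replacing \<open>U\<close> by its jump part and \<open>\<bar>H\<bar> D n / \<tau>\<close> from the asymptotics of \<open>y 0\<close>;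
  \<open>e1\<close>, \<open>\<eta>\<close> and then \<open>K\<close> are chosen so that each of the three terms is at most \<open>\<epsilon> n / 3\<close>.
\<close>

theorem U_asymptotics:
  assumes a: "0 < a" "a \<le> T" and e: "\<epsilon> > 0"
  obtains K where "K \<ge> 1"
    "\<And>l y z. solves T (W l) y z \<Longrightarrow> \<bar>Im l\<bar> \<ge> K \<Longrightarrow>
      norm (2 * sgn (Im l) * \<i> * l * U a y * wave a l - H * (z a + sgn (Im l) * \<i> * l * y a))
        \<le> \<epsilon> * (norm (z a) + norm l * norm (y a))"
proof -
  define C where "C = growth_C"
  note C = growth_C_ge_1[folded C_def]
  obtain D where D: "D > 0"
    "\<And>l y z. solves T (W l) y z \<Longrightarrow> \<bar>Im l\<bar> \<ge> 1 \<Longrightarrow>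
      norm (2 * sgn (Im l) * \<i> * l * y 0 * wave a l - (z a + sgn (Im l) * \<i> * l * y a))
        \<le> D / \<bar>Im l\<bar> * (norm (z a) + norm l * norm (y a))"
    by (rule asymptotics[OF a], rule that)
  define E where "E = exp (norm (P a))"
  define V where "V = v T - v 0"
  define e1 where "e1 = \<epsilon> / (6 * E * C)"
  have E: "E > 0" by (simp add: E_def)
  have V: "V \<ge> 0" using total_nonneg by (simp add: V_def)
  have e1: "e1 > 0" using e E C by (simp add: e1_def)
  obtain \<eta> where \<eta>: "0 < \<eta>" "\<eta> < a" "\<eta> \<le> T"
    "\<And>a (y :: real \<Rightarrow> complex) M m. \<eta> \<le> a \<Longrightarrow> a \<le> T \<Longrightarrow> continuous_on {0..a} y \<Longrightarrow> \<forall>t\<in>{0..a}. norm (y t) \<le> M \<Longrightarrow>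
       \<forall>t\<in>{\<eta>..a}. norm (y t) \<le> m \<Longrightarrow>
       norm (stieltjes_integral 0 a s y - H * y 0) \<le> e1 * M + (v T - v 0) * m"
    by (rule stieltjes_integral_jump_dominates[OF st.stieltjes_axioms T_pos jump e1 a(1)], rule that, assumption, assumption, assumption, blast)
  define K where "K = 1 + 6 * E * C * V / (\<eta> * \<epsilon>) + 3 * norm H * D / \<epsilon>"
  have K1: "K \<ge> 1" unfolding K_def using E C V \<eta>(1) e D(1) by simp
  have main: "norm (2 * sgn (Im l) * \<i> * l * U a y * wave a l - H * (z a + sgn (Im l) * \<i> * l * y a))
        \<le> \<epsilon> * (norm (z a) + norm l * norm (y a))"
    if s: "solves T (W l) y z" and l: "\<bar>Im l\<bar> \<ge> K" for l y z
  proof -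
    define \<tau> where "\<tau> = \<bar>Im l\<bar>"
    have \<tau>: "\<tau> \<ge> K" "\<tau> \<ge> 1" "\<tau> > 0" using l K1 by (auto simp: \<tau>_def)
    have l1: "norm l \<ge> 1" using \<tau> abs_Im_le_cmod[of l] by (simp add: \<tau>_def)
    then have l0: "norm l > 0" by linarith
    define \<sigma> where "\<sigma> = sgn (Im l)"
    have \<sigma>1: "\<sigma> = 1 \<or> \<sigma> = -1" using \<tau>(3) by (auto simp: \<sigma>_def \<tau>_def sgn_if)
    define n where "n = norm (z a) + norm l * norm (y a)"
    have n0: "n \<ge> 0" by (simp add: n_def)
    define X where "X = C * exp (\<tau> * a) * n / norm l"
    have X0: "X \<ge> 0" using C n0 by (simp add: X_def)
    have yt: "norm (y t) \<le> C * exp (\<tau> * (a - t)) * n / norm l" if t: "t \<in> {0..a}" for t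
    proof -
      have "\<bar>t - a\<bar> = a - t" using t by auto
      then have "norm l * norm (y t) \<le> C * exp (\<tau> * (a - t)) * n"
        using solution_le[OF s l1, of a t] a t by (simp add: n_def \<tau>_def C_def)
      then show ?thesis using l0 by (simp add: field_simps)
    qed
    have mono: "C * exp (\<tau> * u) * n / norm l \<le> C * exp (\<tau> * w) * n / norm l" if "u \<le> w" for u w
      using that \<tau> C n0 by (intro divide_right_mono mult_right_mono mult_left_mono) auto
    have Ub: "norm (U a y - H * y 0) \<le> e1 * X + V * (exp (- (\<tau> * \<eta>)) * X)"
      unfolding V_def
    proof (rule \<eta>(4))
      show "continuous_on {0..a} y" by (rule solution_cont[OF s a(2)]) simp
      show "\<forall>t\<in>{0..a}. norm (y t) \<le> X"
      proof
        fix t assume t: "t \<in> {0..a}"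
        show "norm (y t) \<le> X"
          unfolding X_def using yt[OF t] mono[of "a - t" a] t by simp
      qed
      show "\<forall>t\<in>{\<eta>..a}. norm (y t) \<le> exp (- (\<tau> * \<eta>)) * X"
      proof
        fix t assume t: "t \<in> {\<eta>..a}"
        have "norm (y t) \<le> C * exp (\<tau> * (a - \<eta>)) * n / norm l"
          using yt[of t] mono[of "a - t" "a - \<eta>"] t \<eta>(1) by simp
        also have "exp (\<tau> * (a - \<eta>)) = exp (- (\<tau> * \<eta>)) * exp (\<tau> * a)"
          by (simp add: algebra_simps flip: exp_add)
        finally show "norm (y t) \<le> exp (- (\<tau> * \<eta>)) * X" by (simp add: X_def algebra_simps)
      qed
    qed (use a \<eta> in auto)
    have exn: "norm (wave a l) \<le> E * exp (- (\<tau> * a))"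
      using norm_wave_le[of a l] by (simp add: E_def \<tau>_def)
    have bound1: "norm (2 * \<sigma> * \<i> * l * (U a y - H * y 0) * (wave a l)) \<le> 2 * \<epsilon> / 3 * n"
    proof -
      have "norm (2 * \<sigma> * \<i> * l * (U a y - H * y 0) * (wave a l)) = 2 * norm l * norm (U a y - H * y 0) * norm (wave a l)"
        using \<sigma>1(1) by (auto simp: norm_mult)
      also have "\<dots> \<le> 2 * norm l * (e1 * X + V * (exp (- (\<tau> * \<eta>)) * X)) * (E * exp (- (\<tau> * a)))"
        using Ub exn by (intro mult_mono mult_nonneg_nonneg add_nonneg_nonneg) (use e1 X0 V in auto)
      also have "\<dots> = 2 * E * C * (e1 + V * exp (- (\<tau> * \<eta>))) * n"
      proof -
        have "norm l * X * exp (- (\<tau> * a)) = C * n * (exp (\<tau> * a) * exp (- (\<tau> * a)))" using l0 by (simp add: X_def)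
        also have "exp (\<tau> * a) * exp (- (\<tau> * a)) = 1" by (simp flip: exp_add)
        finally have *: "norm l * X * exp (- (\<tau> * a)) = C * n" by simp
        have "2 * norm l * (e1 * X + V * (exp (- (\<tau> * \<eta>)) * X)) * (E * exp (- (\<tau> * a)))
           = 2 * E * (e1 + V * exp (- (\<tau> * \<eta>))) * (norm l * X * exp (- (\<tau> * a)))" by (simp add: algebra_simps)
        then show ?thesis unfolding * by (simp add: algebra_simps)
      qed
      also have "\<dots> \<le> (2 * \<epsilon> / 3) * n"
      proof (rule mult_right_mono[OF _ n0])
        have 1: "2 * E * C * e1 = \<epsilon> / 3" using E C by (simp add: e1_def)
        have "exp (- (\<tau> * \<eta>)) \<le> inverse (\<tau> * \<eta>)"
        proof -
          have "\<tau> * \<eta> \<le> exp (\<tau> * \<eta>)" using exp_ge_add_one_self[of "\<tau> * \<eta>"] by linarith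
          then have "inverse (exp (\<tau> * \<eta>)) \<le> inverse (\<tau> * \<eta>)" using \<tau> \<eta>(1) by (intro le_imp_inverse_le) auto
          then show ?thesis by (simp add: exp_minus)
        qed
        then have "2 * E * C * (V * exp (- (\<tau> * \<eta>))) \<le> 2 * E * C * (V * inverse (\<tau> * \<eta>))"
          using E C V by (intro mult_left_mono) auto
        also have "\<dots> \<le> \<epsilon> / 3"
        proof -
          have "6 * E * C * V / (\<eta> * \<epsilon>) \<le> \<tau>" using \<tau>(1) D(1) e unfolding K_def by (smt (verit) divide_nonneg_pos mult_nonneg_nonneg norm_ge_zero)
          then have "6 * E * C * V \<le> \<tau> * (\<eta> * \<epsilon>)" using \<eta>(1) e by (simp add: pos_divide_le_eq)
          then show ?thesis using \<tau>(3) \<eta>(1) by (simp add: field_simps)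
        qed
        finally show "2 * E * C * (e1 + V * exp (- (\<tau> * \<eta>))) \<le> 2 * \<epsilon> / 3" using 1 by (simp add: distrib_left)
      qed
      finally show ?thesis .
    qed
    have bound2: "norm (H * (2 * \<sigma> * \<i> * l * y 0 * (wave a l) - (z a + \<sigma> * \<i> * l * y a))) \<le> \<epsilon> / 3 * n"
    proof -
      have "norm (H * (2 * \<sigma> * \<i> * l * y 0 * (wave a l) - (z a + \<sigma> * \<i> * l * y a))) \<le> norm H * (D / \<tau> * n)"
        unfolding norm_mult[of H] n_def \<tau>_def using D(2)[OF s, folded \<sigma>_def] \<tau> by (intro mult_left_mono) (auto simp: \<tau>_def)
      also have "\<dots> = (norm H * D / \<tau>) * n" by simp
      also have "\<dots> \<le> \<epsilon> / 3 * n"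
      proof (rule mult_right_mono[OF _ n0])
        have "3 * norm H * D / \<epsilon> \<le> \<tau>" using \<tau>(1) E C V \<eta>(1) e unfolding K_def
          by (smt (verit) divide_nonneg_pos mult_nonneg_nonneg mult_pos_pos)
        then show "norm H * D / \<tau> \<le> \<epsilon> / 3" using e \<tau>(3) by (simp add: field_simps)
      qed
      finally show ?thesis .
    qed
    have "2 * \<sigma> * \<i> * l * U a y * (wave a l) - H * (z a + \<sigma> * \<i> * l * y a)
       = 2 * \<sigma> * \<i> * l * (U a y - H * y 0) * (wave a l) + H * (2 * \<sigma> * \<i> * l * y 0 * (wave a l) - (z a + \<sigma> * \<i> * l * y a))"
      by (simp add: algebra_simps)
    also have "norm \<dots> \<le> 2 * \<epsilon> / 3 * n + \<epsilon> / 3 * n"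
      by (rule norm_triangle_le[OF add_mono[OF bound1 bound2]])
    also have "\<dots> = \<epsilon> * n" by (simp add: algebra_simps)
    finally show ?thesis by (simp add: n_def \<sigma>_def)
  qed
  show ?thesis by (rule that[of K], rule K1, rule main)
qed

lemma Udir_Uneu_asymptotics:
  assumes a: "0 < a" "a \<le> T" and e: "\<epsilon> > 0"
  obtains K where "K \<ge> 1"
    "\<And>l. \<bar>Im l\<bar> \<ge> K \<Longrightarrow> norm (2 * sgn (Im l) * \<i> * l * Udir a l * wave a l - H) \<le> \<epsilon> \<and>
      norm (2 * Uneu a l * wave a l - H) \<le> \<epsilon>"
proof -
  obtain K where K: "K \<ge> 1"
    "\<And>l y z. solves T (W l) y z \<Longrightarrow> \<bar>Im l\<bar> \<ge> K \<Longrightarrow>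
      norm (2 * sgn (Im l) * \<i> * l * U a y * wave a l - H * (z a + sgn (Im l) * \<i> * l * y a))
        \<le> \<epsilon> * (norm (z a) + norm l * norm (y a))"
    by (rule U_asymptotics[OF a e], rule that)
  have aT: "a \<in> {0..T}" using a by auto
  have "norm (2 * sgn (Im l) * \<i> * l * Udir a l * wave a l - H) \<le> \<epsilon> \<and> norm (2 * Uneu a l * wave a l - H) \<le> \<epsilon>"
    if l: "\<bar>Im l\<bar> \<ge> K" for l
  proof
    define \<sigma> where "\<sigma> = complex_of_real (sgn (Im l))"
    show "norm (2 * sgn (Im l) * \<i> * l * Udir a l * wave a l - H) \<le> \<epsilon>"
      using K(2)[OF solves_dir l, of a] by (simp add: base_values[OF aT] Udir_def)
    have "Im l \<noteq> 0" using l K(1) by auto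
    then have l0: "norm l > 0" and \<sigma>1: "norm \<sigma> = 1" by (auto simp: \<sigma>_def sgn_if)
    have "norm (2 * \<sigma> * \<i> * l * Uneu a l * wave a l - H * (\<sigma> * \<i> * l)) \<le> \<epsilon> * norm l"
      using K(2)[OF solves_neu l, of a] by (simp add: base_values[OF aT] Uneu_def \<sigma>_def)
    moreover have "2 * \<sigma> * \<i> * l * Uneu a l * wave a l - H * (\<sigma> * \<i> * l) = (\<sigma> * \<i> * l) * (2 * Uneu a l * wave a l - H)"
      by (simp add: algebra_simps)
    ultimately have "norm l * norm (2 * Uneu a l * wave a l - H) \<le> norm l * \<epsilon>"
      by (simp only: norm_mult \<sigma>1 norm_ii mult_1 mult.commute[of \<epsilon>])
    then show "norm (2 * Uneu a l * wave a l - H) \<le> \<epsilon>" using l0 by simp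
  qed
  then show ?thesis using that[of K] K(1) by blast
qed

lemma Udir_Uneu_lower:
  assumes a: "0 < a" "a \<le> T"
  obtains K c where "K \<ge> 1" "c > 0"
    "\<And>l. \<bar>Im l\<bar> \<ge> K \<Longrightarrow> norm (l * Udir a l) \<ge> c * exp (a * \<bar>Im l\<bar>) \<and> norm (Uneu a l) \<ge> c * exp (a * \<bar>Im l\<bar>)"
proof -
  have H2: "norm H / 2 > 0" using H_nz by simp
  obtain K where K: "K \<ge> 1"
    "\<And>l. \<bar>Im l\<bar> \<ge> K \<Longrightarrow> norm (2 * sgn (Im l) * \<i> * l * Udir a l * wave a l - H) \<le> norm H / 2 \<and>
      norm (2 * Uneu a l * wave a l - H) \<le> norm H / 2"
    by (rule Udir_Uneu_asymptotics[OF a H2], rule that)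
  define E where "E = exp (norm (P a))"
  define c where "c = norm H / (4 * E)"
  have c: "c > 0" using H_nz by (simp add: c_def E_def)
  have "norm (l * Udir a l) \<ge> c * exp (a * \<bar>Im l\<bar>) \<and> norm (Uneu a l) \<ge> c * exp (a * \<bar>Im l\<bar>)"
    if l: "\<bar>Im l\<bar> \<ge> K" for l
  proof -
    have low: "norm X \<ge> c * exp (a * \<bar>Im l\<bar>)" if X: "norm (2 * X * wave a l - H) \<le> norm H / 2" for X
    proof -
      have "norm H / 2 \<le> norm (2 * X * wave a l)"
        using X norm_triangle_sub[of H "2 * X * wave a l"] by (simp add: norm_minus_commute)
      also have "\<dots> = 2 * norm X * norm (wave a l)" by (simp add: norm_mult)
      also have "\<dots> \<le> 2 * norm X * (E * exp (- (\<bar>Im l\<bar> * a)))"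
        unfolding E_def by (rule mult_left_mono[OF norm_wave_le]) simp
      finally have "norm H / 2 * exp (a * \<bar>Im l\<bar>) \<le> 2 * norm X * (E * exp (- (\<bar>Im l\<bar> * a))) * exp (a * \<bar>Im l\<bar>)"
        by (rule mult_right_mono) simp
      also have "\<dots> = 2 * norm X * E * (exp (- (\<bar>Im l\<bar> * a)) * exp (a * \<bar>Im l\<bar>))" by (simp only: mult.assoc)
      also have "exp (- (\<bar>Im l\<bar> * a)) * exp (a * \<bar>Im l\<bar>) = 1" by (simp add: mult.commute flip: exp_add)
      finally show ?thesis by (simp add: c_def E_def field_simps)
    qed
    have "norm (sgn (Im l) * \<i> * (l * Udir a l)) \<ge> c * exp (a * \<bar>Im l\<bar>)"
      by (rule low) (use K(2)[OF l] in \<open>simp add: mult.assoc\<close>)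
    moreover have "norm (sgn (Im l) * \<i> * (l * Udir a l)) = norm (l * Udir a l)"
      using l K(1) by (auto simp: norm_mult sgn_if)
    moreover have "norm (Uneu a l) \<ge> c * exp (a * \<bar>Im l\<bar>)" by (rule low) (use K(2)[OF l] in simp)
    ultimately show ?thesis by simp
  qed
  then show ?thesis using that[of K c] K(1) c by blast
qed

lemma Udir_Uneu_upper:
  assumes a: "a \<in> {0..T}"
  obtains C where "C > 0" "\<And>l. norm (l * Udir a l) \<le> C * exp (a * \<bar>Im l\<bar>)" "\<And>l. norm (Uneu a l) \<le> C * exp (a * \<bar>Im l\<bar>)"
proof -
  define C0 where "C0 = growth_C"
  note C0 = growth_C_ge_1[folded C0_def]
  have big: "norm (U a y) \<le> (v T - v 0) * (C0 * exp (a * \<bar>Im l\<bar>) * (norm (z a) + norm l * norm (y a)) / norm l)"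
    if s: "solves T (W l) y z" and l: "norm l \<ge> 1" for l y z
  proof (rule U_solution_bound[OF s a])
    fix t assume t: "t \<in> {0..a}"
    have "norm l * norm (y t) \<le> C0 * exp (\<bar>Im l\<bar> * \<bar>t - a\<bar>) * (norm (z a) + norm l * norm (y a))"
      using solution_le[OF s l a, of t] t a by (simp add: C0_def)
    also have "\<dots> \<le> C0 * exp (a * \<bar>Im l\<bar>) * (norm (z a) + norm l * norm (y a))"
    proof -
      have "\<bar>Im l\<bar> * \<bar>t - a\<bar> \<le> a * \<bar>Im l\<bar>" using t by (subst mult.commute) (intro mult_right_mono, auto)
      then show ?thesis using C0 by (intro mult_right_mono mult_left_mono) auto
    qed
    finally have "norm l * norm (y t) \<le> C0 * exp (a * \<bar>Im l\<bar>) * (norm (z a) + norm l * norm (y a))" .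
    then have lb: "norm (y t) * norm l \<le> C0 * exp (a * \<bar>Im l\<bar>) * (norm (z a) + norm l * norm (y a))"
      by (subst mult.commute)
    show "norm (y t) \<le> C0 * exp (a * \<bar>Im l\<bar>) * (norm (z a) + norm l * norm (y a)) / norm l"
    proof -
      have l0: "norm l > 0" using l by linarith
      show ?thesis unfolding pos_le_divide_eq[OF l0] by (rule lb)
    qed
  qed
  have cont: "continuous_on (cball 0 1) (\<lambda>l. l * Udir a l)" "continuous_on (cball 0 1) (Uneu a)"
  proof -
    have "(\<lambda>l. l * Udir a l) holomorphic_on UNIV" by (intro holomorphic_intros holomorphic_Udir_Uneu[OF a])
    then show "continuous_on (cball 0 1) (\<lambda>l. l * Udir a l)" "continuous_on (cball 0 1) (Uneu a)"
      using holomorphic_Udir_Uneu[OF a] holomorphic_on_imp_continuous_on continuous_on_subset by blast+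
  qed
  have "bounded ((\<lambda>l. l * Udir a l) ` cball 0 1)" "bounded (Uneu a ` cball 0 1)"
    using cont by (auto intro!: compact_imp_bounded compact_continuous_image)
  then obtain B1 B2 where B: "\<And>l. norm l \<le> 1 \<Longrightarrow> norm (l * Udir a l) \<le> B1" "\<And>l. norm l \<le> 1 \<Longrightarrow> norm (Uneu a l) \<le> B2"
    unfolding bounded_iff by (metis imageI mem_cball_0)
  define C where "C = (v T - v 0) * C0 + \<bar>B1\<bar> + \<bar>B2\<bar> + 1"
  have VC: "(v T - v 0) * C0 \<ge> 0" using total_nonneg C0 by simp
  have C: "C > 0" using VC by (simp add: C_def)
  have up: "norm (l * Udir a l) \<le> C * exp (a * \<bar>Im l\<bar>) \<and> norm (Uneu a l) \<le> C * exp (a * \<bar>Im l\<bar>)" for l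
  proof (cases "norm l \<ge> 1")
    case True
    then have l0: "norm l > 0" by linarith
    have CC: "(v T - v 0) * C0 * exp (a * \<bar>Im l\<bar>) \<le> C * exp (a * \<bar>Im l\<bar>)"
      by (intro mult_right_mono) (auto simp: C_def)
    have "norm (Udir a l) \<le> (v T - v 0) * (C0 * exp (a * \<bar>Im l\<bar>) / norm l)"
      using big[OF solves_dir True, of a] by (simp add: base_values[OF a] Udir_def)
    then have "norm l * norm (Udir a l) \<le> norm l * ((v T - v 0) * (C0 * exp (a * \<bar>Im l\<bar>) / norm l))"
      by (rule mult_left_mono) simp
    then have 1: "norm (l * Udir a l) \<le> (v T - v 0) * C0 * exp (a * \<bar>Im l\<bar>)"
      using l0 by (simp add: norm_mult)
    have "norm (Uneu a l) \<le> (v T - v 0) * C0 * exp (a * \<bar>Im l\<bar>)"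
      using big[OF solves_neu True, of a] l0 by (simp add: base_values[OF a] Uneu_def)
    then show ?thesis using 1 CC by linarith
  next
    case False
    have "exp (a * \<bar>Im l\<bar>) \<ge> 1" using a by simp
    then have "C * 1 \<le> C * exp (a * \<bar>Im l\<bar>)" using C by (intro mult_left_mono) auto
    then have "C \<le> C * exp (a * \<bar>Im l\<bar>)" by simp
    moreover have "norm (l * Udir a l) \<le> C" "norm (Uneu a l) \<le> C"
      using B[of l] False VC by (auto simp: C_def)
    ultimately show ?thesis by linarith
  qed
  show ?thesis using that[of C] C up by blast
qed

lemma dir_neu_le:
  assumes l: "norm l \<ge> 1" and a: "a \<in> {0..T}" and x: "x \<in> {0..T}"
  shows "norm l * norm (dir a l x) \<le> growth_C * exp (\<bar>Im l\<bar> * \<bar>x - a\<bar>)"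
    and "norm (neu a l x) \<le> growth_C * exp (\<bar>Im l\<bar> * \<bar>x - a\<bar>)"
proof -
  show "norm l * norm (dir a l x) \<le> growth_C * exp (\<bar>Im l\<bar> * \<bar>x - a\<bar>)"
    using solution_le[OF solves_dir[of l a] l a x] by (simp add: base_values[OF a])
  have "norm l > 0" using l by linarith
  moreover have "norm l * norm (neu a l x) \<le> norm l * (growth_C * exp (\<bar>Im l\<bar> * \<bar>x - a\<bar>))"
    using solution_le[OF solves_neu[of l a] l a x] by (simp add: base_values[OF a] mult_ac)
  ultimately show "norm (neu a l x) \<le> growth_C * exp (\<bar>Im l\<bar> * \<bar>x - a\<bar>)" by (simp only: mult_le_cancel_left_pos)
qed

text \<open>
  The combination is the value of the functional at the solution with data \<open>(0, 1)\<close> at \<open>x\<close>. The bound \<open>\<bar>t - x\<bar> \<le> x\<close>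
  for \<open>t \<in> [0, a]\<close> is where \<open>x \<ge> a/2\<close> enters.
\<close>

lemma weyl_solution_le:
  assumes l: "norm l \<ge> 1" and a: "a \<in> {0..T}" and x: "x \<in> {a/2..a}"
  shows "norm l * norm (neu a l x * Udir a l - dir a l x * Uneu a l) \<le> (v T - v 0) * (growth_C * exp (\<bar>Im l\<bar> * x))"
proof -
  have xT: "x \<in> {0..T}" using a x by auto
  have l0: "norm l > 0" using l by linarith
  let ?y = "\<lambda>t. neu a l x * dir a l t + (- dir a l x) * neu a l t"
  let ?z = "\<lambda>t. neu a l x * dir' a l t + (- dir a l x) * neu' a l t"
  have sol: "solves T (W l) ?y ?z" by (rule solves_lincomb[OF solves_dir solves_neu])
  have x1: "?z x = 1" using wronskian_dir_neu[OF a xT, of l] by (simp add: algebra_simps)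
  have x0: "?y x = 0" by simp
  have "norm (U a ?y) \<le> (v T - v 0) * (growth_C * exp (\<bar>Im l\<bar> * x) / norm l)"
  proof (rule U_solution_bound[OF sol a])
    fix t assume t: "t \<in> {0..a}"
    then have tT: "t \<in> {0..T}" using a by auto
    have "norm l * norm (?y t) \<le> growth_C * exp (\<bar>Im l\<bar> * \<bar>t - x\<bar>)"
      using solution_le[OF sol l xT tT] unfolding x0 x1 by simp
    also have "\<dots> \<le> growth_C * exp (\<bar>Im l\<bar> * x)"
    proof -
      have "\<bar>t - x\<bar> \<le> x" using t x by auto
      then show ?thesis using growth_C_ge_1 by (intro mult_left_mono) (auto intro!: mult_left_mono)
    qed
    finally show "norm (?y t) \<le> growth_C * exp (\<bar>Im l\<bar> * x) / norm l" using l0 by (simp add: field_simps)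
  qed
  moreover have "U a ?y = neu a l x * Udir a l - dir a l x * Uneu a l"
    using U_lincomb[OF solves_dir[of l a] solves_neu[of l a] a, where c="neu a l x" and d="- dir a l x"]
    by (simp add: Udir_def Uneu_def)
  ultimately have "norm (neu a l x * Udir a l - dir a l x * Uneu a l) \<le> (v T - v 0) * (growth_C * exp (\<bar>Im l\<bar> * x) / norm l)"
    by (simp only:)
  then have "norm l * norm (neu a l x * Udir a l - dir a l x * Uneu a l) \<le> norm l * ((v T - v 0) * (growth_C * exp (\<bar>Im l\<bar> * x) / norm l))"
    by (rule mult_left_mono) simp
  also have "\<dots> = (v T - v 0) * (growth_C * exp (\<bar>Im l\<bar> * x))" using l0 by simp
  finally show ?thesis .
qed

lemma Delta_eq: "Delta1 T s p q l = - Udir T l" "Delta11 T s p q l = Uneu T l"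
  using Udir_Uneu_expand[of T l] T_pos
  by (simp_all add: Delta1_def Delta11_def U1_def V1_def V2_def algebra_simps)

end

section \<open>Uniqueness\<close>

lemma (in nonlocal_pencil) Udir_Uneu_change_base:
  assumes a: "a \<in> {0..T}" and b: "b \<in> {0..T}"
  shows "Udir b l = neu a l b * U b (dir a l) + (- dir a l b) * U b (neu a l)"
    and "Uneu b l = (- neu' a l b) * U b (dir a l) + dir' a l b * U b (neu a l)"
proof -
  have e: "dir b l = (\<lambda>t. neu a l b * dir a l t + (- dir a l b) * neu a l t)"
    "neu b l = (\<lambda>t. (- neu' a l b) * dir a l t + dir' a l b * neu a l t)"
    by (rule ext, rule change_base[OF a])+
  show "Udir b l = neu a l b * U b (dir a l) + (- dir a l b) * U b (neu a l)"
    unfolding Udir_def by (subst e(1)) (rule U_lincomb[OF solves_dir solves_neu b])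
  show "Uneu b l = (- neu' a l b) * U b (dir a l) + dir' a l b * U b (neu a l)"
    unfolding Uneu_def by (subst e(2)) (rule U_lincomb[OF solves_dir solves_neu b])
qed

locale nonlocal_pair = A: nonlocal_pencil T p q s v H + B: nonlocal_pencil T pt qt s v H
  for T :: real and p q pt qt s :: "real \<Rightarrow> complex" and v :: "real \<Rightarrow> real" and H :: complex
begin

definition same_U :: "real \<Rightarrow> bool" where
  "same_U a \<longleftrightarrow> (\<forall>l. A.Udir a l = B.Udir a l \<and> A.Uneu a l = B.Uneu a l)"

definition cross :: "real \<Rightarrow> real \<Rightarrow> complex \<Rightarrow> complex" where
  "cross a x l = A.dir a l x * B.neu a l x - A.neu a l x * B.dir a l x"

text \<open>
  Multiplied by \<open>Udir a\<close>, the cross term is a combination of the functions of \<open>weyl_solution_le\<close> for both equations.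
  Dividing by the lower bound for \<open>Udir a\<close> gives decay like \<open>1/\<bar>\<lambda>\<bar>\<close> for large \<open>\<bar>Im \<lambda>\<bar>\<close>; in the remaining strip the
  growth bound for the solutions gives the same decay directly.
\<close>

lemma cross_zero:
  assumes a: "0 < a" "a \<le> T" and same_U: "same_U a" and x: "x \<in> {a/2..a}"
  shows "cross a x l = 0"
proof -
  have aT: "a \<in> {0..T}" and xT: "x \<in> {0..T}" using a x by auto
  obtain K c where Kc: "K \<ge> 1" "c > 0"
    "\<And>l. \<bar>Im l\<bar> \<ge> K \<Longrightarrow> norm (l * A.Udir a l) \<ge> c * exp (a * \<bar>Im l\<bar>) \<and> norm (A.Uneu a l) \<ge> c * exp (a * \<bar>Im l\<bar>)"
    by (rule A.Udir_Uneu_lower[OF a], rule that, assumption, assumption, blast)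
  define C where "C = max A.growth_C B.growth_C"
  have C: "C \<ge> 1" using A.growth_C_ge_1 by (simp add: C_def)
  define V where "V = v T - v 0"
  have V: "V \<ge> 0" using A.total_nonneg by (simp add: V_def)
  have Cmax: "A.growth_C * r \<le> C * r" "B.growth_C * r \<le> C * r" if "r \<ge> 0" for r
    using that by (auto simp: C_def intro!: mult_right_mono)
  have ax: "\<bar>x - a\<bar> = a - x" using x by auto
  have dirA: "norm l * norm (A.dir a l x) \<le> C * exp (\<bar>Im l\<bar> * (a - x))"
    and dirB: "norm l * norm (B.dir a l x) \<le> C * exp (\<bar>Im l\<bar> * (a - x))"
    and neuA: "norm (A.neu a l x) \<le> C * exp (\<bar>Im l\<bar> * (a - x))"
    and neuB: "norm (B.neu a l x) \<le> C * exp (\<bar>Im l\<bar> * (a - x))" if l: "norm l \<ge> 1" for l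
    using order_trans[OF A.dir_neu_le(1)[OF l aT xT] Cmax(1)] order_trans[OF B.dir_neu_le(1)[OF l aT xT] Cmax(2)]
      order_trans[OF A.dir_neu_le(2)[OF l aT xT] Cmax(1)] order_trans[OF B.dir_neu_le(2)[OF l aT xT] Cmax(2)]
    unfolding ax by simp_all
  have weylA: "norm l * norm (A.neu a l x * A.Udir a l - A.dir a l x * A.Uneu a l) \<le> V * (C * exp (\<bar>Im l\<bar> * x))"
    and weylB: "norm l * norm (B.neu a l x * B.Udir a l - B.dir a l x * B.Uneu a l) \<le> V * (C * exp (\<bar>Im l\<bar> * x))"
    if l: "norm l \<ge> 1" for l
    using order_trans[OF A.weyl_solution_le[OF l aT x, folded V_def] mult_left_mono[OF Cmax(1) V]]
      order_trans[OF B.weyl_solution_le[OF l aT x, folded V_def] mult_left_mono[OF Cmax(2) V]] by simp_all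
  define M where "M = 2 * C\<^sup>2 * exp (2 * K * a) + 2 * C\<^sup>2 * V / c"
  have M1: "2 * C\<^sup>2 * exp (2 * K * a) \<le> M" "2 * C\<^sup>2 * V / c \<le> M" using V Kc(2) by (auto simp: M_def)
  have decay: "norm l * norm (cross a x l) \<le> M" if l: "norm l \<ge> 1" for l
  proof (cases "\<bar>Im l\<bar> \<ge> K")
    case False
    have e: "exp (\<bar>Im l\<bar> * (a - x)) \<le> exp (K * a)"
      using False x a Kc(1) by (auto intro!: mult_mono)
    have le: "C * exp (\<bar>Im l\<bar> * (a - x)) \<le> C * exp (K * a)" using e C by (intro mult_left_mono) auto
    have "norm l * norm (cross a x l) \<le> norm l * (norm (A.dir a l x) * norm (B.neu a l x) + norm (A.neu a l x) * norm (B.dir a l x))"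
      unfolding cross_def by (intro mult_left_mono order_trans[OF norm_triangle_ineq4]) (auto simp: norm_mult)
    also have "\<dots> = (norm l * norm (A.dir a l x)) * norm (B.neu a l x) + norm (A.neu a l x) * (norm l * norm (B.dir a l x))"
      by (simp add: algebra_simps)
    also have "\<dots> \<le> (C * exp (K * a)) * (C * exp (K * a)) + (C * exp (K * a)) * (C * exp (K * a))"
    proof -
      define G where "G = C * exp (K * a)"
      have "G \<ge> 0" using C by (simp add: G_def)
      moreover note order_trans[OF dirA[OF l] le, folded G_def] order_trans[OF dirB[OF l] le, folded G_def]
        order_trans[OF neuA[OF l] le, folded G_def] order_trans[OF neuB[OF l] le, folded G_def]
      ultimately show ?thesis unfolding G_def[symmetric] by (intro add_mono mult_mono) auto
    qed
    also have "\<dots> = 2 * C\<^sup>2 * exp (2 * K * a)"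
    proof -
      have "exp (2 * K * a) = exp (K * a) * exp (K * a)" by (simp flip: exp_add)
      then show ?thesis by (simp add: power2_eq_square)
    qed
    finally show ?thesis using M1 by simp
  next
    case True
    define D where "D = A.Udir a l"
    define E where "E = A.Uneu a l"
    have DE: "B.Udir a l = D" "B.Uneu a l = E" using same_U by (auto simp: same_U_def D_def E_def)
    have w1: "norm l * norm (A.neu a l x * D - A.dir a l x * E) \<le> V * (C * exp (\<bar>Im l\<bar> * x))"
      using weylA[OF l] by (simp add: D_def E_def)
    have w2: "norm l * norm (B.neu a l x * D - B.dir a l x * E) \<le> V * (C * exp (\<bar>Im l\<bar> * x))"
      using weylB[OF l] by (simp add: DE)
    have id: "D * cross a x l = A.dir a l x * (B.neu a l x * D - B.dir a l x * E) - B.dir a l x * (A.neu a l x * D - A.dir a l x * E)"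
      by (simp add: cross_def algebra_simps)
    have ex: "exp (\<bar>Im l\<bar> * (a - x)) * exp (\<bar>Im l\<bar> * x) = exp (a * \<bar>Im l\<bar>)"
      by (simp add: algebra_simps flip: exp_add)
    have "(norm l * norm l) * norm (D * cross a x l) \<le> (norm l * norm (A.dir a l x)) * (norm l * norm (B.neu a l x * D - B.dir a l x * E))
        + (norm l * norm (B.dir a l x)) * (norm l * norm (A.neu a l x * D - A.dir a l x * E))"
    proof -
      have "norm (D * cross a x l) \<le> norm (A.dir a l x) * norm (B.neu a l x * D - B.dir a l x * E)
          + norm (B.dir a l x) * norm (A.neu a l x * D - A.dir a l x * E)"
        unfolding id by (rule order_trans[OF norm_triangle_ineq4]) (simp add: norm_mult)
      then have "(norm l * norm l) * norm (D * cross a x l) \<le> (norm l * norm l) * (norm (A.dir a l x) * norm (B.neu a l x * D - B.dir a l x * E)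
          + norm (B.dir a l x) * norm (A.neu a l x * D - A.dir a l x * E))" by (rule mult_left_mono) simp
      then show ?thesis by (simp add: algebra_simps)
    qed
    also have "\<dots> \<le> (C * exp (\<bar>Im l\<bar> * (a - x))) * (V * (C * exp (\<bar>Im l\<bar> * x))) + (C * exp (\<bar>Im l\<bar> * (a - x))) * (V * (C * exp (\<bar>Im l\<bar> * x)))"
    proof -
      define G where "G = C * exp (\<bar>Im l\<bar> * (a - x))"
      have "G \<ge> 0" using C by (simp add: G_def)
      then show ?thesis
        using dirA[OF l, folded G_def] dirB[OF l, folded G_def] w1 w2 unfolding G_def[symmetric]
        by (intro add_mono mult_mono[of _ G]) auto
    qed
    also have "\<dots> = 2 * C\<^sup>2 * V * (exp (\<bar>Im l\<bar> * (a - x)) * exp (\<bar>Im l\<bar> * x))"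
      by (simp add: power2_eq_square algebra_simps)
    finally have up: "(norm l * norm l) * norm (D * cross a x l) \<le> 2 * C\<^sup>2 * V * exp (a * \<bar>Im l\<bar>)" unfolding ex .
    have "c * exp (a * \<bar>Im l\<bar>) \<le> norm l * norm D" using Kc(3)[OF True] by (simp add: D_def norm_mult)
    then have "(c * exp (a * \<bar>Im l\<bar>)) * (norm l * norm (cross a x l)) \<le> (norm l * norm D) * (norm l * norm (cross a x l))"
      by (rule mult_right_mono) simp
    also have "\<dots> = (norm l * norm l) * norm (D * cross a x l)" by (simp add: norm_mult)
    also note up
    finally have "exp (a * \<bar>Im l\<bar>) * (c * (norm l * norm (cross a x l))) \<le> exp (a * \<bar>Im l\<bar>) * (2 * C\<^sup>2 * V)"
      by (simp add: mult_ac)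
    then have "c * (norm l * norm (cross a x l)) \<le> 2 * C\<^sup>2 * V" by (simp only: mult_le_cancel_left_pos exp_gt_zero)
    then have "norm l * norm (cross a x l) \<le> 2 * C\<^sup>2 * V / c" using Kc(2) by (simp add: field_simps)
    then show ?thesis using M1 by simp
  qed
  have "cross a x holomorphic_on UNIV"
    unfolding cross_def[abs_def] by (intro holomorphic_intros A.holomorphic_dir_neu[OF aT xT] B.holomorphic_dir_neu[OF aT xT])
  moreover have "(cross a x \<longlongrightarrow> 0) at_infinity"
    unfolding Lim_at_infinity
  proof (intro allI impI)
    fix e :: real assume e: "e > 0"
    have "dist (cross a x l) 0 < e" if l: "norm l \<ge> max 1 (\<bar>M\<bar> / e + 1)" for l
    proof -
      have "norm l * norm (cross a x l) \<le> M" using l by (intro decay) simp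
      also have "M < norm l * e"
      proof -
        have "\<bar>M\<bar> / e < norm l" using l by linarith
        then have "\<bar>M\<bar> < norm l * e" by (simp only: pos_divide_less_eq[OF e])
        then show ?thesis by linarith
      qed
      finally have "norm l * norm (cross a x l) < norm l * e" .
      then show ?thesis using l by (simp add: mult_less_cancel_left)
    qed
    then show "\<exists>b. \<forall>l. norm l \<ge> b \<longrightarrow> dist (cross a x l) 0 < e" by blast
  qed
  ultimately show ?thesis by (rule Liouville_weak)
qed

text \<open>
  The vanishing cross term says that the pairs \<open>(dir, neu)\<close> of the two equations are proportional, with the
  continuous factor \<open>r\<close>. Its derivative vanishes too, and comparing Wronskians gives \<open>r^2 = 1\<close>; since \<open>r a = 1\<close>,
  connectedness gives \<open>r = 1\<close>.
\<close>

lemma solutions_agree: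
  assumes a: "0 < a" "a \<le> T" and same_U: "same_U a" and x: "x \<in> {a/2..a}"
  shows "A.dir a l x = B.dir a l x" "A.neu a l x = B.neu a l x"
proof -
  have aT: "a \<in> {0..T}" using a by auto
  have sub: "{a/2..a} \<subseteq> {0..T}" using a by auto
  define r where "r x = A.neu a l x * B.dir' a l x - A.dir a l x * B.neu' a l x" for x
  have key: "A.dir a l x = r x * B.dir a l x \<and> A.neu a l x = r x * B.neu a l x \<and> (r x)\<^sup>2 = 1" if x: "x \<in> {a/2..a}" for x
  proof -
    have xT: "x \<in> {0..T}" using x sub by blast
    have c0: "A.dir a l x * B.neu a l x = A.neu a l x * B.dir a l x"
      using cross_zero[OF a same_U x, of l] by (simp add: cross_def)
    have wA: "A.dir' a l x * A.neu a l x - A.dir a l x * A.neu' a l x = 1" by (rule A.wronskian_dir_neu[OF aT xT])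
    have wB: "B.dir' a l x * B.neu a l x - B.dir a l x * B.neu' a l x = 1" by (rule B.wronskian_dir_neu[OF aT xT])
    have d: "(y has_vector_derivative z x) (at x within {a/2..a})" if "solves T w y z" for w y z
      using that xT has_vector_derivative_within_subset[OF _ sub] unfolding solves_def by blast
    note dAd = d[OF A.solves_dir[of l a]] and dAn = d[OF A.solves_neu[of l a]]
      and dBd = d[OF B.solves_dir[of l a]] and dBn = d[OF B.solves_neu[of l a]]
    have "((\<lambda>x. cross a x l) has_vector_derivative
        (A.dir a l x * B.neu' a l x + A.dir' a l x * B.neu a l x) - (A.neu a l x * B.dir' a l x + A.neu' a l x * B.dir a l x)) (at x within {a/2..a})"
      unfolding cross_def by (intro has_vector_derivative_diff has_vector_derivative_mult dAd dAn dBd dBn)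
    moreover have "((\<lambda>x. cross a x l) has_vector_derivative 0) (at x within {a/2..a})"
      by (rule has_vector_derivative_transform[OF x _ has_vector_derivative_const[of 0]]) (rule cross_zero[OF a same_U])
    ultimately have "(A.dir a l x * B.neu' a l x + A.dir' a l x * B.neu a l x) - (A.neu a l x * B.dir' a l x + A.neu' a l x * B.dir a l x) = 0"
      using a x by (intro vector_derivative_unique_within_closed_interval[of "a/2" a x "\<lambda>x. cross a x l"]) auto
    then have c1: "A.dir' a l x * B.neu a l x - A.neu' a l x * B.dir a l x = r x"
      by (simp add: r_def algebra_simps)
    have 1: "r x * B.dir a l x = A.dir a l x"
    proof -
      have "r x * B.dir a l x = (A.neu a l x * B.dir a l x) * B.dir' a l x - A.dir a l x * B.neu' a l x * B.dir a l x"
        by (simp add: r_def algebra_simps)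
      also have "\<dots> = A.dir a l x * (B.dir' a l x * B.neu a l x - B.dir a l x * B.neu' a l x)"
        unfolding c0[symmetric] by (simp add: algebra_simps)
      finally show ?thesis unfolding wB by simp
    qed
    have 2: "r x * B.neu a l x = A.neu a l x"
    proof -
      have "r x * B.neu a l x = A.neu a l x * B.dir' a l x * B.neu a l x - (A.dir a l x * B.neu a l x) * B.neu' a l x"
        by (simp add: r_def algebra_simps)
      also have "\<dots> = A.neu a l x * (B.dir' a l x * B.neu a l x - B.dir a l x * B.neu' a l x)"
        unfolding c0 by (simp add: algebra_simps)
      finally show ?thesis unfolding wB by simp
    qed
    have "(r x)\<^sup>2 = A.dir' a l x * (r x * B.neu a l x) - A.neu' a l x * (r x * B.dir a l x)"
      unfolding power2_eq_square by (subst c1[symmetric]) (simp add: algebra_simps)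
    also have "\<dots> = 1" unfolding 1 2 using wA by (simp add: algebra_simps)
    finally show ?thesis using 1 2 by simp
  qed
  have "continuous_on {a/2..a} r"
    unfolding r_def using solves_continuous[OF A.solves_dir[of l a]] solves_continuous[OF A.solves_neu[of l a]]
      solves_continuous[OF B.solves_dir[of l a]] solves_continuous[OF B.solves_neu[of l a]] sub
    by (intro continuous_intros) (auto elim: continuous_on_subset)
  moreover have "r ` {a/2..a} \<subseteq> {1, -1}"
  proof (rule image_subsetI)
    fix x assume "x \<in> {a/2..a}"
    from key[OF this] have "(r x)\<^sup>2 = 1" by simp
    then show "r x \<in> {1, -1}" by (simp add: power2_eq_1_iff)
  qed
  then have "finite (r ` {a/2..a})" using finite_subset by blast
  moreover have "connected {a/2..a}" by simp
  ultimately have "r constant_on {a/2..a}" using continuous_finite_range_constant by blast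
  moreover have "r a = 1" by (simp add: r_def A.base_values[OF aT] B.base_values[OF aT])
  moreover have "a \<in> {a/2..a}" using a by simp
  ultimately have "r x = 1" using x unfolding constant_on_def by metis
  then show "A.dir a l x = B.dir a l x" "A.neu a l x = B.neu a l x" using key[OF x] by auto
qed

lemma derivatives_agree:
  assumes a: "0 < a" "a \<le> T" and same_U: "same_U a" and x: "x \<in> {a/2..a}"
  shows "A.dir' a l x = B.dir' a l x" "A.neu' a l x = B.neu' a l x"
proof -
  have sub: "{a/2..a} \<subseteq> {0..T}" using a by auto
  have d: "(y has_vector_derivative z x) (at x within {a/2..a})" if "solves T w y z" for w y z
    using that x sub has_vector_derivative_within_subset[OF _ sub] unfolding solves_def by blast
  have *: "z1 x = z2 x" if "solves T w1 y1 z1" "solves T w2 y2 z2" "\<And>x. x \<in> {a/2..a} \<Longrightarrow> y1 x = y2 x" for w1 w2 y1 y2 z1 z2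
  proof -
    have "(y1 has_vector_derivative z2 x) (at x within {a/2..a})"
      by (rule has_vector_derivative_transform[OF x that(3) d[OF that(2)]])
    then show ?thesis
      using a x d[OF that(1)] by (intro vector_derivative_unique_within_closed_interval[of "a/2" a x y1]) auto
  qed
  show "A.dir' a l x = B.dir' a l x" "A.neu' a l x = B.neu' a l x"
    by (rule *[OF A.solves_dir B.solves_dir solutions_agree(1)[OF a same_U]], assumption,
        rule *[OF A.solves_neu B.solves_neu solutions_agree(2)[OF a same_U]])
qed

text \<open>
  Equal solutions have equal second derivatives, so \<open>W\<close> agrees wherever a solution is nonzero, and \<open>dir\<close> and \<open>neu\<close>
  have no common zero. Two values of \<open>\<lambda>\<close> separate \<open>p\<close> from \<open>q\<close>.
\<close>

lemma potentials_agree: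
  assumes a: "0 < a" "a \<le> T" and same_U: "same_U a"
  shows "\<exists>N. negligible N \<and> (\<forall>x\<in>{a/2..a} - N. p x = pt x \<and> q x = qt x)"
proof -
  have pot: "\<exists>N. negligible N \<and> (\<forall>x\<in>{a/2<..<a} - N. A.W l x = B.W l x)" for l
  proof -
    have *: "\<exists>N. negligible N \<and> (\<forall>x\<in>{a/2<..<a} - N. A.W l x * y1 x = B.W l x * y2 x)"
      if s: "solves T (A.W l) y1 z1" "solves T (B.W l) y2 z2" and eq: "\<And>x. x \<in> {a/2..a} \<Longrightarrow> z1 x = z2 x" for y1 y2 z1 z2
    proof -
      obtain N1 where N1: "negligible N1" "\<And>x. x \<in> {0<..<T} - N1 \<Longrightarrow> (z1 has_vector_derivative A.W l x * y1 x) (at x)"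
        by (rule solves_ae[OF s(1)], rule that)
      obtain N2 where N2: "negligible N2" "\<And>x. x \<in> {0<..<T} - N2 \<Longrightarrow> (z2 has_vector_derivative B.W l x * y2 x) (at x)"
        by (rule solves_ae[OF s(2)], rule that)
      have "A.W l x * y1 x = B.W l x * y2 x" if x: "x \<in> {a/2<..<a} - (N1 \<union> N2)" for x
      proof -
        have x': "x \<in> {0<..<T} - N1" "x \<in> {0<..<T} - N2" using x a by auto
        have "(z2 has_vector_derivative A.W l x * y1 x) (at x)"
          by (rule has_vector_derivative_transform_within_open[OF N1(2)[OF x'(1)], of "{a/2<..<a}"]) (use x eq in auto)
        then show ?thesis using N2(2)[OF x'(2)] by (rule vector_derivative_unique_at)
      qed
      then show ?thesis using negligible_Un[OF N1(1) N2(1)] by blast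
    qed
    obtain N1 where N1: "negligible N1" "\<forall>x\<in>{a/2<..<a} - N1. A.W l x * A.dir a l x = B.W l x * B.dir a l x"
      using *[OF A.solves_dir B.solves_dir derivatives_agree(1)[OF a same_U]] by blast
    obtain N2 where N2: "negligible N2" "\<forall>x\<in>{a/2<..<a} - N2. A.W l x * A.neu a l x = B.W l x * B.neu a l x"
      using *[OF A.solves_neu B.solves_neu derivatives_agree(2)[OF a same_U]] by blast
    have "A.W l x = B.W l x" if x: "x \<in> {a/2<..<a} - (N1 \<union> N2)" for x
    proof -
      have x': "x \<in> {a/2..a}" "x \<in> {0..T}" "a \<in> {0..T}" using x a by auto
      have "A.W l x * A.dir a l x = B.W l x * A.dir a l x" "A.W l x * A.neu a l x = B.W l x * A.neu a l x"
      proof -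
        have xN: "x \<in> {a/2<..<a} - N1" "x \<in> {a/2<..<a} - N2" using x by auto
        show "A.W l x * A.dir a l x = B.W l x * A.dir a l x" "A.W l x * A.neu a l x = B.W l x * A.neu a l x"
          using bspec[OF N1(2) xN(1)] bspec[OF N2(2) xN(2)] unfolding solutions_agree[OF a same_U x'(1), of l]
          by blast+
      qed
      moreover have "A.dir a l x \<noteq> 0 \<or> A.neu a l x \<noteq> 0" using A.wronskian_dir_neu[OF x'(3,2), of l] by auto
      ultimately show ?thesis by auto
    qed
    then show ?thesis using negligible_Un[OF N1(1) N2(1)] by blast
  qed
  obtain N0 where N0: "negligible N0" "\<forall>x\<in>{a/2<..<a} - N0. A.W 0 x = B.W 0 x" using pot by blast
  obtain N1 where N1: "negligible N1" "\<forall>x\<in>{a/2<..<a} - N1. A.W 1 x = B.W 1 x" using pot by blast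
  have "p x = pt x \<and> q x = qt x" if x: "x \<in> {a/2..a} - (N0 \<union> N1 \<union> {a/2, a})" for x
  proof -
    have "x \<in> {a/2<..<a} - N0" "x \<in> {a/2<..<a} - N1" using x by auto
    then have "A.W 0 x = B.W 0 x" "A.W 1 x = B.W 1 x" using N0(2) N1(2) by blast+
    then show ?thesis by (simp add: A.W_def B.W_def)
  qed
  moreover have "negligible (N0 \<union> N1 \<union> {a/2, a})" by (intro negligible_Un N0 N1) auto
  ultimately show ?thesis by blast
qed

lemma same_U_half:
  assumes a: "0 < a" "a \<le> T" and same_U: "same_U a"
  shows "same_U (a/2)"
  unfolding same_U_def
proof
  fix l
  define b where "b = a/2"
  have aT: "a \<in> {0..T}" and bT: "b \<in> {0..T}" and b: "0 \<le> b" "b \<le> a" "b \<in> {a/2..a}" using a by (auto simp: b_def)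
  have tail: "stieltjes_integral b a s (A.dir a l) = stieltjes_integral b a s (B.dir a l)"
    "stieltjes_integral b a s (A.neu a l) = stieltjes_integral b a s (B.neu a l)"
  proof -
    interpret ba: stieltjes b a s v by (rule stieltjes_subinterval[OF A.st.stieltjes_axioms]) (use a b in auto)
    show "stieltjes_integral b a s (A.dir a l) = stieltjes_integral b a s (B.dir a l)"
      by (rule ba.int_cong[OF B.solution_cont[OF B.solves_dir a(2) b(1)]], rule solutions_agree(1)[OF a same_U]) (simp add: b_def)
    show "stieltjes_integral b a s (A.neu a l) = stieltjes_integral b a s (B.neu a l)"
      by (rule ba.int_cong[OF B.solution_cont[OF B.solves_neu a(2) b(1)]], rule solutions_agree(2)[OF a same_U]) (simp add: b_def)
  qed
  note comb = stieltjes_integral_combine[OF A.stieltjes_initial[OF aT] b(1,2)]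
  have dirb: "A.U b (A.dir a l) = B.U b (B.dir a l)"
    using comb[OF A.solution_cont[OF A.solves_dir[of l a] a(2) order_refl]] comb[OF B.solution_cont[OF B.solves_dir[of l a] a(2) order_refl]]
      tail(1) same_U by (simp add: same_U_def A.Udir_def B.Udir_def)
  have neub: "A.U b (A.neu a l) = B.U b (B.neu a l)"
    using comb[OF A.solution_cont[OF A.solves_neu[of l a] a(2) order_refl]] comb[OF B.solution_cont[OF B.solves_neu[of l a] a(2) order_refl]]
      tail(2) same_U by (simp add: same_U_def A.Uneu_def B.Uneu_def)
  note A = A.Udir_Uneu_change_base[OF aT bT, of l] and B = B.Udir_Uneu_change_base[OF aT bT, of l]
  show "A.Udir (a/2) l = B.Udir (a/2) l \<and> A.Uneu (a/2) l = B.Uneu (a/2) l"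
    unfolding b_def[symmetric] A B dirb neub
    using solutions_agree[OF a same_U b(3), of l] derivatives_agree[OF a same_U b(3), of l] by simp
qed

theorem same_U_imp_potentials_equal:
  assumes same_U: "same_U T"
  shows "\<exists>N. negligible N \<and> (\<forall>x\<in>{0<..T} - N. p x = pt x \<and> q x = qt x)"
proof -
  define a where "a n = T / 2 ^ n" for n :: nat
  have a: "0 < a n" "a n \<le> T" "a (Suc n) = a n / 2" for n
    using A.T_pos by (auto simp: a_def divide_le_eq)
  have sn: "same_U (a n)" for n
  proof (induction n)
    case 0 then show ?case using same_U by (simp add: a_def)
  next
    case (Suc n) then show ?case unfolding a(3) by (intro same_U_half a)
  qed
  have "\<forall>n. \<exists>N. negligible N \<and> (\<forall>x\<in>{a n/2..a n} - N. p x = pt x \<and> q x = qt x)"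
    using potentials_agree[OF a(1,2) sn] by blast
  then obtain N where N: "\<And>n. negligible (N n)" "\<And>n x. x \<in> {a n/2..a n} - N n \<Longrightarrow> p x = pt x \<and> q x = qt x"
    by metis
  have "p x = pt x \<and> q x = qt x" if x: "x \<in> {0<..T} - (\<Union>n. N n)" for x
  proof -
    have "\<exists>m. a m < x"
    proof -
      obtain m where m: "T / x < 2 ^ m" using real_arch_pow[of 2 "T / x"] by auto
      then have "a m < x" using x by (simp add: a_def field_simps)
      then show ?thesis ..
    qed
    define m where "m = (LEAST m. a m < x)"
    have m: "a m < x" unfolding m_def using \<open>\<exists>m. a m < x\<close> by (rule LeastI_ex)
    have "m \<noteq> 0"
    proof
      assume "m = 0"
      with m x show False by (simp add: a_def)
    qed
    then obtain n where n: "m = Suc n" by (cases m) auto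
    have "\<not> a n < x" using not_less_Least[of n "\<lambda>m. a m < x"] n by (simp add: m_def)
    then have "x \<in> {a n/2..a n}" using m unfolding n a(3) by simp
    then show ?thesis using N(2)[of x n] x by blast
  qed
  moreover have "negligible (\<Union>n. N n)" using N(1) by (intro negligible_countable_Union) auto
  ultimately show ?thesis by blast
qed

end

section \<open>From the spectra to the characteristic functions\<close>

context nonlocal_pair
begin

lemma factor_eq_1:
  assumes kH: "\<And>e. e > 0 \<Longrightarrow> norm (k * H - H) \<le> e" shows "k = 1"
proof -
  have "norm (k * H - H) \<le> 0" by (rule field_le_epsilon) (use kH in simp)
  then have "k * H = 1 * H" by simp
  then show ?thesis using A.H_nz by (simp only: mult_cancel_right simp_thms)
qed

text \<open>
  The factor \<open>\<lambda>\<close> in front of \<open>Udir\<close> gives it the same two-sided bounds as \<open>Uneu\<close>, so that one quotient lemma serves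
  both. Equality of the integrals of the coefficients \<open>p\<close> enters as equality of the two functions \<open>wave T\<close>.
\<close>

lemma same_U_of_spectra:
  assumes P: "A.P T = B.P T"
    and enum: "enumerates_zeros (Delta1 T s p q) lam" "enumerates_zeros (Delta11 T s p q) lam1"
      "enumerates_zeros (Delta1 T s pt qt) lam" "enumerates_zeros (Delta11 T s pt qt) lam1"
  shows "same_U T"
proof -
  have T: "0 < T" "T \<le> T" "T \<in> {0..T}" using A.T_pos by auto
  obtain KA cA where KA: "KA \<ge> 1" "cA > 0"
    "\<And>l. \<bar>Im l\<bar> \<ge> KA \<Longrightarrow> norm (l * A.Udir T l) \<ge> cA * exp (T * \<bar>Im l\<bar>) \<and> norm (A.Uneu T l) \<ge> cA * exp (T * \<bar>Im l\<bar>)"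
    by (rule A.Udir_Uneu_lower[OF T(1,2)], rule that, assumption, assumption, blast)
  obtain KB cB where KB: "KB \<ge> 1" "cB > 0"
    "\<And>l. \<bar>Im l\<bar> \<ge> KB \<Longrightarrow> norm (l * B.Udir T l) \<ge> cB * exp (T * \<bar>Im l\<bar>) \<and> norm (B.Uneu T l) \<ge> cB * exp (T * \<bar>Im l\<bar>)"
    by (rule B.Udir_Uneu_lower[OF T(1,2)], rule that, assumption, assumption, blast)
  obtain CA where CA: "CA > 0" "\<And>l. norm (l * A.Udir T l) \<le> CA * exp (T * \<bar>Im l\<bar>)" "\<And>l. norm (A.Uneu T l) \<le> CA * exp (T * \<bar>Im l\<bar>)"
    by (rule A.Udir_Uneu_upper[OF T(3)], rule that)
  obtain CB where CB: "CB > 0" "\<And>l. norm (l * B.Udir T l) \<le> CB * exp (T * \<bar>Im l\<bar>)" "\<And>l. norm (B.Uneu T l) \<le> CB * exp (T * \<bar>Im l\<bar>)"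
    by (rule B.Udir_Uneu_upper[OF T(3)], rule that)
  define C where "C = CA + CB"
  have C: "C > 0" using CA CB by (simp add: C_def)
  have up: "X \<le> C * exp (T * \<bar>Im l\<bar>)" if "X \<le> CA * exp (T * \<bar>Im l\<bar>) \<or> X \<le> CB * exp (T * \<bar>Im l\<bar>)" for X l
  proof -
    have "CA * exp (T * \<bar>Im l\<bar>) \<le> C * exp (T * \<bar>Im l\<bar>)" "CB * exp (T * \<bar>Im l\<bar>) \<le> C * exp (T * \<bar>Im l\<bar>)"
      using CA(1) CB(1) by (auto simp: C_def)
    then show ?thesis using that by linarith
  qed
  note hol = A.holomorphic_Udir_Uneu[OF T(3)] B.holomorphic_Udir_Uneu[OF T(3)]
  have nz: "A.Udir T (\<i> * KA) \<noteq> 0" "A.Uneu T (\<i> * KA) \<noteq> 0" "B.Udir T (\<i> * KB) \<noteq> 0" "B.Uneu T (\<i> * KB) \<noteq> 0"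
  proof -
    have im: "KA \<le> \<bar>Im (\<i> * KA)\<bar>" "KB \<le> \<bar>Im (\<i> * KB)\<bar>" by simp_all
    have "cA * exp (T * \<bar>Im (\<i> * KA)\<bar>) > 0" "cB * exp (T * \<bar>Im (\<i> * KB)\<bar>) > 0" using KA(2) KB(2) by auto
    then show "A.Udir T (\<i> * KA) \<noteq> 0" "A.Uneu T (\<i> * KA) \<noteq> 0" "B.Udir T (\<i> * KB) \<noteq> 0" "B.Uneu T (\<i> * KB) \<noteq> 0"
      using KA(3)[OF im(1)] KB(3)[OF im(2)] by auto
  qed
  have const: "\<exists>k. \<forall>z. h z = k" if "h holomorphic_on UNIV" "\<exists>B. \<forall>z. norm (h z) \<le> B" for h :: "complex \<Rightarrow> complex"
  proof -
    have "bounded (range h)" using that(2) unfolding bounded_iff by blast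
    then have "h constant_on UNIV" by (rule Liouville_theorem[OF that(1)])
    then show ?thesis by (auto simp: constant_on_def)
  qed
  have asym: "\<exists>l w1 w2. norm (w1 * A.Udir T l - H) \<le> e \<and> norm (w1 * B.Udir T l - H) \<le> e \<and>
      norm (w2 * A.Uneu T l - H) \<le> e \<and> norm (w2 * B.Uneu T l - H) \<le> e" if e: "e > 0" for e
  proof -
    obtain K1 where K1: "K1 \<ge> 1"
      "\<And>l. \<bar>Im l\<bar> \<ge> K1 \<Longrightarrow> norm (2 * sgn (Im l) * \<i> * l * A.Udir T l * A.wave T l - H) \<le> e \<and>
        norm (2 * A.Uneu T l * A.wave T l - H) \<le> e"
      by (rule A.Udir_Uneu_asymptotics[OF T(1,2) e], rule that)
    obtain K2 where K2: "K2 \<ge> 1"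
      "\<And>l. \<bar>Im l\<bar> \<ge> K2 \<Longrightarrow> norm (2 * sgn (Im l) * \<i> * l * B.Udir T l * B.wave T l - H) \<le> e \<and>
        norm (2 * B.Uneu T l * B.wave T l - H) \<le> e"
      by (rule B.Udir_Uneu_asymptotics[OF T(1,2) e], rule that)
    define l where "l = \<i> * complex_of_real (max K1 K2)"
    have l: "\<bar>Im l\<bar> \<ge> K1" "\<bar>Im l\<bar> \<ge> K2" using K1(1) K2(1) by (auto simp: l_def)
    have w: "B.wave T l = A.wave T l" by (simp add: A.wave_def B.wave_def P)
    show ?thesis
      by (rule exI[of _ l], rule exI[of _ "2 * complex_of_real (sgn (Im l)) * \<i> * l * A.wave T l"], rule exI[of _ "2 * A.wave T l"])
         (use K1(2)[OF l(1)] K2(2)[OF l(2)] in \<open>simp add: w mult_ac\<close>)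
  qed
  have k1: "k = 1" if kk: "\<And>e. e > 0 \<Longrightarrow> \<exists>w b. norm (w * (k * b) - H) \<le> e \<and> norm (w * b - H) \<le> e" for k
  proof (rule factor_eq_1)
    fix e :: real assume e: "e > 0"
    define e' where "e' = e / (norm k + 1)"
    have e': "e' > 0" using e by (simp add: e'_def add_nonneg_pos)
    obtain w b where wb: "norm (w * (k * b) - H) \<le> e'" "norm (w * b - H) \<le> e'" using kk[OF e'] by blast
    have "k * H - H = (w * (k * b) - H) - k * (w * b - H)" by (simp add: algebra_simps)
    also have "norm \<dots> \<le> e' + norm k * e'"
    proof (rule order_trans[OF norm_triangle_ineq4 add_mono[OF wb(1)]])
      show "norm (k * (w * b - H)) \<le> norm k * e'" unfolding norm_mult[of k] by (rule mult_left_mono[OF wb(2)]) simp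
    qed
    also have "\<dots> = (norm k + 1) * e'" by (simp add: algebra_simps)
    also have "\<dots> = e"
    proof -
      have "norm k + 1 \<noteq> 0" using norm_ge_zero[of k] by linarith
      then show ?thesis by (simp add: e'_def)
    qed
    finally show "norm (k * H - H) \<le> e" .
  qed
  have DA: "Delta1 T s p q = (\<lambda>l. - A.Udir T l)" "Delta11 T s p q = A.Uneu T" using A.Delta_eq by auto
  have DB: "Delta1 T s pt qt = (\<lambda>l. - B.Udir T l)" "Delta11 T s pt qt = B.Uneu T" using B.Delta_eq by auto
  have Udir: "A.Udir T l = B.Udir T l" for l
  proof -
    obtain h where h: "h holomorphic_on UNIV" "\<And>z. - A.Udir T z = h z * (- B.Udir T z)"
    proof (rule entire_quotient_of_common_zeros[OF _ _ _ _ enum(1)[unfolded DA] enum(3)[unfolded DB]])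
      show "(\<lambda>l. - A.Udir T l) holomorphic_on UNIV" "(\<lambda>l. - B.Udir T l) holomorphic_on UNIV"
        by (intro holomorphic_intros hol)+
      show "\<exists>z. - A.Udir T z \<noteq> 0" "\<exists>z. - B.Udir T z \<noteq> 0" using nz by auto
    qed (rule that)
    have "\<exists>B. \<forall>z. norm (h z) \<le> B"
    proof (rule entire_quotient_bounded[where f="\<lambda>z. z * A.Udir T z" and g="\<lambda>z. z * B.Udir T z" and C=C and a=T and K=KB and c=cB])
      show "(\<lambda>z. z * B.Udir T z) holomorphic_on UNIV" by (intro holomorphic_intros hol)
      show "z * A.Udir T z = h z * (z * B.Udir T z)" for z using h(2)[of z] by simp
    qed (use h(1) up CA(2) CB(2) KB C T in auto)
    then obtain k where k: "\<And>z. h z = k" using const[OF h(1)] by blast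
    have eq: "A.Udir T z = k * B.Udir T z" for z using h(2)[of z] k by simp
    have "k = 1" using asym unfolding eq by (intro k1) blast
    then show ?thesis using eq by simp
  qed
  have Uneu: "A.Uneu T l = B.Uneu T l" for l
  proof -
    obtain h where h: "h holomorphic_on UNIV" "\<And>z. A.Uneu T z = h z * B.Uneu T z"
    proof (rule entire_quotient_of_common_zeros[OF _ _ _ _ enum(2)[unfolded DA] enum(4)[unfolded DB]])
      show "\<exists>z. A.Uneu T z \<noteq> 0" "\<exists>z. B.Uneu T z \<noteq> 0" using nz by auto
    qed (rule hol that; assumption?)+
    have "\<exists>B. \<forall>z. norm (h z) \<le> B"
      by (rule entire_quotient_bounded[where f="A.Uneu T" and g="B.Uneu T" and C=C and a=T and K=KB and c=cB])
         (use h hol up CA(3) CB(3) KB C T in auto)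
    then obtain k where k: "\<And>z. h z = k" using const[OF h(1)] by blast
    have eq: "A.Uneu T z = k * B.Uneu T z" for z using h(2)[of z] k by simp
    have "k = 1" using asym unfolding eq by (intro k1) blast
    then show ?thesis using eq by simp
  qed
  show ?thesis unfolding same_U_def using Udir Uneu by blast
qed

end

theorem theorem2:
  fixes T :: real
    and p q pt qt \<sigma>\<^sub>1 :: "real \<Rightarrow> complex"
    and H\<^sub>1 :: complex
    and lam lam1 lamt lam1t :: "int \<Rightarrow> complex"
  assumes "T > 0"
    and "abs_continuous_on_ivl 0 T p" and "abs_continuous_on_ivl 0 T pt"
    and "q absolutely_integrable_on {0<..<T}" and "qt absolutely_integrable_on {0<..<T}"
    and "integral {0..T} p = integral {0..T} pt"
    and "bounded_variation_on_ivl 0 T \<sigma>\<^sub>1"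
    and "\<And>t. 0 < t \<Longrightarrow> t < T \<Longrightarrow> continuous (at_right t) \<sigma>\<^sub>1"
    and "((\<lambda>t. \<sigma>\<^sub>1 t - \<sigma>\<^sub>1 0) \<longlongrightarrow> H\<^sub>1) (at_right 0)" and "H\<^sub>1 \<noteq> 0"
    and "enumerates_zeros (Delta1 T \<sigma>\<^sub>1 p q) lam"
    and "enumerates_zeros (Delta11 T \<sigma>\<^sub>1 p q) lam1"
    and "enumerates_zeros (Delta1 T \<sigma>\<^sub>1 pt qt) lamt"
    and "enumerates_zeros (Delta11 T \<sigma>\<^sub>1 pt qt) lam1t"
    and "\<And>n. lam n = lamt n" and "\<And>n. lam1 n = lam1t n"
  shows "(\<forall>x\<in>{0<..<T}. p x = pt x) \<and> (AE x in lebesgue. x \<in> {0<..<T} \<longrightarrow> q x = qt x)"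
proof -
  obtain v where v: "\<And>u w. 0 \<le> u \<Longrightarrow> u \<le> w \<Longrightarrow> w \<le> T \<Longrightarrow> norm (\<sigma>\<^sub>1 w - \<sigma>\<^sub>1 u) \<le> v w - v u"
    by (rule bounded_variation_majorant[OF assms(7)], rule that)
  have cp: "continuous_on {0..T} p" and cpt: "continuous_on {0..T} pt"
    using assms(2,3) by (auto simp: abs_continuous_on_ivl_iff_abs_cont intro: abs_cont_continuous)
  have qi: "q absolutely_integrable_on {0..T}" "qt absolutely_integrable_on {0..T}"
    using assms(4,5) absolutely_integrable_on_open_interval[of 0 T] by auto
  interpret nonlocal_pair T p q pt qt \<sigma>\<^sub>1 v H\<^sub>1
    by unfold_locales (use assms(1,9,10) cp cpt qi v in auto)
  have lam: "lamt = lam" "lam1t = lam1" using assms(15,16) by (auto simp: fun_eq_iff)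
  have "same_U T"
    by (rule same_U_of_spectra[OF _ assms(11,12) assms(13,14)[unfolded lam]]) (simp add: A.P_def B.P_def assms(6))
  then obtain N where N: "negligible N" "\<And>x. x \<in> {0<..T} - N \<Longrightarrow> p x = pt x \<and> q x = qt x"
    using same_U_imp_potentials_equal by blast
  have "p x = pt x" if x: "x \<in> {0<..<T}" for x
  proof (rule ccontr)
    assume ne: "p x \<noteq> pt x"
    \<comment> \<open>The set where the continuous functions \<open>p\<close> and \<open>pt\<close> differ is open, so it is empty if it is null.\<close>
    define S where "S = {x \<in> {0<..<T}. p x - pt x \<in> - {0}}"
    have "open S" unfolding S_def Collect_conj_eq
    proof -
      have "continuous_on {0<..<T} (\<lambda>x. p x - pt x)"
        by (intro continuous_intros continuous_on_subset[OF cp] continuous_on_subset[OF cpt]) auto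
      then have "open ({0<..<T} \<inter> (\<lambda>x. p x - pt x) -` (- {0}))"
        by (rule continuous_open_preimage) auto
      moreover have "{0<..<T} \<inter> (\<lambda>x. p x - pt x) -` (- {0}) = {x. x \<in> {0<..<T}} \<inter> {x. p x - pt x \<in> - {0}}" by auto
      ultimately show "open ({x. x \<in> {0<..<T}} \<inter> {x. p x - pt x \<in> - {0}})" by simp
    qed
    moreover have "S \<noteq> {}" using ne x by (auto simp: S_def)
    moreover have "S \<subseteq> N" using N(2) by (fastforce simp: S_def)
    then have "negligible S" using N(1) negligible_subset by blast
    ultimately show False using open_not_negligible by blast
  qed
  moreover have "AE x in lebesgue. x \<in> {0<..<T} \<longrightarrow> q x = qt x"
    unfolding AE_lebesgue_iff_negligible using N by (intro exI[of _ N]) auto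
  ultimately show ?thesis by blast
qed

end
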